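(* Let $G$ be a hyperrigid subset of a unital $C^*$-algebra $\mathcal{A}$, and let $\chi$ be a character of $\mathcal{A}$ such that $G\subseteq\ker\chi$. Suppose that $\pi\colon\mathcal{A}\to B(\mathcal{H})$ and $\rho\colon\mathcal{A}\to B(\mathcal{K})$ are representations of $\mathcal{A}$ on separable Hilbert spaces $\mathcal{H}$ and $\mathcal{K}$, respectively, and $R\in B(\mathcal{H},\mathcal{K})$ is a contraction such that $\pi(g)=R^*\rho(g)R$ for every $g\in G$. Then the following statements hold: (i) $\mathcal{M}_\chi(\pi)$ reduces $\pi$, $R^*R$ and $\triangle_R$; (ii) $\mathcal{L}_\chi:=\bigvee_{a\in\mathcal{A}}\rho(a)R(\mathcal{M}_\chi(\pi))$ and $\mathcal{L}_{\chi_\perp}:=\bigvee_{a\in\mathcal{A}}\rho(a)R(\mathcal{M}_\chi(\pi)^\perp)$ reduce $\rho$; (iii) $\mathcal{L}_\chi=\overline{R(\mathcal{M}_\chi(\pi))}$, $\mathcal{L}_{\chi_\perp}=\overline{R(\mathcal{M}_\chi(\pi)^\perp)}$ and $\mathcal{L}_\chi\perp\mathcal{L}_{\chi_\perp}$; (iv) $R(\mathcal{M}_\chi(\pi))\subseteq\mathcal{M}_\chi(\rho)$ and $\operatorname{ran}(\triangle_R)\subseteq\mathcal{M}_\chi(\pi)$; (v) $(\pi,\rho,R)$ has an isometric $\chi$-decomposition relative to $(\mathcal{H}_0,\mathcal{H}_1,\mathcal{K}_0,\mathcal{K}_1)$, where $\mathcal{H}_0=\mathcal{M}_\chi(\pi)^\perp$,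 $\mathcal{H}_1=\mathcal{M}_\chi(\pi)$, $\mathcal{K}_0=\mathcal{L}_\chi^\perp$ and $\mathcal{K}_1=\mathcal{L}_\chi$; (vi) $R_0\pi(a)|_{\mathcal{H}_0}=\rho(a)|_{\mathcal{K}_0}R_0$ for all $a\in\mathcal{A}$, where $R=R_0\oplus R_1$ is the splitting of $R$ in the decomposition of (v). Moreover, if $\mathcal{K}=\bigvee_{a\in\mathcal{A}}\rho(a)R(\mathcal{H})$, then $\mathcal{L}_{\chi_\perp}=\mathcal{L}_\chi^\perp$ and $R_0$ is unitary, so $(\pi,\rho,R)$ has a unitary $\chi$-decomposition relative to $(\mathcal{H}_0,\mathcal{H}_1,\mathcal{K}_0,\mathcal{K}_1)$.
   Context: All Hilbert spaces are complex. $B(\mathcal{H},\mathcal{K})$ is the space of bounded linear operators from $\mathcal{H}$ to $\mathcal{K}$, $B(\mathcal{H})=B(\mathcal{H},\mathcal{H})$, and $I$ is the identity operator. $\bigvee$ denotes closed linear span. A representation of a unital $C^*$-algebra $\mathcal{A}$ is a unital $*$-homomorphism $\mathcal{A}\to B(\mathcal{H})$; a character is a one-dimensional representation $\chi\colon\mathcal{A}\to\mathbb{C}$. For a representation $\pi\colon\mathcal{A}\to B(\mathcal{H})$ and a character $\chi$, $\mathcal{M}_\chi(\pi):=\bigcap_{a\in\mathcal{A}}\ker(\pi(a)-\chi(a)I)$. A contraction is an operator $R$ with $\|R\|\le 1$; $\triangle_R:=I-R^*R$. A closed subspace reduces $\pi$ if it reduces every $\pi(a)$. UCP means unital completely positive.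 A set $G$ generates the unital $C^*$-algebra $\mathcal{A}$ if $\mathcal{A}$ is the smallest $C^*$-subalgebra of $\mathcal{A}$ containing $G$ and the unit. A finite or countably infinite set $G$ of generators of $\mathcal{A}$ is hyperrigid if for every faithful representation $\pi\colon\mathcal{A}\to B(\mathcal{H})$ on a separable Hilbert space $\mathcal{H}$ and every sequence of UCP maps $\Phi_k\colon B(\mathcal{H})\to B(\mathcal{H})$ ($k\in\mathbb{N}$): if $\lim_{k}\|\Phi_k(\pi(g))-\pi(g)\|=0$ for all $g\in G$, then $\lim_k\|\Phi_k(\pi(a))-\pi(a)\|=0$ for all $a\in\mathcal{A}$. A "hyperrigid subset" is always a finite or countably infinite generating set. Given a character $\chi$ of $\mathcal{A}$, representations $\pi\colon\mathcal{A}\to B(\mathcal{H})$, $\rho\colon\mathcal{A}\to B(\mathcal{K})$, a contraction $R\in B(\mathcal{H},\mathcal{K})$, closed subspaces $\mathcal{H}_0,\mathcal{H}_1$ of $\mathcal{H}$ and $\mathcal{K}_0,\mathcal{K}_1$ of $\mathcal{K}$ (possibly zero), the triple $(\pi,\rho,R)$ has an isometric (resp., unitary) $\chi$-decomposition relative to $(\mathcal{H}_0,\mathcal{H}_1,\mathcal{K}_0,\mathcal{K}_1)$ if: (1) $\mathcal{H}=\mathcal{H}_0\oplus\mathcal{H}_1$ and $\mathcal{K}=\mathcal{K}_0\oplus\mathcal{K}_1$ (orthogonal sums); (2) $\mathcal{H}_0,\mathcal{H}_1$ reduce $\pi$ and $\mathcal{K}_0,\mathcal{K}_1$ reduce $\rho$;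 (3) $\pi(a)|_{\mathcal{H}_1}=\chi(a)I_{\mathcal{H}_1}$ and $\rho(a)|_{\mathcal{K}_1}=\chi(a)I_{\mathcal{K}_1}$ for all $a\in\mathcal{A}$; (4) $R=R_0\oplus R_1$, where $R_0\in B(\mathcal{H}_0,\mathcal{K}_0)$ is isometric (resp., unitary) and $R_1\in B(\mathcal{H}_1,\mathcal{K}_1)$; (5) $\pi(a)|_{\mathcal{H}_0}=R_0^*\rho(a)|_{\mathcal{K}_0}R_0$ for all $a\in\mathcal{A}$. *)

theory Defs
  imports "HOL-Analysis.Analysis"
begin

section \<open>Complex vector spaces, Hilbert spaces and C*-algebras\<close>

class scaleC =
  fixes scaleC :: "complex \<Rightarrow> 'a \<Rightarrow> 'a"  (infixr \<open>*\<^sub>C\<close> 75)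

class complex_vector = real_vector + scaleC +
  assumes scaleC_add_right: "c *\<^sub>C (x + y) = c *\<^sub>C x + c *\<^sub>C y"
    and scaleC_add_left: "(c + d) *\<^sub>C x = c *\<^sub>C x + d *\<^sub>C x"
    and scaleC_scaleC: "c *\<^sub>C d *\<^sub>C x = (c * d) *\<^sub>C x"
    and scaleC_one: "1 *\<^sub>C x = x"
    and scaleR_scaleC: "r *\<^sub>R x = complex_of_real r *\<^sub>C x"

global_interpretation complex_vector:
  vector_space "scaleC :: complex \<Rightarrow> 'a \<Rightarrow> 'a::complex_vector"
  defines csubspace = complex_vector.subspace
    and cspan = complex_vector.span
  by unfold_locales (rule scaleC_add_right scaleC_add_left scaleC_scaleC scaleC_one)+

text \<open>The norm, metric and topology of a complex Hilbert space are those of the underlying real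
  inner product space, whose inner product is the real part of the complex one. The latter is
  linear in its first argument.\<close>

class complex_hilbert_space = complex_vector + real_inner + complete_space +
  fixes cinner :: "'a \<Rightarrow> 'a \<Rightarrow> complex"
  assumes cinner_commute: "cinner x y = cnj (cinner y x)"
    and cinner_add_left: "cinner (x + y) z = cinner x z + cinner y z"
    and cinner_scaleC_left: "cinner (c *\<^sub>C x) y = c * cinner x y"
    and inner_Re_cinner: "inner x y = Re (cinner x y)"

text \<open>The zero algebra is excluded, since the class of real normed algebras with unit
  requires \<open>norm 1 = 1\<close>; it has no characters.\<close>

class unital_cstar_algebra = complex_vector + real_normed_algebra_1 + banach +
  fixes star :: "'a \<Rightarrow> 'a"
  assumes mult_scaleC_left: "(c *\<^sub>C x) * y = c *\<^sub>C (x * y)"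
    and mult_scaleC_right: "x * (c *\<^sub>C y) = c *\<^sub>C (x * y)"
    and norm_scaleC: "norm (c *\<^sub>C x) = cmod c * norm x"
    and star_add: "star (x + y) = star x + star y"
    and star_scaleC: "star (c *\<^sub>C x) = cnj c *\<^sub>C star x"
    and star_mult: "star (x * y) = star y * star x"
    and star_star: "star (star x) = x"
    and cstar_identity: "norm (star x * x) = (norm x)\<^sup>2"

section \<open>The Hilbert space of square-summable complex sequences\<close>

typedef ell2 = "{f :: nat \<Rightarrow> complex. summable (\<lambda>n. (cmod (f n))\<^sup>2)}"
  morphisms ell2_nth Abs_ell2
  by (rule exI[of _ "\<lambda>_. 0"]) simp

setup_lifting type_definition_ell2

lemma ell2_summable: "summable (\<lambda>n. (cmod (ell2_nth x n))\<^sup>2)"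
  using ell2_nth[of x] by simp

lemma ell2_add_bound: "(cmod (a + b))\<^sup>2 \<le> 2 * (cmod a)\<^sup>2 + 2 * (cmod b)\<^sup>2"
proof -
  have "(cmod (a + b))\<^sup>2 \<le> (cmod a + cmod b)\<^sup>2"
    by (intro power_mono norm_triangle_ineq) simp
  also have "\<dots> \<le> 2 * (cmod a)\<^sup>2 + 2 * (cmod b)\<^sup>2"
    using sum_squares_bound[of "cmod a" "cmod b"] by (simp add: power2_sum)
  finally show ?thesis .
qed

lemma ell2_add_summable:
  assumes "summable (\<lambda>n. (cmod (f n))\<^sup>2)" "summable (\<lambda>n. (cmod (g n))\<^sup>2)"
  shows "summable (\<lambda>n. (cmod (f n + g n))\<^sup>2)"
proof (rule summable_comparison_test')
  show "summable (\<lambda>n. 2 * (cmod (f n))\<^sup>2 + 2 * (cmod (g n))\<^sup>2)"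
    using assms by (intro summable_add summable_mult)
qed (use ell2_add_bound in simp)

lemma ell2_scale_summable:
  assumes "summable (\<lambda>n. (cmod (f n))\<^sup>2)"
  shows "summable (\<lambda>n. (cmod (c * f n))\<^sup>2)"
  using summable_mult[OF assms, of "(cmod c)\<^sup>2"] by (simp add: norm_mult power_mult_distrib)

lemma ell2_cinner_summable: "summable (\<lambda>n. ell2_nth x n * cnj (ell2_nth y n))"
proof (rule summable_comparison_test')
  show "summable (\<lambda>n. (cmod (ell2_nth x n))\<^sup>2 + (cmod (ell2_nth y n))\<^sup>2)"
    by (intro summable_add ell2_summable)
  show "norm (ell2_nth x n * cnj (ell2_nth y n))
      \<le> (cmod (ell2_nth x n))\<^sup>2 + (cmod (ell2_nth y n))\<^sup>2" for n
  proof -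
    have "2 * cmod (ell2_nth x n) * cmod (ell2_nth y n)
        \<le> (cmod (ell2_nth x n))\<^sup>2 + (cmod (ell2_nth y n))\<^sup>2"
      by (rule sum_squares_bound)
    moreover have "0 \<le> cmod (ell2_nth x n) * cmod (ell2_nth y n)" by simp
    ultimately show ?thesis unfolding norm_mult complex_mod_cnj by linarith
  qed
qed

instantiation ell2 :: complex_vector
begin

lift_definition zero_ell2 :: ell2 is "\<lambda>_. 0" by simp
lift_definition plus_ell2 :: "ell2 \<Rightarrow> ell2 \<Rightarrow> ell2" is "\<lambda>f g n. f n + g n"
  by (rule ell2_add_summable)
lift_definition minus_ell2 :: "ell2 \<Rightarrow> ell2 \<Rightarrow> ell2" is "\<lambda>f g n. f n - g n"
  subgoal for f g using ell2_add_summable[of f "\<lambda>n. - g n"] by simp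
  done
lift_definition uminus_ell2 :: "ell2 \<Rightarrow> ell2" is "\<lambda>f n. - f n" by simp
lift_definition scaleR_ell2 :: "real \<Rightarrow> ell2 \<Rightarrow> ell2" is "\<lambda>r f n. complex_of_real r * f n"
  by (rule ell2_scale_summable)
lift_definition scaleC_ell2 :: "complex \<Rightarrow> ell2 \<Rightarrow> ell2" is "\<lambda>c f n. c * f n"
  by (rule ell2_scale_summable)

instance
  by standard (transfer; simp add: algebra_simps fun_eq_iff)+

end

lemma ell2_eqI: "(\<And>n. ell2_nth x n = ell2_nth y n) \<Longrightarrow> x = y"
  by (metis ell2_nth_inject ext)

instantiation ell2 :: real_inner
begin

definition inner_ell2 :: "ell2 \<Rightarrow> ell2 \<Rightarrow> real" where
  "inner_ell2 x y = Re (\<Sum>n. ell2_nth x n * cnj (ell2_nth y n))"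
definition norm_ell2 :: "ell2 \<Rightarrow> real" where
  "norm_ell2 x = sqrt (inner x x)"
definition dist_ell2 :: "ell2 \<Rightarrow> ell2 \<Rightarrow> real" where
  "dist_ell2 x y = norm (x - y)"
definition sgn_ell2 :: "ell2 \<Rightarrow> ell2" where
  "sgn_ell2 x = inverse (norm x) *\<^sub>R x"
definition uniformity_ell2 :: "(ell2 \<times> ell2) filter" where
  "uniformity_ell2 = (INF e\<in>{0<..}. principal {(x, y). dist x y < e})"
definition open_ell2 :: "ell2 set \<Rightarrow> bool" where
  "open_ell2 U \<longleftrightarrow> (\<forall>x\<in>U. eventually (\<lambda>(x', y). x' = x \<longrightarrow> y \<in> U) uniformity)"

lemma inner_ell2_Re: "inner x y = (\<Sum>n. Re (ell2_nth x n * cnj (ell2_nth y n)))" for x y :: ell2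
  unfolding inner_ell2_def by (rule Re_suminf[OF ell2_cinner_summable])

lemma inner_ell2_summable: "summable (\<lambda>n. Re (ell2_nth x n * cnj (ell2_nth y n)))" for x y :: ell2
  by (rule summable_Re[OF ell2_cinner_summable])

lemma inner_ell2_self: "inner x x = (\<Sum>n. (cmod (ell2_nth x n))\<^sup>2)" for x :: ell2
  unfolding inner_ell2_Re by (simp add: complex_mult_cnj cmod_power2)

instance
proof
  fix x y z :: ell2 and r :: real
  show "inner x y = inner y x"
    unfolding inner_ell2_Re by (simp add: mult.commute)
  show "inner (x + y) z = inner x z + inner y z"
    using suminf_add[OF inner_ell2_summable[of x z] inner_ell2_summable[of y z]]
    unfolding inner_ell2_Re by (simp add: plus_ell2.rep_eq algebra_simps)
  show "inner (r *\<^sub>R x) y = r * inner x y"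
    using suminf_mult[OF inner_ell2_summable[of x y], of r]
    unfolding inner_ell2_Re by (simp add: scaleR_ell2.rep_eq algebra_simps)
  show "0 \<le> inner x x"
    unfolding inner_ell2_self by (intro suminf_nonneg ell2_summable) simp
  show "inner x x = 0 \<longleftrightarrow> x = 0"
  proof
    assume "inner x x = 0"
    then have "\<forall>n. (cmod (ell2_nth x n))\<^sup>2 = 0"
      unfolding inner_ell2_self using suminf_eq_zero_iff[OF ell2_summable[of x]] by simp
    then show "x = 0" by (intro ell2_eqI) (simp add: zero_ell2.rep_eq)
  qed (simp add: inner_ell2_self zero_ell2.rep_eq)
qed (rule norm_ell2_def dist_ell2_def sgn_ell2_def uniformity_ell2_def open_ell2_def)+

end

lemma norm_ell2_power2: "(norm x)\<^sup>2 = (\<Sum>n. (cmod (ell2_nth x n))\<^sup>2)" for x :: ell2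
  by (simp add: power2_norm_eq_inner inner_ell2_self)

lemma sum_le_norm_ell2: "(\<Sum>n<k. (cmod (ell2_nth x n))\<^sup>2) \<le> (norm x)\<^sup>2" for x :: ell2
  unfolding norm_ell2_power2 by (intro sum_le_suminf ell2_summable) auto

lemma cmod_le_norm_ell2: "cmod (ell2_nth x n) \<le> norm x" for x :: ell2
proof (rule power2_le_imp_le)
  have "0 \<le> (\<Sum>i<n. (cmod (ell2_nth x i))\<^sup>2)" by (rule sum_nonneg) simp
  then show "(cmod (ell2_nth x n))\<^sup>2 \<le> (norm x)\<^sup>2"
    using sum_le_norm_ell2[of x "Suc n"] unfolding sum.lessThan_Suc by linarith
qed simp

instance ell2 :: complete_space
proof
  fix X :: "nat \<Rightarrow> ell2"
  assume X: "Cauchy X"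
  have "Cauchy (\<lambda>m. ell2_nth (X m) n)" for n
  proof (rule CauchyI)
    fix e :: real assume "0 < e"
    then obtain M where "\<forall>i\<ge>M. \<forall>j\<ge>M. norm (X i - X j) < e"
      using X by (metis CauchyD)
    moreover have "norm (ell2_nth (X i) n - ell2_nth (X j) n) \<le> norm (X i - X j)" for i j
      using cmod_le_norm_ell2[of "X i - X j" n] by (simp add: minus_ell2.rep_eq)
    ultimately show "\<exists>M. \<forall>i\<ge>M. \<forall>j\<ge>M. norm (ell2_nth (X i) n - ell2_nth (X j) n) < e"
      by (meson le_less_trans)
  qed
  then have "\<exists>l. (\<lambda>m. ell2_nth (X m) n) \<longlonglongrightarrow> l" for n
    by (simp add: Cauchy_convergent_iff convergent_def)
  then obtain L where L: "\<And>n. (\<lambda>m. ell2_nth (X m) n) \<longlonglongrightarrow> L n"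
    by metis
  have tail: "summable (\<lambda>n. (cmod (ell2_nth (X i) n - L n))\<^sup>2) \<and>
      (\<Sum>n. (cmod (ell2_nth (X i) n - L n))\<^sup>2) \<le> e\<^sup>2"
    if M: "\<forall>i\<ge>M. \<forall>j\<ge>M. norm (X i - X j) < e" and i: "M \<le> i" for M e i
  proof -
    have bound: "(\<Sum>n<k. (cmod (ell2_nth (X i) n - L n))\<^sup>2) \<le> e\<^sup>2" for k
    proof (rule LIMSEQ_le_const2)
      show "(\<lambda>j. \<Sum>n<k. (cmod (ell2_nth (X i) n - ell2_nth (X j) n))\<^sup>2)
          \<longlonglongrightarrow> (\<Sum>n<k. (cmod (ell2_nth (X i) n - L n))\<^sup>2)"
        by (intro tendsto_intros L)
      have "(\<Sum>n<k. (cmod (ell2_nth (X i) n - ell2_nth (X j) n))\<^sup>2) \<le> e\<^sup>2" if "M \<le> j" for j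
      proof -
        have "norm (X i - X j) \<le> e" using M i that by (simp add: less_imp_le)
        then have "(norm (X i - X j))\<^sup>2 \<le> e\<^sup>2" by (intro power_mono) auto
        then show ?thesis
          using sum_le_norm_ell2[of "X i - X j" k] by (simp add: minus_ell2.rep_eq)
      qed
      then show "\<exists>N. \<forall>j\<ge>N. (\<Sum>n<k. (cmod (ell2_nth (X i) n - ell2_nth (X j) n))\<^sup>2) \<le> e\<^sup>2"
        by blast
    qed
    have "summable (\<lambda>n. (cmod (ell2_nth (X i) n - L n))\<^sup>2)"
      by (rule summableI_nonneg_bounded[OF _ bound]) simp
    then show ?thesis using bound by (auto intro: suminf_le_const)
  qed
  obtain M where "\<forall>i\<ge>M. \<forall>j\<ge>M. norm (X i - X j) < 1"
    using X by (metis CauchyD zero_less_one)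
  then have "summable (\<lambda>n. (cmod (ell2_nth (X M) n - L n))\<^sup>2)"
    using tail by blast
  then have "summable (\<lambda>n. (cmod (ell2_nth (X M) n + - (ell2_nth (X M) n - L n)))\<^sup>2)"
    by (intro ell2_add_summable ell2_summable) (simp only: norm_minus_cancel)
  then have nthL: "ell2_nth (Abs_ell2 L) = L"
    by (simp add: Abs_ell2_inverse)
  have "X \<longlonglongrightarrow> Abs_ell2 L"
  proof (rule LIMSEQ_I)
    fix e :: real assume "0 < e"
    then obtain N where N: "\<forall>i\<ge>N. \<forall>j\<ge>N. norm (X i - X j) < e / 2"
      using X by (metis CauchyD half_gt_zero)
    have "norm (X i - Abs_ell2 L) < e" if "N \<le> i" for i
    proof -
      have "(norm (X i - Abs_ell2 L))\<^sup>2 \<le> (e / 2)\<^sup>2"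
        using tail[OF N that] by (simp add: norm_ell2_power2 minus_ell2.rep_eq nthL)
      then have "norm (X i - Abs_ell2 L) \<le> e / 2"
        by (rule power2_le_imp_le) (use \<open>0 < e\<close> in simp)
      then show ?thesis using \<open>0 < e\<close> by simp
    qed
    then show "\<exists>N. \<forall>i\<ge>N. norm (X i - Abs_ell2 L) < e" by blast
  qed
  then show "convergent X" by (rule convergentI)
qed

instantiation ell2 :: complex_hilbert_space
begin

definition cinner_ell2 :: "ell2 \<Rightarrow> ell2 \<Rightarrow> complex" where
  "cinner_ell2 x y = (\<Sum>n. ell2_nth x n * cnj (ell2_nth y n))"

instance
proof
  fix x y z :: ell2 and c :: complex
  have "(\<lambda>n. cnj (ell2_nth y n * cnj (ell2_nth x n))) sums cnj (cinner y x)"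
    unfolding cinner_ell2_def sums_cnj by (rule summable_sums[OF ell2_cinner_summable])
  then show "cinner x y = cnj (cinner y x)"
    unfolding cinner_ell2_def[of x y] by (simp add: sums_iff mult.commute)
  show "cinner (x + y) z = cinner x z + cinner y z"
    using suminf_add[OF ell2_cinner_summable[of x z] ell2_cinner_summable[of y z]]
    unfolding cinner_ell2_def by (simp add: plus_ell2.rep_eq algebra_simps)
  show "cinner (c *\<^sub>C x) y = c * cinner x y"
    using suminf_mult[OF ell2_cinner_summable[of x y], of c]
    unfolding cinner_ell2_def by (simp add: scaleC_ell2.rep_eq algebra_simps)
  show "inner x y = Re (cinner x y)"
    by (simp add: inner_ell2_def cinner_ell2_def)
qed

end

section \<open>Operators\<close>

text \<open>A Hilbert space is given either as a type of class \<^class>\<open>complex_hilbert_space\<close> or,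
  when it has to vary or is a summand of another one, as a closed subspace of such a type.\<close>

definition closed_csubspace :: "'h::complex_hilbert_space set \<Rightarrow> bool" where
  "closed_csubspace M \<longleftrightarrow> csubspace M \<and> closed M"

definition orthogonal_sets :: "'h::complex_hilbert_space set \<Rightarrow> 'h set \<Rightarrow> bool" where
  "orthogonal_sets M N \<longleftrightarrow> (\<forall>x\<in>M. \<forall>y\<in>N. cinner x y = 0)"

definition orth_compl :: "'h::complex_hilbert_space set \<Rightarrow> 'h set" where
  "orth_compl M = {x. \<forall>y\<in>M. cinner x y = 0}"

definition closed_cspan :: "'h::complex_hilbert_space set \<Rightarrow> 'h set" where
  "closed_cspan S = closure (cspan S)"

definition bounded_clinear ::
  "('h::complex_hilbert_space \<Rightarrow> 'k::complex_hilbert_space) \<Rightarrow> bool" where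
  "bounded_clinear T \<longleftrightarrow> bounded_linear T \<and> (\<forall>c x. T (c *\<^sub>C x) = c *\<^sub>C T x)"

text \<open>For closed subspaces \<open>H\<close> and \<open>K\<close>, the space \<open>B(H,K)\<close> is realised isometrically as a space
  of operators between the ambient spaces, an operator from \<open>H\<close> to \<open>K\<close> being extended by zero to
  the orthogonal complement of \<open>H\<close>. Then sums, composition, adjoint and operator norm are those of
  the ambient operators, and the identity of \<open>H\<close> becomes the orthogonal projection onto \<open>H\<close>.\<close>

definition operators ::
  "'h::complex_hilbert_space set \<Rightarrow> 'k::complex_hilbert_space set \<Rightarrow> ('h \<Rightarrow> 'k) set" where
  "operators H K = {T. bounded_clinear T \<and> range T \<subseteq> K \<and> (\<forall>x\<in>orth_compl H. T x = 0)}"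

definition identity_on :: "'h::complex_hilbert_space set \<Rightarrow> 'h \<Rightarrow> 'h" where
  "identity_on H x = (THE y. y \<in> H \<and> x - y \<in> orth_compl H)"

definition cadjoint ::
  "('h::complex_hilbert_space \<Rightarrow> 'k::complex_hilbert_space) \<Rightarrow> 'k \<Rightarrow> 'h" where
  "cadjoint T = (THE S. \<forall>x y. cinner (T x) y = cinner x (S y))"

definition contraction ::
  "('h::complex_hilbert_space \<Rightarrow> 'k::complex_hilbert_space) \<Rightarrow> bool" where
  "contraction R \<longleftrightarrow> bounded_clinear R \<and> onorm R \<le> 1"

definition defect ::
  "('h::complex_hilbert_space \<Rightarrow> 'k::complex_hilbert_space) \<Rightarrow> 'h \<Rightarrow> 'h" where
  "defect R = (\<lambda>x. x - cadjoint R (R x))"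

definition isometric_op ::
  "'h::complex_hilbert_space set \<Rightarrow> 'k::complex_hilbert_space set \<Rightarrow> ('h \<Rightarrow> 'k) \<Rightarrow> bool" where
  "isometric_op H K V \<longleftrightarrow> V \<in> operators H K \<and> cadjoint V \<circ> V = identity_on H"

definition unitary_op ::
  "'h::complex_hilbert_space set \<Rightarrow> 'k::complex_hilbert_space set \<Rightarrow> ('h \<Rightarrow> 'k) \<Rightarrow> bool" where
  "unitary_op H K U \<longleftrightarrow> U \<in> operators H K \<and>
     cadjoint U \<circ> U = identity_on H \<and> U \<circ> cadjoint U = identity_on K"

definition reduces :: "'h::complex_hilbert_space set \<Rightarrow> ('h \<Rightarrow> 'h) \<Rightarrow> bool" where
  "reduces M T \<longleftrightarrow> closed_csubspace M \<and> T ` M \<subseteq> M \<and> T ` orth_compl M \<subseteq> orth_compl M"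

definition reduces_rep ::
  "'h::complex_hilbert_space set \<Rightarrow> ('a \<Rightarrow> 'h \<Rightarrow> 'h) \<Rightarrow> bool" where
  "reduces_rep M \<pi> \<longleftrightarrow> (\<forall>a. reduces M (\<pi> a))"

text \<open>A map is completely positive if, for every \<open>n\<close>, it maps positive matrices over \<open>B(H)\<close> to
  positive ones entrywise, where an \<open>n \<times> n\<close> matrix over \<open>B(H)\<close> is regarded as an operator on the
  \<open>n\<close>-fold direct sum of \<open>H\<close>.\<close>

definition positive_op_matrix ::
  "'h::complex_hilbert_space set \<Rightarrow> nat \<Rightarrow> (nat \<Rightarrow> nat \<Rightarrow> 'h \<Rightarrow> 'h) \<Rightarrow> bool" where
  "positive_op_matrix H n T \<longleftrightarrow>
     (\<forall>x. (\<forall>i<n. x i \<in> H) \<longrightarrow>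
        (\<Sum>i<n. \<Sum>j<n. cinner (T i j (x j)) (x i)) \<in> \<real>\<^sub>\<ge>\<^sub>0)"

definition ucp_map ::
  "'h::complex_hilbert_space set \<Rightarrow> (('h \<Rightarrow> 'h) \<Rightarrow> ('h \<Rightarrow> 'h)) \<Rightarrow> bool" where
  "ucp_map H \<Phi> \<longleftrightarrow>
     (\<forall>T\<in>operators H H. \<Phi> T \<in> operators H H) \<and>
     (\<forall>S\<in>operators H H. \<forall>T\<in>operators H H. \<Phi> (\<lambda>x. S x + T x) = (\<lambda>x. \<Phi> S x + \<Phi> T x)) \<and>
     (\<forall>c. \<forall>T\<in>operators H H. \<Phi> (\<lambda>x. c *\<^sub>C T x) = (\<lambda>x. c *\<^sub>C \<Phi> T x)) \<and>
     \<Phi> (identity_on H) = identity_on H \<and>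
     (\<forall>n T. (\<forall>i<n. \<forall>j<n. T i j \<in> operators H H) \<longrightarrow> positive_op_matrix H n T \<longrightarrow>
        positive_op_matrix H n (\<lambda>i j. \<Phi> (T i j)))"

section \<open>Representations, characters and hyperrigidity\<close>

definition cstar_representation ::
  "'h::complex_hilbert_space set \<Rightarrow> ('a::unital_cstar_algebra \<Rightarrow> 'h \<Rightarrow> 'h) \<Rightarrow> bool" where
  "cstar_representation H \<pi> \<longleftrightarrow>
     (\<forall>a. \<pi> a \<in> operators H H) \<and>
     (\<forall>a b. \<pi> (a + b) = (\<lambda>x. \<pi> a x + \<pi> b x)) \<and>
     (\<forall>c a. \<pi> (c *\<^sub>C a) = (\<lambda>x. c *\<^sub>C \<pi> a x)) \<and>
     (\<forall>a b. \<pi> (a * b) = \<pi> a \<circ> \<pi> b) \<and>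
     (\<forall>a. \<pi> (star a) = cadjoint (\<pi> a)) \<and>
     \<pi> 1 = identity_on H"

definition character :: "('a::unital_cstar_algebra \<Rightarrow> complex) \<Rightarrow> bool" where
  "character chi \<longleftrightarrow>
     (\<forall>a b. chi (a + b) = chi a + chi b) \<and>
     (\<forall>c a. chi (c *\<^sub>C a) = c * chi a) \<and>
     (\<forall>a b. chi (a * b) = chi a * chi b) \<and>
     (\<forall>a. chi (star a) = cnj (chi a)) \<and>
     chi 1 = 1"

definition cstar_subalgebra :: "'a::unital_cstar_algebra set \<Rightarrow> bool" where
  "cstar_subalgebra B \<longleftrightarrow> csubspace B \<and> closed B \<and>
     (\<forall>a\<in>B. \<forall>b\<in>B. a * b \<in> B) \<and> (\<forall>a\<in>B. star a \<in> B)"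

definition generates :: "'a::unital_cstar_algebra set \<Rightarrow> bool" where
  "generates G \<longleftrightarrow> \<Inter>{B. cstar_subalgebra B \<and> insert 1 G \<subseteq> B} = UNIV"

text \<open>Up to unitary equivalence, the separable Hilbert spaces are exactly the closed subspaces of
  \<^typ>\<open>ell2\<close>; these stand for all separable Hilbert spaces, over which HOL cannot quantify inside a
  definition.\<close>

definition hyperrigid :: "'a::unital_cstar_algebra set \<Rightarrow> bool" where
  "hyperrigid G \<longleftrightarrow> countable G \<and> generates G \<and>
     (\<forall>(H :: ell2 set) \<pi> \<Phi>.
        closed_csubspace H \<longrightarrow> cstar_representation H \<pi> \<longrightarrow> inj \<pi> \<longrightarrow>
        (\<forall>k::nat. ucp_map H (\<Phi> k)) \<longrightarrow>
        (\<forall>g\<in>G. (\<lambda>k. onorm (\<lambda>x. \<Phi> k (\<pi> g) x - \<pi> g x)) \<longlonglongrightarrow> 0) \<longrightarrow>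
        (\<forall>a. (\<lambda>k. onorm (\<lambda>x. \<Phi> k (\<pi> a) x - \<pi> a x)) \<longlonglongrightarrow> 0))"

section \<open>Decompositions relative to a character\<close>

definition chi_space ::
  "('a \<Rightarrow> complex) \<Rightarrow> ('a \<Rightarrow> 'h \<Rightarrow> 'h) \<Rightarrow> 'h::complex_hilbert_space set" where
  "chi_space chi \<pi> = (\<Inter>a. {x. \<pi> a x - chi a *\<^sub>C x = 0})"

definition orthogonal_sum ::
  "'h::complex_hilbert_space set \<Rightarrow> 'h set \<Rightarrow> bool" where
  "orthogonal_sum H0 H1 \<longleftrightarrow> closed_csubspace H0 \<and> closed_csubspace H1 \<and>
     orthogonal_sets H0 H1 \<and> (\<forall>x. \<exists>x0\<in>H0. \<exists>x1\<in>H1. x = x0 + x1)"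

definition splits_as ::
  "('h::complex_hilbert_space \<Rightarrow> 'k::complex_hilbert_space) \<Rightarrow>
   'h set \<Rightarrow> 'h set \<Rightarrow> 'k set \<Rightarrow> 'k set \<Rightarrow> ('h \<Rightarrow> 'k) \<Rightarrow> ('h \<Rightarrow> 'k) \<Rightarrow> bool" where
  "splits_as R H0 H1 K0 K1 R0 R1 \<longleftrightarrow>
     R0 \<in> operators H0 K0 \<and> R1 \<in> operators H1 K1 \<and> R = (\<lambda>x. R0 x + R1 x)"

text \<open>The first argument of \<open>chi_decomposition\<close> is the property required of the summand \<open>R0\<close>.
  Restrictions of operators to \<open>H0\<close>, \<open>H1\<close> and \<open>K1\<close> are compared pointwise.\<close>

definition chi_decomposition ::
  "('h::complex_hilbert_space set \<Rightarrow> 'k::complex_hilbert_space set \<Rightarrow> ('h \<Rightarrow> 'k) \<Rightarrow> bool) \<Rightarrow>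
   ('a \<Rightarrow> complex) \<Rightarrow> ('a \<Rightarrow> 'h \<Rightarrow> 'h) \<Rightarrow> ('a \<Rightarrow> 'k \<Rightarrow> 'k) \<Rightarrow> ('h \<Rightarrow> 'k) \<Rightarrow>
   'h set \<Rightarrow> 'h set \<Rightarrow> 'k set \<Rightarrow> 'k set \<Rightarrow> bool" where
  "chi_decomposition P chi \<pi> \<rho> R H0 H1 K0 K1 \<longleftrightarrow>
     orthogonal_sum H0 H1 \<and> orthogonal_sum K0 K1 \<and>
     reduces_rep H0 \<pi> \<and> reduces_rep H1 \<pi> \<and> reduces_rep K0 \<rho> \<and> reduces_rep K1 \<rho> \<and>
     (\<forall>a. \<forall>x\<in>H1. \<pi> a x = chi a *\<^sub>C x) \<and> (\<forall>a. \<forall>y\<in>K1. \<rho> a y = chi a *\<^sub>C y) \<and>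
     (\<exists>R0 R1. splits_as R H0 H1 K0 K1 R0 R1 \<and> P H0 K0 R0 \<and>
        (\<forall>a. \<forall>x\<in>H0. \<pi> a x = cadjoint R0 (\<rho> a (R0 x))))"

abbreviation "isometric_chi_decomposition \<equiv> chi_decomposition isometric_op"
abbreviation "unitary_chi_decomposition \<equiv> chi_decomposition unitary_op"

definition cyclic_span ::
  "('a \<Rightarrow> 'k \<Rightarrow> 'k) \<Rightarrow> ('h \<Rightarrow> 'k) \<Rightarrow> 'h set \<Rightarrow> 'k::complex_hilbert_space set" where
  "cyclic_span \<rho> R M = closed_cspan (\<Union>a. \<rho> a ` R ` M)"

end

theory Submission
  imports Defs
begin

text \<open>
Everything follows from one identity: for all \<open>a\<close>,
\<open>\<pi>(a) = R\<^sup>*\<rho>(a)R + \<chi>(a)\<triangle>\<^sub>R\<close> (lemma \<open>hyperrigid_compression\<close>). The right-hand side is a unital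
completely positive map that agrees with \<open>\<pi>\<close> on \<open>G\<close>, because \<open>\<chi>\<close> vanishes there, and
hyperrigidity should force it to agree with \<open>\<pi>\<close> everywhere. Hyperrigidity speaks of UCP maps on
the whole of \<open>B(H)\<close> for a faithful representation, so the two maps are realised as a corner: on the
direct sum of a faithful representation with \<open>\<pi>\<close>, \<open>\<rho>\<close> and a multiple of \<open>\<chi>\<close> there are
operators \<open>K\<close>, \<open>L\<close> with \<open>K\<^sup>*K + L\<^sup>*L = I\<close> such that \<open>T \<mapsto> K\<^sup>*TK + L\<^sup>*TL\<close> replaces the summand
\<open>\<pi>\<close> by \<open>R\<^sup>*\<rho>R + \<chi>\<triangle>\<^sub>R\<close> and leaves the others alone. A constant sequence of UCP maps then does the
job. The multiple of \<open>\<chi>\<close> lives on the completion of \<open>H\<close> for the form \<open>\<langle>\<triangle>\<^sub>R x, x'\<rangle>\<close>; the canonical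
map of \<open>H\<close> into it plays the role of the square root of \<open>\<triangle>\<^sub>R\<close>.

If no faithful representation on a separable space existed, hyperrigidity would be void. Hence the
Gelfand--Naimark theorem for separable algebras has to be established. Its heart is that \<open>x\<^sup>*x\<close> is
positive (\<open>positive_element_star_mult\<close>). Positivity is expressed through the norm, and functional
calculus is reduced to the square root, given by the binomial series of \<open>\<surd>(1 - y)\<close>, which still
converges for \<open>\<parallel>y\<parallel> = 1\<close>. Hahn--Banach functionals then yield a faithful positive functional
(\<open>faithful_positive_functional\<close>), and the completion of the associated semi-inner product space is
carried out inside the space of square-summable sequences by Gram--Schmidt orthogonalisation
(\<open>ell2_embedding\<close>), simultaneously for all four summands.

Given the identity, let \<open>a \<in> ker \<chi>\<close> and \<open>w = \<rho>(a)Rx\<close>. Comparing \<open>\<pi>(a\<^sup>*a)\<close> with \<open>\<pi>(a)\<^sup>*\<pi>(a)\<close> gives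
\<open>\<parallel>R\<^sup>*w\<parallel> = \<parallel>w\<parallel>\<close>, so \<open>w = RR\<^sup>*w\<close>, which says \<open>\<rho>(a)R = R\<pi>(a)\<close>; this extends to all \<open>a\<close>
(\<open>intertwines\<close>). Inserting it back yields \<open>\<triangle>\<^sub>R\<pi>(a) = 0\<close> on \<open>ker \<chi>\<close>, so the range of
\<open>\<triangle>\<^sub>R\<close> lies in \<open>\<M>\<^sub>\<chi>(\<pi>)\<close> (\<open>defect_in_chi_space\<close>) and \<open>R\<close> is isometric on
\<open>\<M>\<^sub>\<chi>(\<pi>)\<^sup>\<bottom>\<close>. The remaining assertions are Hilbert space geometry.
\<close>

section \<open>Positive elements of a C*-algebra\<close>

subsection \<open>Scalars and the involution\<close>

lemma scaleC_zero_right [simp]: "c *\<^sub>C 0 = (0::'a::complex_vector)"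
  using scaleC_add_right[of c 0 0] by simp

lemma scaleC_zero_left [simp]: "0 *\<^sub>C x = (0::'a::complex_vector)"
  using scaleC_add_left[of 0 0 x] by simp

lemma scaleC_minus_left: "(- c) *\<^sub>C x = - (c *\<^sub>C (x::'a::complex_vector))"
  using scaleC_add_left[of "-c" c x] by (simp add: eq_neg_iff_add_eq_0)

lemma scaleC_minus_right: "c *\<^sub>C (- x) = - (c *\<^sub>C (x::'a::complex_vector))"
  using scaleC_add_right[of c "-x" x] by (simp add: eq_neg_iff_add_eq_0)

lemma scaleC_diff_right: "c *\<^sub>C (x - y) = c *\<^sub>C x - c *\<^sub>C (y::'a::complex_vector)"
  using scaleC_add_right[of c x "-y"] by (simp add: scaleC_minus_right)

lemma scaleC_diff_left: "(c - d) *\<^sub>C x = c *\<^sub>C x - d *\<^sub>C (x::'a::complex_vector)"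
  using scaleC_add_left[of c "-d" x] by (simp add: scaleC_minus_left)

declare scaleC_one [simp] scaleC_scaleC [simp]

lemma additive_star: "Modules.additive (star :: 'a \<Rightarrow> 'a::unital_cstar_algebra)"
  by unfold_locales (rule star_add)

lemmas star_zero [simp] = Modules.additive.zero[OF additive_star]
  and star_minus = Modules.additive.minus[OF additive_star]
  and star_diff = Modules.additive.diff[OF additive_star]

declare star_star [simp]

lemma star_one [simp]: "star (1::'a::unital_cstar_algebra) = 1"
  by (metis mult.right_neutral star_mult star_star)

lemma star_scaleR: "star (r *\<^sub>R x) = r *\<^sub>R star (x::'a::unital_cstar_algebra)"
  by (simp add: scaleR_scaleC star_scaleC)

lemma star_power: "star (x ^ n) = star (x::'a::unital_cstar_algebra) ^ n"
  by (induction n) (simp_all add: star_mult power_commutes)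

lemma norm_star [simp]: "norm (star x) = norm (x::'a::unital_cstar_algebra)"
proof -
  have le: "norm y \<le> norm (star y)" for y :: 'a
  proof (cases "y = 0")
    case False
    have "norm y * norm y \<le> norm (star y) * norm y"
      using norm_mult_ineq[of "star y" y] by (simp add: cstar_identity power2_eq_square)
    then show ?thesis using False by simp
  qed simp
  show ?thesis using le[of x] le[of "star x"] by simp
qed

lemma bounded_linear_star: "bounded_linear (star :: 'a \<Rightarrow> 'a::unital_cstar_algebra)"
  by (rule bounded_linear_intro[of _ 1]) (simp_all add: star_add star_scaleR)

lemma norm_square_selfadjoint: "star h = h \<Longrightarrow> norm (h * h) = (norm (h::'a::unital_cstar_algebra))\<^sup>2"
  using cstar_identity[of h] by simp

subsection \<open>The square root of one minus a contraction\<close>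

text \<open>The Taylor coefficients of \<open>\<surd>(1 - x)\<close> at \<open>0\<close>.\<close>

definition sqrt_coeff :: "nat \<Rightarrow> real" where
  "sqrt_coeff n = (-1) ^ n * ((1/2) gchoose n)"

lemma sqrt_coeff_0 [simp]: "sqrt_coeff 0 = 1"
  by (simp add: sqrt_coeff_def)

lemma sqrt_coeff_Suc: "real (Suc n) * sqrt_coeff (Suc n) = (real n - 1/2) * sqrt_coeff n"
proof -
  have "real (Suc n) * ((1/2) gchoose Suc n) = (1/2 - real n) * ((1/2) gchoose n)"
    using gbinomial_absorb_comp[of "1/2 :: real" n] gbinomial_absorption[of n "1/2 :: real"]
    by simp
  then have "(-1) ^ n * (real (Suc n) * ((1/2) gchoose Suc n))
      = (-1) ^ n * ((1/2 - real n) * ((1/2) gchoose n))" by (simp only:)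
  then show ?thesis by (simp add: sqrt_coeff_def algebra_simps)
qed

lemma sqrt_coeff_neg: "sqrt_coeff (Suc n) \<le> 0"
proof (induction n)
  case 0
  then show ?case using sqrt_coeff_Suc[of 0] by simp
next
  case (Suc n)
  have "real (Suc (Suc n)) * sqrt_coeff (Suc (Suc n)) \<le> 0"
    unfolding sqrt_coeff_Suc[of "Suc n"] using Suc by (intro mult_nonneg_nonpos) auto
  then show ?case by (simp add: mult_le_0_iff)
qed

text \<open>For \<open>0 \<le> x < 1\<close> the series of \<open>1 - \<surd>(1 - x) \<le> 1\<close> has nonnegative terms, so its partial sums
  are at most \<open>1\<close>; let \<open>x\<close> tend to \<open>1\<close>. This gives absolute convergence on the closed unit ball, so
  that square roots of positive elements exist exactly and not only up to a small error.\<close>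

lemma sqrt_coeff_sum_le: "(\<Sum>n<N. - sqrt_coeff (Suc n)) \<le> 1"
proof -
  have less1: "(\<Sum>n<N. - sqrt_coeff (Suc n) * x ^ Suc n) \<le> 1" if x: "0 \<le> x" "x < 1" for x :: real
  proof -
    have *: "(\<lambda>n. sqrt_coeff n * x ^ n) sums sqrt (1 - x)"
      using sqrt_series[of "- x"] x
      by (simp add: sqrt_coeff_def power_minus[of x] mult_ac)
    have "(\<lambda>n. - (sqrt_coeff (Suc n) * x ^ Suc n)) sums - (sqrt (1 - x) - 1)"
      using * by (intro sums_minus) (subst sums_Suc_iff, simp)
    then have s: "(\<lambda>n. - sqrt_coeff (Suc n) * x ^ Suc n) sums (1 - sqrt (1 - x))"
      by simp
    have "(\<Sum>n<N. - sqrt_coeff (Suc n) * x ^ Suc n) \<le> (\<Sum>n. - sqrt_coeff (Suc n) * x ^ Suc n)"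
      using s x sqrt_coeff_neg by (intro sum_le_suminf) (auto simp: sums_iff intro!: mult_nonpos_nonneg)
    also have "\<dots> = 1 - sqrt (1 - x)" using s by (simp add: sums_iff)
    also have "\<dots> \<le> 1" using x by simp
    finally show ?thesis .
  qed
  have "((\<lambda>x. \<Sum>n<N. - sqrt_coeff (Suc n) * x ^ Suc n) \<longlongrightarrow> (\<Sum>n<N. - sqrt_coeff (Suc n) * 1 ^ Suc n))
      (at_left (1::real))"
    by (intro tendsto_intros)
  moreover have "\<forall>\<^sub>F x in at_left (1::real). (\<Sum>n<N. - sqrt_coeff (Suc n) * x ^ Suc n) \<le> 1"
    unfolding eventually_at_left_field using less1 by (intro exI[of _ 0]) auto
  ultimately show ?thesis
    using tendsto_upperbound by fastforce
qed

lemma summable_sqrt_coeff: "summable (\<lambda>n. - sqrt_coeff (Suc n))"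
  by (rule summableI_nonneg_bounded[OF _ sqrt_coeff_sum_le]) (use sqrt_coeff_neg in simp)

lemma summable_abs_sqrt_coeff: "summable (\<lambda>n. \<bar>sqrt_coeff n\<bar>)"
  using summable_sqrt_coeff sqrt_coeff_neg by (subst summable_Suc_iff[symmetric]) simp

text \<open>Vandermonde's identity for the exponents \<open>1/2 + 1/2 = 1\<close>: the formal square of the series is
  \<open>1 - x\<close>.\<close>

lemma sqrt_coeff_convolution:
  "(\<Sum>i\<le>n. sqrt_coeff i * sqrt_coeff (n - i)) = (if n = 0 then 1 else if n = 1 then - 1 else 0)"
proof -
  have "(\<Sum>i\<le>n. sqrt_coeff i * sqrt_coeff (n - i))
      = (\<Sum>i\<le>n. (-1) ^ n * (((1/2) gchoose i) * ((1/2) gchoose (n - i))))"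
    by (intro sum.cong) (auto simp: sqrt_coeff_def simp flip: power_add)
  also have "\<dots> = (-1) ^ n * ((1::real) gchoose n)"
    using gbinomial_Vandermonde[of "1/2 :: real" "1/2" n]
    by (simp add: atMost_atLeast0 flip: sum_distrib_left)
  also have "(1::real) gchoose n = real (1 choose n)"
    by (metis binomial_gbinomial of_nat_1)
  finally show ?thesis by (cases n) auto
qed

definition sqrt_one_minus :: "'a::unital_cstar_algebra \<Rightarrow> 'a" where
  "sqrt_one_minus y = (\<Sum>n. sqrt_coeff n *\<^sub>R y ^ n)"

context
  fixes y :: "'a::unital_cstar_algebra"
  assumes norm_y: "norm y \<le> 1"
begin

lemma norm_power_le_1: "norm (y ^ n) \<le> 1"
  by (rule order_trans[OF norm_power_ineq]) (use norm_y in \<open>simp add: power_le_one\<close>)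

lemma summable_norm_sqrt: "summable (\<lambda>n. norm (sqrt_coeff n *\<^sub>R y ^ n))"
  using norm_power_le_1
  by (intro summable_comparison_test'[OF summable_abs_sqrt_coeff]) (simp add: mult_left_le)

lemma summable_sqrt: "summable (\<lambda>n. sqrt_coeff n *\<^sub>R y ^ n)"
  using summable_norm_cancel[OF summable_norm_sqrt] .

lemma sqrt_one_minus_square: "sqrt_one_minus y * sqrt_one_minus y = 1 - y"
proof -
  have "(\<lambda>n. \<Sum>i\<le>n. (sqrt_coeff i *\<^sub>R y ^ i) * (sqrt_coeff (n - i) *\<^sub>R y ^ (n - i)))
      sums (sqrt_one_minus y * sqrt_one_minus y)"
    unfolding sqrt_one_minus_def by (intro Cauchy_product_sums summable_norm_sqrt)
  moreover have "(\<Sum>i\<le>n. (sqrt_coeff i *\<^sub>R y ^ i) * (sqrt_coeff (n - i) *\<^sub>R y ^ (n - i)))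
      = (if n = 0 then 1 else if n = 1 then - y else 0)" for n
  proof -
    have "(\<Sum>i\<le>n. (sqrt_coeff i *\<^sub>R y ^ i) * (sqrt_coeff (n - i) *\<^sub>R y ^ (n - i)))
      = (\<Sum>i\<le>n. sqrt_coeff i * sqrt_coeff (n - i)) *\<^sub>R y ^ n"
      unfolding scaleR_left.sum by (intro sum.cong) (simp_all flip: power_add)
    then show ?thesis unfolding sqrt_coeff_convolution by simp
  qed
  ultimately have "(\<lambda>n. if n = 0 then 1 else if n = 1 then - y else 0)
      sums (sqrt_one_minus y * sqrt_one_minus y)" by simp
  moreover have "(\<lambda>n. if n = 0 then 1 else if n = 1 then - y else 0)
      sums (\<Sum>n\<in>{0,1::nat}. if n = 0 then 1 else if n = 1 then - y else 0)"
    by (rule sums_finite) auto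
  ultimately show ?thesis using sums_unique2 by fastforce
qed

lemma star_sqrt_one_minus: "star y = y \<Longrightarrow> star (sqrt_one_minus y) = sqrt_one_minus y"
  unfolding sqrt_one_minus_def bounded_linear.suminf[OF bounded_linear_star summable_sqrt]
  by (simp add: star_scaleR star_power)

lemma sqrt_one_minus_commutes:
  assumes "z * y = y * z"
  shows "z * sqrt_one_minus y = sqrt_one_minus y * z"
proof -
  have "z * y ^ n = y ^ n * z" for n
    using assms by (induction n) (auto simp: mult.assoc, metis mult.assoc)
  then show ?thesis
    unfolding sqrt_one_minus_def suminf_mult[OF summable_sqrt, symmetric] suminf_mult2[OF summable_sqrt]
    by simp
qed

text \<open>After the constant term \<open>1\<close>, all coefficients are at most \<open>0\<close> and their sum is at least \<open>-1\<close>.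
  Consequently the square root is a positive element itself.\<close>

lemma norm_one_minus_sqrt: "norm (1 - sqrt_one_minus y) \<le> 1"
proof -
  have s: "summable (\<lambda>n. norm (sqrt_coeff (Suc n) *\<^sub>R y ^ Suc n))"
    using summable_norm_sqrt by (subst summable_Suc_iff)
  have "sqrt_one_minus y = 1 + (\<Sum>n. sqrt_coeff (Suc n) *\<^sub>R y ^ Suc n)"
    unfolding sqrt_one_minus_def using suminf_split_head[OF summable_sqrt] by simp
  then have "norm (1 - sqrt_one_minus y) = norm (\<Sum>n. sqrt_coeff (Suc n) *\<^sub>R y ^ Suc n)"
    by simp
  also have "\<dots> \<le> (\<Sum>n. norm (sqrt_coeff (Suc n) *\<^sub>R y ^ Suc n))"
    by (rule summable_norm[OF s])
  also have "\<dots> \<le> (\<Sum>n. - sqrt_coeff (Suc n))"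
    by (rule suminf_le[OF _ s summable_sqrt_coeff])
      (use mult_left_mono_neg[OF norm_power_le_1 sqrt_coeff_neg] sqrt_coeff_neg
        in \<open>simp add: abs_of_nonpos del: power_Suc\<close>)
  also have "\<dots> \<le> 1"
    by (rule suminf_le_const[OF summable_sqrt_coeff sqrt_coeff_sum_le])
  finally show ?thesis .
qed

end

subsection \<open>The positive cone\<close>

text \<open>For selfadjoint \<open>h\<close> the norm condition says that the spectrum is contained in \<open>[0, 2t]\<close>, so this
  is the usual notion of positivity. In this form sums of positive elements are positive by the
  triangle inequality.\<close>

definition positive_element :: "'a::unital_cstar_algebra \<Rightarrow> bool" where
  "positive_element h \<longleftrightarrow> star h = h \<and> (\<exists>t\<ge>0. norm (t *\<^sub>R 1 - h) \<le> t)"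

lemma positive_elementI:
  "star h = h \<Longrightarrow> 0 \<le> t \<Longrightarrow> norm (t *\<^sub>R 1 - h) \<le> t \<Longrightarrow> positive_element h"
  by (auto simp: positive_element_def)

lemma positive_element_selfadjoint: "positive_element h \<Longrightarrow> star h = h"
  by (simp add: positive_element_def)

lemma positive_element_add:
  assumes "positive_element h" "positive_element k"
  shows "positive_element (h + k)"
proof -
  from assms obtain s t where "0 \<le> s" "norm (s *\<^sub>R 1 - h) \<le> s" "0 \<le> t" "norm (t *\<^sub>R 1 - k) \<le> t"
    by (auto simp: positive_element_def)
  then have "norm ((s + t) *\<^sub>R 1 - (h + k)) \<le> s + t"
    using norm_triangle_ineq[of "s *\<^sub>R 1 - h" "t *\<^sub>R 1 - k"] by (simp add: algebra_simps)
  then show ?thesis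
    using assms \<open>0 \<le> s\<close> \<open>0 \<le> t\<close>
    by (intro positive_elementI[of _ "s + t"]) (auto simp: star_add positive_element_def)
qed

lemma positive_element_scaleR:
  assumes "positive_element h" "0 \<le> r"
  shows "positive_element (r *\<^sub>R h)"
proof -
  from assms obtain t where t: "0 \<le> t" "norm (t *\<^sub>R 1 - h) \<le> t"
    by (auto simp: positive_element_def)
  have "norm (r *\<^sub>R (t *\<^sub>R 1 - h)) \<le> r * t"
    using t assms(2) by (simp add: mult_left_mono)
  then show ?thesis
    using assms t by (intro positive_elementI[of _ "r * t"])
      (auto simp: star_scaleR positive_element_def scaleR_diff_right)
qed

text \<open>Write \<open>h = t(1 - y)\<close> with \<open>\<parallel>y\<parallel> \<le> 1\<close> and use the binomial series.\<close>

lemma positive_element_sqrt: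
  assumes "positive_element h"
  obtains s where "positive_element s" "s * s = h" "\<forall>z. z * h = h * z \<longrightarrow> z * s = s * z"
proof -
  from assms obtain t where t: "0 \<le> t" "norm (t *\<^sub>R 1 - h) \<le> t" and h: "star h = h"
    by (auto simp: positive_element_def)
  show ?thesis
  proof (cases "t = 0")
    case True
    then have "h = 0" using t by simp
    then show ?thesis using assms that[of 0] by simp
  next
    case False
    define y where "y = 1 - (1 / t) *\<^sub>R h"
    have "y = (1 / t) *\<^sub>R (t *\<^sub>R 1 - h)"
      using False by (simp add: y_def scaleR_diff_right)
    then have y1: "norm y \<le> 1" using t False by simp
    have ys: "star y = y" using h by (simp add: y_def star_diff star_scaleR)
    define s where "s = sqrt t *\<^sub>R sqrt_one_minus y"
    have "sqrt t *\<^sub>R 1 - s = sqrt t *\<^sub>R (1 - sqrt_one_minus y)"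
      by (simp add: s_def scaleR_diff_right)
    then have "norm (sqrt t *\<^sub>R 1 - s) \<le> sqrt t"
      using norm_one_minus_sqrt[OF y1] t by (simp add: mult_left_le)
    then have "positive_element s"
      using t star_sqrt_one_minus[OF y1 ys]
      by (intro positive_elementI[of _ "sqrt t"]) (simp_all add: s_def star_scaleR)
    moreover have "s * s = h"
      using t False sqrt_one_minus_square[OF y1] by (simp add: s_def y_def)
    moreover have "z * s = s * z" if "z * h = h * z" for z
    proof -
      have "z * y = y * z" using that by (simp add: y_def algebra_simps)
      then show ?thesis using sqrt_one_minus_commutes[OF y1] by (simp add: s_def)
    qed
    ultimately show ?thesis using that by blast
  qed
qed

text \<open>\<open>s + \<i>r\<close> is unitary and \<open>s\<close> is its real part.\<close>

lemma norm_le_1_of_squares_sum_1: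
  fixes r s :: "'a::unital_cstar_algebra"
  assumes "star s = s" "star r = r" "s * r = r * s" "s * s + r * r = 1"
  shows "norm s \<le> 1"
proof -
  define u where "u = s + \<i> *\<^sub>C r"
  have su: "star u = s - \<i> *\<^sub>C r"
    by (simp add: u_def star_add star_scaleC assms scaleC_minus_left)
  have "star u * u = s * s + r * r"
    unfolding su unfolding u_def
    by (simp add: algebra_simps mult_scaleC_left mult_scaleC_right assms(3) scaleC_minus_left)
  then have "(norm u)\<^sup>2 = 1\<^sup>2"
    using cstar_identity[of u] assms(4) by simp
  then have "norm u = 1"
    by (rule power2_eq_imp_eq) auto
  moreover have "s = (1/2) *\<^sub>R (u + star u)"
    unfolding su unfolding u_def by (simp flip: scaleR_2)
  ultimately show ?thesis
    using norm_triangle_ineq[of u "star u"] by simp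
qed

text \<open>\<open>1 - h\<^sup>2\<close> has a selfadjoint square root \<open>k\<close> commuting with \<open>h\<close>, so \<open>k + \<i>h\<close> is unitary.\<close>

lemma norm_one_minus_square_le:
  fixes h :: "'a::unital_cstar_algebra"
  assumes "star h = h" "norm h \<le> 1"
  shows "norm (1 - h * h) \<le> 1"
proof -
  have h1: "norm (h * h) \<le> 1"
    using assms by (simp add: norm_square_selfadjoint power_le_one)
  have hs: "star (h * h) = h * h" by (simp add: star_mult assms)
  define k where "k = sqrt_one_minus (h * h)"
  have k: "k * k = 1 - h * h" "star k = k"
    unfolding k_def using sqrt_one_minus_square[OF h1] star_sqrt_one_minus[OF h1 hs] by auto
  have "h * k = k * h"
    unfolding k_def by (rule sqrt_one_minus_commutes[OF h1]) (simp add: mult.assoc)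
  then have "norm k \<le> 1"
    using k assms by (intro norm_le_1_of_squares_sum_1[of k h]) auto
  then show ?thesis
    unfolding k(1)[symmetric] norm_square_selfadjoint[OF k(2)] by (simp add: power_le_one)
qed

lemma positive_element_square:
  assumes "star h = (h::'a::unital_cstar_algebra)"
  shows "positive_element (h * h)"
proof (cases "h = 0")
  case False
  define k where "k = (1 / norm h) *\<^sub>R h"
  have "norm (1 - k * k) \<le> 1"
    using assms False by (intro norm_one_minus_square_le) (simp_all add: k_def star_scaleR)
  then have "positive_element (k * k)"
    using assms by (intro positive_elementI[of _ 1]) (simp_all add: k_def star_mult star_scaleR)
  then have "positive_element ((norm h)\<^sup>2 *\<^sub>R (k * k))" by (rule positive_element_scaleR) simp
  then show ?thesis using False by (simp add: k_def power2_eq_square)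
qed (rule positive_elementI[of _ 0]; simp)

lemma positive_element_mult:
  assumes "positive_element h" "positive_element k" "h * k = k * h"
  shows "positive_element (h * k)"
proof -
  obtain s where s: "positive_element s" "s * s = h" "\<forall>z. z * h = h * z \<longrightarrow> z * s = s * z"
    using positive_element_sqrt[OF assms(1)] by blast
  obtain r where r: "positive_element r" "r * r = k" "\<forall>z. z * k = k * z \<longrightarrow> z * r = r * z"
    using positive_element_sqrt[OF assms(2)] by blast
  have "k * s = s * k" using assms(3) s(3) by simp
  then have sr: "s * r = r * s" using r(3) by simp
  have "positive_element ((s * r) * (s * r))"
    using s(1) r(1) sr by (intro positive_element_square) (simp add: star_mult positive_element_selfadjoint)
  also have "(s * r) * (s * r) = s * (r * s) * r" by (simp add: mult.assoc)
  also have "\<dots> = h * k" unfolding sr[symmetric] using s(2) r(2) by (metis mult.assoc)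
  finally show ?thesis .
qed

text \<open>In the definition of positivity, \<open>t\<close> may be taken to be any bound of the norm; here \<open>t = 1\<close>.\<close>

lemma norm_one_minus_positive_le:
  assumes "positive_element h" "norm h \<le> 1"
  shows "norm (1 - h) \<le> 1"
proof -
  obtain s where s: "positive_element s" "s * s = h"
    using positive_element_sqrt[OF assms(1)] by blast
  have "(norm s)\<^sup>2 \<le> 1"
    using assms(2) norm_square_selfadjoint[of s] s by (simp add: positive_element_selfadjoint)
  then have "norm s \<le> 1" using abs_square_le_1[of "norm s"] by simp
  then show ?thesis
    using norm_one_minus_square_le[of s] s by (simp add: positive_element_selfadjoint)
qed

lemma positive_element_one_minus:
  assumes "positive_element h" "norm h \<le> 1"
  shows "positive_element (1 - h)"
  using assms by (intro positive_elementI[of _ 1]) (simp_all add: star_diff positive_element_selfadjoint)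

text \<open>With commuting square roots \<open>s\<close> of \<open>a\<close> and \<open>r\<close> of \<open>1 - a\<close>, again \<open>s + \<i>r\<close> is unitary.\<close>

lemma norm_le_1_of_positive_one_minus:
  assumes "positive_element a" "positive_element (1 - a)"
  shows "norm a \<le> 1"
proof -
  obtain s where s: "positive_element s" "s * s = a" "\<forall>z. z * a = a * z \<longrightarrow> z * s = s * z"
    using positive_element_sqrt[OF assms(1)] by blast
  obtain r where r: "positive_element r" "r * r = 1 - a" "\<forall>z. z * (1 - a) = (1 - a) * z \<longrightarrow> z * r = r * z"
    using positive_element_sqrt[OF assms(2)] by blast
  have "s * a = a * s" using s(2) by (metis mult.assoc)
  then have "s * r = r * s" using r(3) by (simp add: algebra_simps)
  then have "norm s \<le> 1"
    using s(1,2) r(1,2)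
    by (intro norm_le_1_of_squares_sum_1[of s r]) (simp_all add: positive_element_selfadjoint)
  then show ?thesis
    unfolding s(2)[symmetric] norm_square_selfadjoint[OF positive_element_selfadjoint[OF s(1)]]
    by (simp add: power_le_one)
qed

text \<open>After scaling, \<open>a + c \<le> 1\<close> implies \<open>a \<le> 1\<close>.\<close>

lemma norm_positive_le_add:
  assumes "positive_element a" "positive_element c"
  shows "norm a \<le> norm (a + c)"
proof (rule dense_ge)
  \<comment> \<open>scaling by \<open>r\<close> instead of \<open>\<parallel>a + c\<parallel>\<close> avoids a division by zero\<close>
  fix r assume r: "norm (a + c) < r"
  then have "0 < r" using norm_ge_zero le_less_trans by blast
  have "positive_element (1 - (1/r) *\<^sub>R (a + c))"
    using assms r \<open>0 < r\<close>
    by (intro positive_element_one_minus positive_element_scaleR positive_element_add) auto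
  then have "positive_element ((1 - (1/r) *\<^sub>R (a + c)) + (1/r) *\<^sub>R c)"
    using assms \<open>0 < r\<close> by (intro positive_element_add positive_element_scaleR) auto
  then have "norm ((1/r) *\<^sub>R a) \<le> 1"
    using assms \<open>0 < r\<close>
    by (intro norm_le_1_of_positive_one_minus positive_element_scaleR) (auto simp: scaleR_add_right)
  then show "norm a \<le> r" using \<open>0 < r\<close> by simp
qed

text \<open>The decomposition \<open>x = u + \<i>v\<close> into real and imaginary part. If \<open>-x\<^sup>*x\<close> is positive, the
  last equation shows that \<open>xx\<^sup>*\<close> is positive.\<close>

lemma star_mult_add_mult_star:
  fixes x :: "'a::unital_cstar_algebra"
  assumes "u = (1/2) *\<^sub>R (x + star x)" and "v = (- \<i> / 2) *\<^sub>C (x - star x)"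
  shows "star u = u" "star v = v" "star x * x + x * star x = 2 *\<^sub>R (u * u) + 2 *\<^sub>R (v * v)"
proof -
  show "star u = u" by (simp add: assms(1) star_scaleR star_add add.commute)
  have "star v = (\<i> / 2) *\<^sub>C (star x - x)"
    by (simp add: assms(2) star_scaleC star_diff scaleC_minus_left star_minus)
  then show "star v = v" 
    by (simp add: assms(2) scaleC_diff_right scaleC_minus_left)
  have "2 *\<^sub>R (u * u) = (1/2) *\<^sub>R ((x + star x) * (x + star x))"
    by (simp add: assms(1))
  moreover have "2 *\<^sub>R (v * v) = - ((1/2) *\<^sub>R ((x - star x) * (x - star x)))"
  proof -
    define d where "d = x - star x"
    have "v * v = ((- \<i> / 2) * (- \<i> / 2)) *\<^sub>C (d * d)"
      by (simp only: assms(2) mult_scaleC_left mult_scaleC_right scaleC_scaleC d_def)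
    also have "(- \<i> / 2) * (- \<i> / 2) = complex_of_real (- (1/4))" by simp
    also have "\<dots> *\<^sub>C (d * d) = (- (1/4)) *\<^sub>R (d * d)" by (rule scaleR_scaleC[symmetric])
    finally have "v * v = (- (1/4)) *\<^sub>R (d * d)" .
    then show ?thesis by (simp add: d_def)
  qed
  moreover have "(x + star x) * (x + star x) - (x - star x) * (x - star x)
      = 2 *\<^sub>R (star x * x + x * star x)"
    by (simp add: algebra_simps scaleR_2)
  ultimately show "star x * x + x * star x = 2 *\<^sub>R (u * u) + 2 *\<^sub>R (v * v)"
    by (simp flip: scaleR_diff_right)
qed

text \<open>Normalise to \<open>\<parallel>y\<parallel> = 1\<close> and put \<open>h = -y\<^sup>*y\<close>, \<open>k = yy\<^sup>*\<close>, both positive of norm \<open>1\<close>. The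
  nonzero spectra of \<open>y\<^sup>*y\<close> and \<open>yy\<^sup>*\<close> coincide, which is absurd, as one is contained in \<open>[-1, 0]\<close> and the
  other in \<open>[0, 1]\<close>. In terms of norms: \<open>w = (1 - k)y = y(1 + h)\<close> satisfies
  \<open>ww\<^sup>* = (1 - k)k(1 - k)\<close>, of norm at most \<open>1\<close>, and \<open>-w\<^sup>*w = (1 + h)h(1 + h) \<ge> 2h\<^sup>2\<close>, of norm
  at least \<open>2\<close>.\<close>

lemma eq_0_if_minus_star_mult_positive:
  fixes x :: "'a::unital_cstar_algebra"
  assumes "positive_element (- (star x * x))"
  shows "x = 0"
proof (rule ccontr)
  assume "x \<noteq> 0"
  define y where "y = (1 / norm x) *\<^sub>R x"
  have ny: "norm y = 1" using \<open>x \<noteq> 0\<close> by (simp add: y_def)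
  define h where "h = - (star y * y)"
  have "h = (1 / (norm x)\<^sup>2) *\<^sub>R (- (star x * x))"
    by (simp add: h_def y_def star_scaleR power2_eq_square)
  then have h: "positive_element h"
    using positive_element_scaleR[OF assms, of "1 / (norm x)\<^sup>2"] by simp
  have nh: "norm h = 1" using ny by (simp add: h_def cstar_identity)
  define k where "k = y * star y"
  define u where "u = (1/2) *\<^sub>R (y + star y)"
  define v where "v = (- \<i> / 2) *\<^sub>C (y - star y)"
  note uv = star_mult_add_mult_star[OF u_def v_def]
  have "k = 2 *\<^sub>R (u * u) + 2 *\<^sub>R (v * v) + h"
    unfolding uv(3)[symmetric] by (simp add: k_def h_def)
  moreover have "positive_element (2 *\<^sub>R (u * u) + 2 *\<^sub>R (v * v) + h)"
    using uv h by (intro positive_element_add positive_element_scaleR positive_element_square) auto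
  ultimately have k: "positive_element k" by simp
  have nk: "norm k = 1" using ny cstar_identity[of "star y"] by (simp add: k_def)
  define w where "w = (1 - k) * y"
  have sk: "star (1 - k) = 1 - k" using k by (simp add: star_diff positive_element_selfadjoint)
  have "w * star w = (1 - k) * k * (1 - k)"
    by (simp add: w_def star_mult sk) (simp add: k_def mult.assoc)
  then have "norm (w * star w) \<le> norm ((1 - k) * k) * norm (1 - k)"
    by (simp only: norm_mult_ineq)
  also have "\<dots> \<le> (norm (1 - k) * norm k) * norm (1 - k)"
    by (intro mult_right_mono norm_mult_ineq norm_ge_zero)
  also have "\<dots> \<le> 1"
    using norm_one_minus_positive_le[OF k] nk by (simp add: mult_le_one)
  finally have "norm (star w * w) \<le> 1"
    using cstar_identity[of w] cstar_identity[of "star w"] by simp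
  have wh: "w = y * (1 + h)" by (simp add: w_def k_def h_def algebra_simps)
  have "star w * w = star (1 + h) * (star y * y) * (1 + h)"
    by (simp add: wh star_mult mult.assoc)
  also have "\<dots> = - ((1 + h) * h * (1 + h))"
  proof -
    have "star (1 + h) = 1 + h" using h by (simp add: star_add positive_element_selfadjoint)
    moreover have "star y * y = - h" by (simp add: h_def)
    ultimately show ?thesis by simp
  qed
  finally have "norm ((1 + h) * h * (1 + h)) \<le> 1"
    using \<open>norm (star w * w) \<le> 1\<close> by simp
  moreover have "(1 + h) * h * (1 + h) = 2 *\<^sub>R (h * h) + (h + h * (h * h))"
    by (simp add: algebra_simps scaleR_2)
  moreover have "norm (2 *\<^sub>R (h * h)) \<le> norm (2 *\<^sub>R (h * h) + (h + h * (h * h)))"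
    using h by (intro norm_positive_le_add positive_element_add positive_element_scaleR
        positive_element_mult positive_element_square)
      (auto simp: positive_element_selfadjoint mult.assoc)
  moreover have "norm (2 *\<^sub>R (h * h)) = 2"
    using nh norm_square_selfadjoint[of h] h by (simp add: positive_element_selfadjoint)
  ultimately show False by simp
qed

text \<open>Kaplansky's argument. For \<open>b = x\<^sup>*x\<close> and \<open>c = \<bar>b\<bar> = \<surd>(b\<^sup>2)\<close>, the element \<open>n = c - b\<close> is twice
  the negative part of \<open>b\<close>. Then \<open>(xn)\<^sup>*(xn) = nbn = -cn\<^sup>2\<close> is negative, so \<open>xn = 0\<close> by the preceding lemma,
  which forces \<open>n = 0\<close> and \<open>b = c\<close>.\<close>

theorem positive_element_star_mult:
  fixes x :: "'a::unital_cstar_algebra"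
  shows "positive_element (star x * x)"
proof -
  define b where "b = star x * x"
  have sb: "star b = b" by (simp add: b_def star_mult)
  obtain c where c: "positive_element c" "c * c = b * b"
    "\<forall>z. z * (b * b) = (b * b) * z \<longrightarrow> z * c = c * z"
    using positive_element_sqrt[OF positive_element_square[OF sb]] by blast
  have bc: "b * c = c * b" using c(3) by (simp add: mult.assoc)
  have sc: "star c = c" using c(1) by (rule positive_element_selfadjoint)
  define n where "n = c - b"
  have sn: "star n = n" by (simp add: n_def star_diff sb sc)
  have nn: "n * n = 2 *\<^sub>R (c * n)"
    by (simp add: n_def algebra_simps scaleR_2 c(2) bc)
  have bn: "b * n = - (c * n)"
    by (simp add: n_def algebra_simps c(2) bc)
  have cn: "c * n = n * c" by (simp add: n_def algebra_simps bc)
  have n3: "positive_element (c * (n * n))"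
  proof (rule positive_element_mult[OF c(1) positive_element_square[OF sn]])
    have "c * (n * n) = n * c * n" by (simp add: cn flip: mult.assoc)
    also have "\<dots> = n * n * c" by (simp add: cn mult.assoc)
    finally show "c * (n * n) = n * n * c" .
  qed
  have "star (x * n) * (x * n) = n * (b * n)"
    by (simp add: star_mult sn b_def mult.assoc)
  also have "\<dots> = - (n * c * n)" unfolding bn by (simp add: mult.assoc)
  also have "\<dots> = - (c * (n * n))" by (simp add: cn[symmetric] mult.assoc)
  finally have eq: "star (x * n) * (x * n) = - (c * (n * n))" .
  then have "x * n = 0" using n3 by (intro eq_0_if_minus_star_mult_positive) simp
  then have "c * (n * n) = 0" using eq by simp
  moreover have "(n * n) * (n * n) = 2 *\<^sub>R (c * (n * n)) * n"
    by (subst nn) (simp add: mult.assoc)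
  ultimately have "(n * n) * (n * n) = 0" by simp
  then have "norm ((n * n) * (n * n)) = 0" by simp
  then have "n = 0"
    using norm_square_selfadjoint[of "n * n"] norm_square_selfadjoint[OF sn] sn
    by (simp add: star_mult)
  then show ?thesis using c(1) by (simp add: n_def b_def)
qed

text \<open>A functional of norm \<open>1\<close> that attains its norm at \<open>1 + b\<close> therefore attains it at \<open>1\<close> and at
  \<open>b\<close>.\<close>

lemma norm_one_add_positive:
  assumes "positive_element (b::'a::unital_cstar_algebra)"
  shows "norm (1 + b) = 1 + norm b"
proof (rule antisym)
  show "norm (1 + b) \<le> 1 + norm b" using norm_triangle_ineq[of 1 b] by simp
  have one: "positive_element (1::'a)" by (rule positive_elementI[of _ 1]) auto
  define N where "N = norm (1 + b)"
  have "norm (1::'a) \<le> N" unfolding N_def by (rule norm_positive_le_add[OF one assms])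
  then have N1: "1 \<le> N" by simp
  have "positive_element (1 - (1/N) *\<^sub>R (1 + b))"
    using assms one N1 by (intro positive_element_one_minus positive_element_scaleR positive_element_add)
      (auto simp: N_def)
  then have p: "positive_element (N *\<^sub>R (1 - (1/N) *\<^sub>R (1 + b)))"
    using N1 by (intro positive_element_scaleR) auto
  have "N *\<^sub>R (1 - (1/N) *\<^sub>R (1 + b)) = (N - 1) *\<^sub>R 1 - b"
    using N1 by (simp add: algebra_simps)
  then have "norm b \<le> norm (b + ((N - 1) *\<^sub>R 1 - b))"
    using p assms by (intro norm_positive_le_add) auto
  then show "1 + norm b \<le> norm (1 + b)"
    using N1 by (simp add: N_def[symmetric])
qed

text \<open>The form \<open>c\<^sup>*c\<close> of \<open>\<parallel>b\<parallel>\<^sup>2 - b\<^sup>*b\<close> makes every action of the algebra on a semi-inner product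
  space automatically bounded: take the inner product of \<open>c\<^sup>*cv\<close> with \<open>v\<close>.\<close>

lemma norm_square_minus_star_mult:
  fixes b :: "'a::unital_cstar_algebra"
  obtains c where "star c * c = (norm b)\<^sup>2 *\<^sub>R 1 - star b * b"
proof (cases "b = 0")
  case True
  then show ?thesis using that[of 0] by simp
next
  case False
  define h where "h = (1 / (norm b)\<^sup>2) *\<^sub>R (star b * b)"
  have "positive_element (1 - h)"
    unfolding h_def using False
    by (intro positive_element_one_minus positive_element_scaleR positive_element_star_mult)
      (simp_all add: cstar_identity)
  then have "positive_element ((norm b)\<^sup>2 *\<^sub>R (1 - h))" by (rule positive_element_scaleR) simp
  then obtain s where "positive_element s" "s * s = (norm b)\<^sup>2 *\<^sub>R (1 - h)"
    using positive_element_sqrt by metis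
  moreover have "(norm b)\<^sup>2 *\<^sub>R (1 - h) = (norm b)\<^sup>2 *\<^sub>R 1 - star b * b"
    using False by (simp add: h_def scaleR_diff_right)
  ultimately show ?thesis using that[of s] by (simp add: positive_element_selfadjoint)
qed

section \<open>States\<close>

subsection \<open>The Hahn--Banach theorem\<close>

definition sublinear :: "('a::real_vector \<Rightarrow> real) \<Rightarrow> bool" where
  "sublinear q \<longleftrightarrow> (\<forall>x y. q (x + y) \<le> q x + q y) \<and> (\<forall>r\<ge>0. \<forall>x. q (r *\<^sub>R x) \<le> r * q x)"

lemma sublinear_add: "sublinear q \<Longrightarrow> q (x + y) \<le> q x + q y"
  and sublinear_scaleR: "sublinear q \<Longrightarrow> 0 \<le> r \<Longrightarrow> q (r *\<^sub>R x) \<le> r * q x"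
  by (auto simp: sublinear_def)

lemma sublinear_zero: "sublinear q \<Longrightarrow> q 0 = 0"
  using sublinear_add[of q 0 0] sublinear_scaleR[of q 0 0] by simp

lemma sublinear_minus: "sublinear q \<Longrightarrow> - q (- x) \<le> q x"
  using sublinear_add[of q x "-x"] sublinear_zero[of q] by simp

text \<open>\<open>q'(x) = inf {q(x + ty) - tq(y) | t \<ge> 0}\<close> is again sublinear, and linear in direction \<open>y\<close>. Hence
  a minimal sublinear functional is linear, and a single application of the lemma forces every linear
  functional below \<open>q'\<close> to take the value \<open>q(y)\<close> at \<open>y\<close>.\<close>

lemma sublinear_lower:
  fixes q :: "'a::real_vector \<Rightarrow> real"
  assumes q: "sublinear q"
  obtains q' where "sublinear q'" "\<And>x. q' x \<le> q x" "q' (- y) \<le> - q y"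
proof -
  define Q where "Q x = (\<lambda>t. q (x + t *\<^sub>R y) - t * q y) ` {0..}" for x
  define q' where "q' x = Inf (Q x)" for x
  have homog: "t * q y \<le> q (t *\<^sub>R y)" if "0 \<le> t" for t
  proof (cases "t = 0")
    case False
    then show ?thesis
      using that sublinear_scaleR[OF q, of "1/t" "t *\<^sub>R y"] by (simp add: field_simps)
  qed (use sublinear_zero[OF q] in simp)
  have "- q (- x) \<le> q (x + t *\<^sub>R y) - t * q y" if "0 \<le> t" for x t
    using homog[OF that] sublinear_add[OF q, of "-x" "x + t *\<^sub>R y"] by simp
  then have bdd: "bdd_below (Q x)" for x
    by (auto simp: Q_def intro!: bdd_belowI[of _ "- q (- x)"])
  have le: "q' x \<le> q (x + t *\<^sub>R y) - t * q y" if "0 \<le> t" for x t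
    unfolding q'_def using that by (intro cInf_lower bdd) (auto simp: Q_def)
  have ge: "c \<le> q' x" if "\<And>t. 0 \<le> t \<Longrightarrow> c \<le> q (x + t *\<^sub>R y) - t * q y" for c x
    unfolding q'_def using that by (intro cInf_greatest) (auto simp: Q_def)
  have "q' (x + z) \<le> q' x + q' z" for x z
  proof -
    have "q' (x + z) - (q (z + s *\<^sub>R y) - s * q y) \<le> q' x" if s: "0 \<le> s" for s
    proof (rule ge)
      fix t :: real assume t: "0 \<le> t"
      show "q' (x + z) - (q (z + s *\<^sub>R y) - s * q y) \<le> q (x + t *\<^sub>R y) - t * q y"
        using le[of "t + s" "x + z"] s t sublinear_add[OF q, of "x + t *\<^sub>R y" "z + s *\<^sub>R y"]
        by (simp add: algebra_simps)
    qed
    then have "q' (x + z) - q' x \<le> q' z" by (intro ge) (simp add: algebra_simps)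
    then show ?thesis by simp
  qed
  moreover have "q' (r *\<^sub>R x) \<le> r * q' x" if r: "0 \<le> r" for r x
  proof (cases "r = 0")
    case True
    then show ?thesis using le[of 0 0] sublinear_zero[OF q] by simp
  next
    case False
    have "q' (r *\<^sub>R x) / r \<le> q' x"
    proof (rule ge)
      fix t :: real assume t: "0 \<le> t"
      have "q' (r *\<^sub>R x) \<le> q (r *\<^sub>R (x + t *\<^sub>R y)) - r * t * q y"
        using le[of "r * t" "r *\<^sub>R x"] r t by (simp add: scaleR_add_right)
      also have "\<dots> \<le> r * (q (x + t *\<^sub>R y) - t * q y)"
        using sublinear_scaleR[OF q r, of "x + t *\<^sub>R y"] by (simp add: algebra_simps)
      finally show "q' (r *\<^sub>R x) / r \<le> q (x + t *\<^sub>R y) - t * q y"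
        using r False by (simp add: field_simps)
    qed
    then show ?thesis using r False by (simp add: field_simps)
  qed
  ultimately have "sublinear q'" by (simp add: sublinear_def)
  moreover have "q' x \<le> q x" for x using le[of 0 x] by simp
  moreover have "q' (- y) \<le> - q y" using le[of 1 "-y"] sublinear_zero[OF q] by simp
  ultimately show ?thesis using that by blast
qed

text \<open>The bound \<open>-p(-x) \<le> q(x)\<close> for \<open>q \<le> p\<close> keeps the infimum finite; subadditivity survives because
  any two members of a chain have a common lower bound in it.\<close>

lemma sublinear_chain_Inf:
  fixes C :: "('a::real_vector \<Rightarrow> real) set"
  assumes "C \<noteq> {}" and C: "\<And>q. q \<in> C \<Longrightarrow> sublinear q \<and> (\<forall>x. q x \<le> p x)"
    and chain: "\<And>q r. q \<in> C \<Longrightarrow> r \<in> C \<Longrightarrow> (\<forall>x. q x \<le> r x) \<or> (\<forall>x. r x \<le> q x)"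
  shows "sublinear (\<lambda>x. INF q\<in>C. q x)" "q \<in> C \<Longrightarrow> (INF q\<in>C. q x) \<le> q x"
proof -
  have bdd: "bdd_below ((\<lambda>q. q x) ` C)" for x
  proof (rule bdd_belowI2)
    fix q assume "q \<in> C"
    then show "- p (- x) \<le> q x" using C[of q] sublinear_minus[of q x] by (smt (verit))
  qed
  show le: "q \<in> C \<Longrightarrow> (INF q\<in>C. q x) \<le> q x" for q x
    by (rule cINF_lower[OF bdd])
  have "(INF q\<in>C. q (x + y)) \<le> (INF q\<in>C. q x) + (INF q\<in>C. q y)" for x y
  proof -
    have "(INF q\<in>C. q (x + y)) \<le> q x + r y" if "q \<in> C" "r \<in> C" for q r
    proof -
      obtain s where "s \<in> C" "\<forall>x. s x \<le> q x" "\<forall>x. s x \<le> r x"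
        using chain[of q r] \<open>q \<in> C\<close> \<open>r \<in> C\<close> by (metis order_refl)
      then show ?thesis
        using le[of s "x + y"] C[of s] sublinear_add[of s x y] by (smt (verit))
    qed
    then have "(INF q\<in>C. q (x + y)) - r y \<le> (INF q\<in>C. q x)" if "r \<in> C" for r
      using that \<open>C \<noteq> {}\<close> by (intro cINF_greatest) (auto simp: algebra_simps)
    then have "(INF q\<in>C. q (x + y)) - (INF q\<in>C. q x) \<le> (INF q\<in>C. q y)"
      using \<open>C \<noteq> {}\<close> by (intro cINF_greatest) (auto simp: algebra_simps)
    then show ?thesis by simp
  qed
  moreover have "(INF q\<in>C. q (r *\<^sub>R x)) \<le> r * (INF q\<in>C. q x)" if r: "0 \<le> r" for r x
  proof (cases "r = 0")
    case True
    obtain q where "q \<in> C" using \<open>C \<noteq> {}\<close> by auto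
    then show ?thesis using True le[of q 0] C[of q] sublinear_zero[of q] by simp
  next
    case False
    have "(INF q\<in>C. q (r *\<^sub>R x)) / r \<le> (INF q\<in>C. q x)"
    proof (rule cINF_greatest[OF \<open>C \<noteq> {}\<close>])
      fix q assume "q \<in> C"
      then have "(INF q\<in>C. q (r *\<^sub>R x)) \<le> r * q x"
        using le[of q "r *\<^sub>R x"] C[of q] sublinear_scaleR[of q r x] r by linarith
      then show "(INF q\<in>C. q (r *\<^sub>R x)) / r \<le> q x" using r False by (simp add: field_simps)
    qed
    then show ?thesis using r False by (simp add: field_simps)
  qed
  ultimately show "sublinear (\<lambda>x. INF q\<in>C. q x)" by (simp add: sublinear_def)
qed

text \<open>A minimal sublinear functional \<open>f \<le> p\<close> is linear, since lowering it in direction \<open>y\<close> does not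
  change it and hence \<open>f(-y) = -f(y)\<close>.\<close>

theorem sublinear_dominates_linear:
  fixes p :: "'a::real_vector \<Rightarrow> real"
  assumes p: "sublinear p"
  obtains f where "linear f" "\<And>x. f x \<le> p x"
proof -
  define A where "A = {q :: 'a \<Rightarrow> real. sublinear q \<and> (\<forall>x. q x \<le> p x)}"
  define P where "P a u \<longleftrightarrow> (\<forall>x. u x \<le> a x)" for a u :: "'a \<Rightarrow> real"
  have "partial_order_on A (relation_of P A)"
    by (rule partial_order_on_relation_ofI) (auto simp: P_def fun_eq_iff intro: order_trans antisym)
  moreover have "\<exists>u\<in>A. \<forall>a\<in>C. P a u" if "C \<in> Chains (relation_of P A)" for C
  proof (cases "C = {}")
    case True
    then show ?thesis using p by (auto simp: A_def)
  next
    case False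
    have CA: "C \<subseteq> A" and ch: "\<And>q r. q \<in> C \<Longrightarrow> r \<in> C \<Longrightarrow> P q r \<or> P r q"
      using that by (auto simp: Chains_def relation_of_def)
    have 1: "\<And>q. q \<in> C \<Longrightarrow> sublinear q \<and> (\<forall>x. q x \<le> p x)" using CA by (auto simp: A_def)
    have 2: "\<And>q r. q \<in> C \<Longrightarrow> r \<in> C \<Longrightarrow> (\<forall>x. q x \<le> r x) \<or> (\<forall>x. r x \<le> q x)"
      using ch by (auto simp: P_def)
    have inf1: "sublinear (\<lambda>x. INF q\<in>C. q x)"
      by (rule sublinear_chain_Inf(1)[OF False]) (fact 1 2)+
    have inf2: "(INF q\<in>C. q x) \<le> q x" if "q \<in> C" for q x
      by (rule sublinear_chain_Inf(2)[OF False _ _ that]) (fact 1 2)+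
    obtain q where "q \<in> C" using False by auto
    then have "(\<lambda>x. INF q\<in>C. q x) \<in> A"
      using inf1 order_trans[OF inf2] 1[of q] unfolding A_def by blast
    moreover have "\<forall>a\<in>C. P a (\<lambda>x. INF q\<in>C. q x)" using inf2 by (simp add: P_def)
    ultimately show ?thesis by (intro bexI[of _ "\<lambda>x. INF q\<in>C. q x"])
  qed
  ultimately obtain f where fA: "f \<in> A" and min: "\<And>a. a \<in> A \<Longrightarrow> P f a \<Longrightarrow> a = f"
    using predicate_Zorn[of A P] by blast
  have f: "sublinear f" and fp: "\<And>x. f x \<le> p x" using fA by (auto simp: A_def)
  have minus: "f (- y) = - f y" for y
  proof -
    obtain q where q: "sublinear q" "\<And>x. q x \<le> f x" "q (- y) \<le> - f y"
      using sublinear_lower[OF f, of y] by blast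
    then have "q \<in> A" using order_trans[OF q(2) fp] by (auto simp: A_def)
    then have "q = f" using q min by (auto simp: P_def)
    then show ?thesis using q sublinear_minus[OF f, of "- y"] by simp
  qed
  have "f (x + y) = f x + f y" for x y
  proof -
    have "f x \<le> f (x + y) + f (- y)" using sublinear_add[OF f, of "x + y" "- y"] by simp
    then show ?thesis using sublinear_add[OF f, of x y] minus[of y] by simp
  qed
  moreover have pos: "f (r *\<^sub>R x) = r * f x" if "0 \<le> r" for r x
    using sublinear_scaleR[OF f that, of x] sublinear_scaleR[OF f that, of "-x"] minus[of x]
      minus[of "r *\<^sub>R x"] by simp
  moreover have "f (r *\<^sub>R x) = r * f x" for r x
  proof (cases "0 \<le> r")
    case False
    then show ?thesis using pos[of "- r" x] minus[of "r *\<^sub>R x"] by simp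
  qed (rule pos)
  ultimately have "linear f" by (intro linearI) auto
  then show ?thesis using that fp by blast
qed

text \<open>Lower the norm in direction \<open>v\<close> first: any linear functional below the result takes the
  value \<open>\<parallel>v\<parallel>\<close> at \<open>v\<close>.\<close>

corollary norming_functional:
  fixes v :: "'a::real_normed_vector"
  obtains f :: "'a \<Rightarrow> real" where "linear f" "\<And>x. \<bar>f x\<bar> \<le> norm x" "f v = norm v"
proof -
  have "sublinear (norm :: 'a \<Rightarrow> real)" by (simp add: sublinear_def norm_triangle_ineq)
  then obtain q where q: "sublinear q" "\<And>x. q x \<le> norm x" "q (- v) \<le> - norm v"
    using sublinear_lower[of norm v] by blast
  then obtain f where f: "linear f" "\<And>x. f x \<le> q x" using sublinear_dominates_linear by blast
  have le: "f x \<le> norm x" for x using f(2) q(2) order_trans by blast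
  have "\<bar>f x\<bar> \<le> norm x" for x using le[of x] le[of "- x"] linear_neg[OF f(1), of x] by simp
  moreover have "f v = norm v"
    using le[of v] f(2)[of "- v"] q(3) linear_neg[OF f(1), of v] by simp
  ultimately show ?thesis using that f(1) by blast
qed

subsection \<open>Positive functionals\<close>

definition positive_functional :: "('a::unital_cstar_algebra \<Rightarrow> complex) \<Rightarrow> bool" where
  "positive_functional f \<longleftrightarrow>
     (\<forall>x y. f (x + y) = f x + f y) \<and> (\<forall>c x. f (c *\<^sub>C x) = c * f x) \<and>
     (\<forall>x. f (star x) = cnj (f x)) \<and> (\<forall>x. 0 \<le> Re (f (star x * x)))"

text \<open>A norm-one functional \<open>g\<close> with \<open>g(1) = 1\<close> is nonnegative on positive elements, because
  \<open>\<parallel>t - h\<parallel> \<le> t\<close> gives \<open>t - g(h) \<le> t\<close>. The constant \<open>2\<close> is crude but suffices for continuity.\<close>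

lemma norm_attaining_positive_functional:
  fixes a :: "'a::unital_cstar_algebra"
  obtains f where "positive_functional f" "\<And>x. cmod (f x) \<le> 2 * norm x"
    "f (star a * a) = (norm a)\<^sup>2"
proof -
  define b where "b = star a * a"
  have b: "positive_element b" unfolding b_def by (rule positive_element_star_mult)
  obtain g where g: "linear g" "\<And>x. \<bar>g x\<bar> \<le> norm x" "g (1 + b) = norm (1 + b)"
    using norming_functional by blast
  have gadd: "g (x + y) = g x + g y" and gsc: "g (r *\<^sub>R x) = r * g x" for x y r
    using linear_add[OF g(1)] linear_scale[OF g(1)] by auto
  have g1: "g 1 = 1" and gb: "g b = norm b"
    using g(3) g(2)[of 1] g(2)[of b] norm_one_add_positive[OF b] by (auto simp: gadd)
  have gpos: "0 \<le> g h" if "positive_element h" for h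
  proof -
    obtain t where t: "0 \<le> t" "norm (t *\<^sub>R 1 - h) \<le> t"
      using \<open>positive_element h\<close> by (auto simp: positive_element_def)
    then have "g (t *\<^sub>R 1 - h) \<le> t" using g(2)[of "t *\<^sub>R 1 - h"] by simp
    then show ?thesis by (simp add: linear_diff[OF g(1)] gsc g1)
  qed
  \<comment> \<open>the complex functional with real part \<open>x \<mapsto> g ((x + x\<^sup>*) / 2)\<close>\<close>
  define k where "k x = (g x + g (star x)) / 2" for x
  have kadd: "k (x + y) = k x + k y" and ksc: "k (r *\<^sub>R x) = r * k x" and kstar: "k (star x) = k x"
    for x y r by (simp_all add: k_def gadd gsc star_add star_scaleR field_simps)
  have kle: "\<bar>k x\<bar> \<le> norm x" for x
    using g(2)[of x] g(2)[of "star x"] by (simp add: k_def)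
  have kherm: "k h = g h" if "star h = h" for h by (simp add: k_def that)
  have kneg: "k (- x) = - k x" for x using ksc[of "-1" x] by simp
  define f where "f x = Complex (k x) (- k (\<i> *\<^sub>C x))" for x
  have ki: "k (\<i> *\<^sub>C star x) = - k (\<i> *\<^sub>C x)" for x
    using kstar[of "\<i> *\<^sub>C x"] by (simp add: star_scaleC scaleC_minus_left kneg)
  have fadd: "f (x + y) = f x + f y" for x y
    by (simp add: f_def scaleC_add_right kadd complex_eq_iff)
  have fscR: "f (r *\<^sub>R x) = complex_of_real r * f x" for r x
  proof -
    have "\<i> *\<^sub>C (r *\<^sub>R x) = r *\<^sub>R (\<i> *\<^sub>C x)" by (simp add: scaleR_scaleC mult.commute)
    then show ?thesis by (simp add: f_def ksc complex_eq_iff)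
  qed
  have fi: "f (\<i> *\<^sub>C x) = \<i> * f x" for x
  proof -
    have "\<i> *\<^sub>C \<i> *\<^sub>C x = - x" by (simp add: scaleC_minus_left)
    then show ?thesis by (simp add: f_def kneg complex_eq_iff)
  qed
  have fsc: "f (c *\<^sub>C x) = c * f x" for c x
  proof -
    have "c *\<^sub>C x = Re c *\<^sub>R x + Im c *\<^sub>R (\<i> *\<^sub>C x)"
      unfolding scaleR_scaleC scaleC_scaleC scaleC_add_left[symmetric]
      by (metis complex_eq mult.commute)
    then have "f (c *\<^sub>C x) = (Re c + Im c * \<i>) * f x"
      by (simp add: fadd fscR fi algebra_simps)
    then show ?thesis by (metis complex_eq mult.commute)
  qed
  have fherm: "f h = of_real (g h)" if "star h = h" for h
    using ki[of h] that by (simp add: f_def kherm complex_eq_iff)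
  have "positive_functional f"
    unfolding positive_functional_def
  proof (intro conjI allI)
    show "f (star x) = cnj (f x)" for x by (simp add: f_def kstar ki complex_eq_iff)
    show "0 \<le> Re (f (star x * x))" for x
      using gpos[OF positive_element_star_mult[of x]] by (simp add: fherm star_mult)
  qed (rule fadd fsc)+
  moreover have "cmod (f x) \<le> 2 * norm x" for x
    using cmod_le[of "f x"] kle[of x] kle[of "\<i> *\<^sub>C x"] by (simp add: f_def norm_scaleC)
  moreover have "f (star a * a) = (norm a)\<^sup>2"
    using gb by (simp add: fherm star_mult b_def cstar_identity)
  ultimately show ?thesis using that by blast
qed

subsection \<open>Separability and a faithful positive functional\<close>

lemma bounded_bilinear_scaleC:
  "bounded_bilinear (scaleC :: complex \<Rightarrow> 'a \<Rightarrow> 'a::unital_cstar_algebra)"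
proof
  fix r :: real and c :: complex and x :: 'a
  show "(r *\<^sub>R c) *\<^sub>C x = r *\<^sub>R c *\<^sub>C x" by (simp add: scaleR_scaleC scaleR_conv_of_real)
  show "c *\<^sub>C r *\<^sub>R x = r *\<^sub>R c *\<^sub>C x" by (simp add: scaleR_scaleC mult.commute)
  show "\<exists>K. \<forall>c x. norm (c *\<^sub>C x :: 'a) \<le> norm c * norm x * K"
    by (rule exI[of _ 1]) (simp add: norm_scaleC)
qed (rule scaleC_add_left scaleC_add_right)+

lemma limit_in_closure:
  fixes x :: "'a::first_countable_topology"
  assumes "\<And>n. X n \<in> S" "X \<longlonglongrightarrow> x"
  shows "x \<in> closure S"
  by (rule Lim_in_closed_set[OF closed_closure _ _ assms(2)])
    (use assms(1) closure_subset in \<open>auto intro!: always_eventually\<close>)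

text \<open>One round of closing \<open>S\<close> under the operations of a *-algebra, with scalars from a countable set
  \<open>Q\<close> to keep the result countable.\<close>

definition algebra_step :: "complex set \<Rightarrow> 'a::unital_cstar_algebra set \<Rightarrow> 'a set" where
  "algebra_step Q S = S \<union> (\<lambda>(x, y). x + y) ` (S \<times> S) \<union> (\<lambda>(x, y). x * y) ` (S \<times> S) \<union>
     star ` S \<union> (\<lambda>(c, x). c *\<^sub>C x) ` (Q \<times> S)"

text \<open>The countable set generated by \<open>G\<close> under the algebra operations with scalars from a countable
  dense set of complex numbers has a C*-subalgebra as its closure.\<close>

lemma countable_generated_separable:
  fixes G :: "'a::unital_cstar_algebra set"
  assumes "countable G" "generates G"
  obtains D where "countable D" "closure D = (UNIV :: 'a set)"
proof -
  obtain Q :: "complex set" where Q: "countable Q" "\<And>X. open X \<Longrightarrow> X \<noteq> {} \<Longrightarrow> \<exists>d\<in>Q. d \<in> X"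
    using countable_dense_setE by blast
  have Qcl: "closure Q = UNIV"
  proof (rule ccontr)
    assume "closure Q \<noteq> UNIV"
    then have "- closure Q \<noteq> {}" by auto
    then obtain d where "d \<in> Q" "d \<in> - closure Q"
      using Q(2)[of "- closure Q"] by auto
    then show False using closure_subset by auto
  qed
  define E where "E n = (algebra_step Q ^^ n) (insert 0 (insert 1 G))" for n
  define D where "D = (\<Union>n. E n)"
  have "countable (E n)" for n
    using assms(1) Q(1) by (induction n) (auto simp: E_def algebra_step_def)
  then have cD: "countable D" by (simp add: D_def)
  have ESuc: "E (Suc n) = algebra_step Q (E n)" for n by (simp add: E_def)
  have mono: "E m \<subseteq> E n" if "m \<le> n" for m n
    using that by (induction rule: dec_induct) (auto simp: ESuc algebra_step_def)
  have common: "\<exists>n. x \<in> E n \<and> y \<in> E n" if "x \<in> D" "y \<in> D" for x y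
  proof -
    obtain i j where "x \<in> E i" "y \<in> E j" using \<open>x \<in> D\<close> \<open>y \<in> D\<close> by (auto simp: D_def)
    then show ?thesis using mono[of i "max i j"] mono[of j "max i j"] by auto
  qed
  have EsubD: "E n \<subseteq> D" for n by (auto simp: D_def)
  have Dadd: "x + y \<in> D" and Dmult: "x * y \<in> D" if xy: "x \<in> D" "y \<in> D" for x y
  proof -
    obtain n where "x \<in> E n" "y \<in> E n" using common[OF xy] by blast
    then have "x + y \<in> E (Suc n)" "x * y \<in> E (Suc n)"
      by (force simp: ESuc algebra_step_def)+
    then show "x + y \<in> D" "x * y \<in> D" using EsubD by blast+
  qed
  have Dstar: "star x \<in> D" if "x \<in> D" for x
  proof -
    obtain n where "x \<in> E n" using \<open>x \<in> D\<close> by (auto simp: D_def)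
    then have "star x \<in> E (Suc n)" by (simp add: ESuc algebra_step_def)
    then show ?thesis using EsubD by blast
  qed
  have Dscale: "c *\<^sub>C x \<in> D" if "c \<in> Q" "x \<in> D" for c x
  proof -
    obtain n where "x \<in> E n" using \<open>x \<in> D\<close> by (auto simp: D_def)
    then have "c *\<^sub>C x \<in> E (Suc n)" using that by (force simp: ESuc algebra_step_def)
    then show ?thesis using EsubD by blast
  qed
  have 0: "insert 0 (insert 1 G) \<subseteq> D" using EsubD[of 0] by (simp add: E_def)
  have "cstar_subalgebra (closure D)"
    unfolding cstar_subalgebra_def complex_vector.subspace_def
  proof (intro conjI ballI allI)
    show "0 \<in> closure D" using 0 closure_subset by auto
    show "closed (closure D)" by simp
    fix x assume "x \<in> closure D"
    then obtain X where X: "\<And>n. X n \<in> D" "X \<longlonglongrightarrow> x" by (auto simp: closure_sequential)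
    show "star x \<in> closure D"
      by (rule limit_in_closure[OF Dstar[OF X(1)] bounded_linear.tendsto[OF bounded_linear_star X(2)]])
    show "c *\<^sub>C x \<in> closure D" for c
    proof -
      have "c \<in> closure Q" using Qcl by simp
      then obtain q where q: "\<And>n. q n \<in> Q" "q \<longlonglongrightarrow> c" by (auto simp: closure_sequential)
      show ?thesis
        by (rule limit_in_closure[OF Dscale[OF q(1) X(1)]
              bounded_bilinear.tendsto[OF bounded_bilinear_scaleC q(2) X(2)]])
    qed
    fix y assume "y \<in> closure D"
    then obtain Y where Y: "\<And>n. Y n \<in> D" "Y \<longlonglongrightarrow> y" by (auto simp: closure_sequential)
    show "x + y \<in> closure D"
      by (rule limit_in_closure[OF Dadd[OF X(1) Y(1)] tendsto_add[OF X(2) Y(2)]])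
    show "x * y \<in> closure D"
      by (rule limit_in_closure[OF Dmult[OF X(1) Y(1)] tendsto_mult[OF X(2) Y(2)]])
  qed
  moreover have "insert 1 G \<subseteq> closure D" using 0 closure_subset[of D] by blast
  ultimately have "\<Inter>{B. cstar_subalgebra B \<and> insert 1 G \<subseteq> B} \<subseteq> closure D" by blast
  then have "closure D = UNIV" using assms(2) by (auto simp: generates_def)
  then show ?thesis using that cD by blast
qed

text \<open>Choose \<open>f\<^sub>n\<close> attaining the norm of \<open>d\<^sub>n\<^sup>*d\<^sub>n\<close> for a dense sequence \<open>(d\<^sub>n)\<close> and
  put \<open>f = \<Sum>2\<^sup>-\<^sup>nf\<^sub>n\<close>. If \<open>f(a\<^sup>*a) = 0\<close>, then all \<open>f\<^sub>n(a\<^sup>*a)\<close> vanish, and approximating \<open>a\<close> by the \<open>d\<^sub>n\<close>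
  gives \<open>\<parallel>a\<parallel> = 0\<close>.\<close>

theorem faithful_positive_functional:
  fixes D :: "'a::unital_cstar_algebra set"
  assumes "countable D" "closure D = UNIV"
  obtains f :: "'a \<Rightarrow> complex" where "positive_functional f" "\<And>x. cmod (f x) \<le> 4 * norm x"
    "\<And>a. f (star a * a) = 0 \<Longrightarrow> a = 0"
proof -
  have "D \<noteq> {}" using assms(2) by auto
  define d where "d = from_nat_into D"
  have d: "range d = D" using \<open>D \<noteq> {}\<close> assms(1) by (simp add: d_def)
  have "\<forall>n. \<exists>f. positive_functional f \<and> (\<forall>x. cmod (f x) \<le> 2 * norm x) \<and>
      f (star (d n) * d n) = (norm (d n))\<^sup>2"
    by (metis norm_attaining_positive_functional)
  then obtain F where F: "\<And>n. positive_functional (F n)" "\<And>n x. cmod (F n x) \<le> 2 * norm x"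
    "\<And>n. F n (star (d n) * d n) = (norm (d n))\<^sup>2"
    by metis
  define f where "f x = (\<Sum>n. complex_of_real ((1/2)^n) * F n x)" for x
  have summ2: "summable (\<lambda>n. (1/2)^n * (2 * norm x))" for x :: 'a
    by (intro summable_mult2 summable_geometric) simp
  have bd: "cmod (complex_of_real ((1/2)^n) * F n x) \<le> (1/2)^n * (2 * norm x)" for n x
    unfolding norm_mult using F(2)[of n x] by (simp add: norm_power mult_left_mono)
  have nsumm: "summable (\<lambda>n. norm (complex_of_real ((1/2)^n) * F n x))" for x
    by (rule summable_comparison_test'[OF summ2[of x]]) (use bd in auto)
  have summ: "summable (\<lambda>n. complex_of_real ((1/2)^n) * F n x)" for x
    by (rule summable_norm_cancel[OF nsumm])
  have Fadd: "F n (x + y) = F n x + F n y" and Fsc: "F n (c *\<^sub>C x) = c * F n x"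
    and Fst: "F n (star x) = cnj (F n x)" and Fpos: "0 \<le> Re (F n (star x * x))" for n x y c
    using F(1)[of n] by (auto simp: positive_functional_def)
  have Re_f: "Re (f x) = (\<Sum>n. (1/2)^n * Re (F n x))" "summable (\<lambda>n. (1/2)^n * Re (F n x))" for x
    using Re_suminf[OF summ[of x]] summable_Re[OF summ[of x]] by (auto simp: f_def)
  have "positive_functional f"
    unfolding positive_functional_def
  proof (intro conjI allI)
    show "f (x + y) = f x + f y" for x y
      unfolding f_def suminf_add[OF summ summ] by (simp add: Fadd algebra_simps)
    show "f (c *\<^sub>C x) = c * f x" for c x
      unfolding f_def suminf_mult[OF summ, symmetric] by (simp add: Fsc algebra_simps)
    show "f (star x) = cnj (f x)" for x
    proof -
      have "(\<lambda>n. cnj (complex_of_real ((1/2)^n) * F n x)) sums cnj (f x)"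
        unfolding sums_cnj f_def by (rule summable_sums[OF summ])
      then show ?thesis by (simp add: f_def sums_iff Fst)
    qed
    show "0 \<le> Re (f (star x * x))" for x
      unfolding Re_f(1) by (intro suminf_nonneg Re_f(2)) (simp add: Fpos)
  qed
  moreover have "cmod (f x) \<le> 4 * norm x" for x
  proof -
    have "cmod (f x) \<le> (\<Sum>n. norm (complex_of_real ((1/2)^n) * F n x))"
      unfolding f_def by (rule summable_norm[OF nsumm])
    also have "\<dots> \<le> (\<Sum>n. (1/2)^n * (2 * norm x))"
      by (rule suminf_le[OF bd nsumm summ2])
    also have "\<dots> = 4 * norm x"
      by (simp add: suminf_geometric flip: suminf_mult2)
    finally show ?thesis .
  qed
  moreover have "a = 0" if f0: "f (star a * a) = 0" for a
  proof -
    have "(\<Sum>n. (1/2)^n * Re (F n (star a * a))) = 0" using Re_f(1)[of "star a * a"] f0 by simp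
    then have Re0: "Re (F n (star a * a)) = 0" for n
      using suminf_eq_zero_iff[OF Re_f(2)[of "star a * a"]] Fpos[of _ a] by simp
    have close: "(norm (d n))\<^sup>2 \<le> 2 * norm (star (d n) * d n - star a * a)" for n
    proof -
      have "Re (F n (star (d n) * d n)) = Re (F n (star (d n) * d n - star a * a)) + Re (F n (star a * a))"
        using Fadd[of n "star (d n) * d n - star a * a" "star a * a"] by simp
      also have "\<dots> \<le> 2 * norm (star (d n) * d n - star a * a)"
        using Re0[of n] F(2)[of n "star (d n) * d n - star a * a"]
          complex_Re_le_cmod[of "F n (star (d n) * d n - star a * a)"] by simp
      finally show ?thesis unfolding F(3) by simp
    qed
    have "a \<in> closure D" using assms(2) by simp
    then obtain X where X: "\<And>n. X n \<in> D" "X \<longlonglongrightarrow> a" by (auto simp: closure_sequential)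
    have "(norm (X n))\<^sup>2 \<le> 2 * norm (star (X n) * X n - star a * a)" for n
      using X(1)[of n] close d by (metis imageE)
    moreover have "(\<lambda>n. (norm (X n))\<^sup>2) \<longlonglongrightarrow> (norm a)\<^sup>2" by (intro tendsto_intros X)
    moreover have "(\<lambda>n. 2 * norm (star (X n) * X n - star a * a)) \<longlonglongrightarrow> 2 * norm (star a * a - star a * a)"
      by (intro tendsto_intros X bounded_linear.tendsto[OF bounded_linear_star])
    ultimately have "(norm a)\<^sup>2 \<le> 2 * norm (star a * a - star a * a)"
      using LIMSEQ_le by blast
    then show "a = 0" by simp
  qed
  ultimately show ?thesis using that by blast
qed

section \<open>Complex Hilbert spaces\<close>

subsection \<open>The inner product\<close>

lemma cinner_add_right: "cinner x (y + z) = cinner x y + cinner x z"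
  by (subst (1 2 3) cinner_commute) (simp add: cinner_add_left)

lemma cinner_scaleC_right: "cinner x (c *\<^sub>C y) = cnj c * cinner x y"
  by (subst (1 2) cinner_commute) (simp add: cinner_scaleC_left)

lemma cinner_zero_left [simp]: "cinner 0 y = 0"
  using cinner_scaleC_left[of 0 0 y] by simp

lemma cinner_zero_right [simp]: "cinner x 0 = 0"
  using cinner_scaleC_right[of x 0 0] by simp

lemma cinner_minus_left: "cinner (- x) y = - cinner x y"
  using cinner_add_left[of "- x" x y] by (simp add: eq_neg_iff_add_eq_0)

lemma cinner_minus_right: "cinner x (- y) = - cinner x y"
  using cinner_add_right[of x "- y" y] by (simp add: eq_neg_iff_add_eq_0)

lemma cinner_diff_left: "cinner (x - y) z = cinner x z - cinner y z"
  using cinner_add_left[of x "- y" z] by (simp add: cinner_minus_left)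

lemma cinner_diff_right: "cinner x (y - z) = cinner x y - cinner x z"
  using cinner_add_right[of x y "- z"] by (simp add: cinner_minus_right)

lemmas cinner_simps = cinner_add_left cinner_add_right cinner_scaleC_left cinner_scaleC_right
  cinner_minus_left cinner_minus_right cinner_diff_left cinner_diff_right

lemma cinner_self: "cinner x x = of_real ((norm x)\<^sup>2)"
proof -
  have "Im (cinner x x) = 0" using cinner_commute[of x x] by (simp add: complex_eq_iff)
  then show ?thesis
    by (simp add: complex_eq_iff power2_norm_eq_inner inner_Re_cinner)
qed

lemma cinner_self_eq_0: "cinner x x = 0 \<longleftrightarrow> x = 0"
  by (simp add: cinner_self)

lemma eq_if_cinner_eq: "(\<And>z. cinner x z = cinner y z) \<Longrightarrow> x = y"
  using cinner_self_eq_0[of "x - y"] by (simp add: cinner_diff_left)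

lemma eq_if_cinner_eq_right: "(\<And>z. cinner z x = cinner z y) \<Longrightarrow> x = y"
  using cinner_self_eq_0[of "x - y"] by (simp add: cinner_diff_right)

lemma cinner_eq_0_commute: "cinner x y = 0 \<longleftrightarrow> cinner y x = 0"
  by (metis cinner_commute complex_cnj_zero)

lemma norm_scaleC_hilbert: "norm (c *\<^sub>C x) = cmod c * norm (x::'h::complex_hilbert_space)"
proof (rule power2_eq_imp_eq)
  have "complex_of_real ((norm (c *\<^sub>C x))\<^sup>2) = of_real ((cmod c * norm x)\<^sup>2)"
    unfolding cinner_self[symmetric] cinner_scaleC_left cinner_scaleC_right
    by (simp add: cinner_self power_mult_distrib mult.assoc[symmetric] complex_norm_square[symmetric]
        mult.commute[of "cnj c"])
  then show "(norm (c *\<^sub>C x))\<^sup>2 = (cmod c * norm x)\<^sup>2" by (simp only: of_real_eq_iff)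
qed auto

lemma cmod_cinner_le: "cmod (cinner x y) \<le> norm x * norm y"
proof (cases "cinner x y = 0")
  case False
  define c where "c = cnj (cinner x y) / cmod (cinner x y)"
  have "cinner (c *\<^sub>C x) y = cmod (cinner x y)"
    using False by (simp add: cinner_scaleC_left c_def complex_norm_square[symmetric] mult.commute
        power2_eq_square)
  then have "cmod (cinner x y) = inner (c *\<^sub>C x) y" by (simp add: inner_Re_cinner)
  also have "\<dots> \<le> norm (c *\<^sub>C x) * norm y" by (rule norm_cauchy_schwarz)
  also have "norm (c *\<^sub>C x) = norm x"
    using False by (simp add: norm_scaleC_hilbert c_def norm_divide)
  finally show ?thesis .
qed simp

lemma scaleR_scaleC_commute: "c *\<^sub>C r *\<^sub>R x = r *\<^sub>R c *\<^sub>C (x::'a::complex_vector)"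
  by (simp add: scaleR_scaleC mult.commute)

lemma cinner_scaleR_left: "cinner (r *\<^sub>R x) y = r * cinner x y"
  by (simp add: scaleR_scaleC cinner_scaleC_left)

lemma cinner_scaleR_right: "cinner x (r *\<^sub>R y) = r * cinner x y"
  by (simp add: scaleR_scaleC cinner_scaleC_right)

lemma bounded_bilinear_cinner:
  "bounded_bilinear (cinner :: 'h::complex_hilbert_space \<Rightarrow> 'h \<Rightarrow> complex)"
proof
  show "\<exists>K. \<forall>x y :: 'h. norm (cinner x y) \<le> norm x * norm y * K"
    by (rule exI[of _ 1]) (simp add: cmod_cinner_le)
qed (simp_all add: cinner_add_left cinner_add_right cinner_scaleR_left cinner_scaleR_right scaleR_conv_of_real)

lemmas tendsto_cinner = bounded_bilinear.tendsto[OF bounded_bilinear_cinner]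

lemma bounded_linear_scaleC_right:
  "bounded_linear (\<lambda>x::'h::complex_hilbert_space. c *\<^sub>C x)"
  by (rule bounded_linear_intro[of _ "cmod c"])
    (simp_all add: scaleC_add_right scaleR_scaleC_commute norm_scaleC_hilbert mult.commute)

lemmas tendsto_scaleC_right = bounded_linear.tendsto[OF bounded_linear_scaleC_right]

lemma closed_csubspaceD:
  assumes "closed_csubspace M"
  shows "0 \<in> M" "x \<in> M \<Longrightarrow> y \<in> M \<Longrightarrow> x + y \<in> M" "x \<in> M \<Longrightarrow> c *\<^sub>C x \<in> M"
    "x \<in> M \<Longrightarrow> y \<in> M \<Longrightarrow> x - y \<in> M" "x \<in> M \<Longrightarrow> r *\<^sub>R x \<in> M" "closed M"
  using assms complex_vector.subspace_diff
  by (auto simp: closed_csubspace_def complex_vector.subspace_def scaleR_scaleC)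

lemma orth_complD: "x \<in> orth_compl M \<Longrightarrow> y \<in> M \<Longrightarrow> cinner x y = 0"
  "x \<in> orth_compl M \<Longrightarrow> y \<in> M \<Longrightarrow> cinner y x = 0"
  using cinner_eq_0_commute by (auto simp: orth_compl_def)

lemma closed_csubspace_orth_compl: "closed_csubspace (orth_compl M)"
proof -
  have "closed (orth_compl M)"
    unfolding closed_sequential_limits
  proof (intro allI impI)
      fix X l assume X: "(\<forall>n. X n \<in> orth_compl M) \<and> X \<longlonglongrightarrow> l"
      have "cinner l y = 0" if "y \<in> M" for y
      proof -
        have "(\<lambda>n. cinner (X n) y) \<longlonglongrightarrow> cinner l y"
          using X by (intro tendsto_cinner tendsto_const) auto
        moreover have "(\<lambda>n. cinner (X n) y) = (\<lambda>n. 0)"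
          using X that orth_complD(1) by (intro ext) blast
        ultimately show ?thesis using LIMSEQ_unique tendsto_const by metis
      qed
      then show "l \<in> orth_compl M" by (simp add: orth_compl_def)
  qed
  then show ?thesis
    by (auto simp: closed_csubspace_def complex_vector.subspace_def orth_compl_def cinner_simps)
qed

lemma orth_compl_disjoint: "x \<in> M \<Longrightarrow> x \<in> orth_compl M \<Longrightarrow> x = 0"
  using orth_complD(1) cinner_self_eq_0 by blast

lemma orth_compl_antimono: "M \<subseteq> N \<Longrightarrow> orth_compl N \<subseteq> orth_compl M"
  by (auto simp: orth_compl_def)

lemma orth_compl_closure: "orth_compl (closure M) = orth_compl M"
proof
  show "orth_compl M \<subseteq> orth_compl (closure M)"
  proof
    fix x assume x: "x \<in> orth_compl M"
    then have "M \<subseteq> orth_compl {x}"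
      by (auto simp: orth_compl_def cinner_eq_0_commute)
    then have "closure M \<subseteq> orth_compl {x}"
      using closed_csubspaceD(6)[OF closed_csubspace_orth_compl] closure_minimal by blast
    then show "x \<in> orth_compl (closure M)"
      by (auto simp: orth_compl_def cinner_eq_0_commute)
  qed
qed (rule orth_compl_antimono[OF closure_subset])

subsection \<open>The projection theorem\<close>

text \<open>A minimising sequence for the distance from \<open>x\<close> to \<open>M\<close> is Cauchy by the parallelogram law; at
  the minimum, \<open>x - y\<close> is orthogonal to \<open>M\<close> for the real inner product, and for the complex one because \<open>M\<close>
  is invariant under multiplication by \<open>\<i>\<close>.\<close>

lemma projection_exists:
  fixes x :: "'h::complex_hilbert_space"
  assumes M: "closed_csubspace M"
  obtains y where "y \<in> M" "x - y \<in> orth_compl M"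
proof -
  note cs = closed_csubspaceD[OF M]
  define S where "S = (\<lambda>y. (norm (x - y))\<^sup>2) ` M"
  define \<delta> where "\<delta> = Inf S"
  have "S \<noteq> {}" using cs(1) by (auto simp: S_def)
  have bdd: "bdd_below S" by (auto simp: S_def intro!: bdd_belowI[of _ 0])
  have \<delta>: "\<delta> \<le> (norm (x - y))\<^sup>2" if "y \<in> M" for y
    unfolding \<delta>_def using that by (intro cInf_lower bdd) (simp add: S_def)
  have "\<exists>y\<in>M. (norm (x - y))\<^sup>2 < \<delta> + inverse (real (Suc n))" for n
    using cInf_lessD[OF \<open>S \<noteq> {}\<close>, of "\<delta> + inverse (real (Suc n))"]
    by (auto simp: \<delta>_def S_def)
  then obtain Y where Y: "\<And>n. Y n \<in> M" "\<And>n. (norm (x - Y n))\<^sup>2 < \<delta> + inverse (real (Suc n))"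
    by metis
  have dist: "(norm (Y m - Y n))\<^sup>2 \<le> 2 * inverse (real (Suc m)) + 2 * inverse (real (Suc n))" for m n
  proof -
    have para: "(norm (a - b))\<^sup>2 + 4 * (norm (x - (1/2) *\<^sub>R (a + b)))\<^sup>2
        = 2 * (norm (x - a))\<^sup>2 + 2 * (norm (x - b))\<^sup>2" for a b
      by (simp add: power2_norm_eq_inner inner_simps inner_commute algebra_simps)
    have "(1/2) *\<^sub>R (Y m + Y n) \<in> M" using Y cs by auto
    then show ?thesis using para[of "Y m" "Y n"] \<delta> Y(2)[of m] Y(2)[of n] by fastforce
  qed
  have "Cauchy Y"
  proof (rule CauchyI)
    fix e :: real assume e: "0 < e"
    then obtain N where N: "inverse (real (Suc N)) < e\<^sup>2 / 4"
      using reals_Archimedean[of "e\<^sup>2 / 4"] by auto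
    have "norm (Y m - Y n) < e" if "m \<ge> N" "n \<ge> N" for m n
    proof (rule power2_less_imp_less)
      have le: "inverse (real (Suc k)) \<le> inverse (real (Suc N))" if "k \<ge> N" for k
        using that by (intro le_imp_inverse_le) auto
      show "(norm (Y m - Y n))\<^sup>2 < e\<^sup>2"
        using dist[of m n] N le[OF \<open>m \<ge> N\<close>] le[OF \<open>n \<ge> N\<close>] by linarith
    qed (use e in simp)
    then show "\<exists>N. \<forall>m\<ge>N. \<forall>n\<ge>N. norm (Y m - Y n) < e" by blast
  qed
  then obtain y where y: "Y \<longlonglongrightarrow> y" by (auto simp: Cauchy_convergent_iff convergent_def)
  have yM: "y \<in> M" using closed_sequentially[OF cs(6)] Y(1) y by blast
  have "(norm (x - y))\<^sup>2 \<le> \<delta> + 0"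
  proof (rule LIMSEQ_le)
    show "(\<lambda>n. (norm (x - Y n))\<^sup>2) \<longlonglongrightarrow> (norm (x - y))\<^sup>2" by (intro tendsto_intros y)
    show "(\<lambda>n. \<delta> + inverse (real (Suc n))) \<longlonglongrightarrow> \<delta> + 0"
      by (intro tendsto_intros LIMSEQ_inverse_real_of_nat)
    show "\<exists>N. \<forall>n\<ge>N. (norm (x - Y n))\<^sup>2 \<le> \<delta> + inverse (real (Suc n))"
      using Y(2) less_imp_le by blast
  qed
  then have min: "(norm (x - y))\<^sup>2 \<le> (norm (x - z))\<^sup>2" if "z \<in> M" for z
    using \<delta>[OF that] by linarith
  have inner0: "inner (x - y) m = 0" if "m \<in> M" for m
  proof (cases "m = 0")
    case False
    \<comment> \<open>the minimiser of \<open>\<parallel>x - y - tm\<parallel>\<close>\<close>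
    define t where "t = inner (x - y) m / (norm m)\<^sup>2"
    have "(norm (x - y))\<^sup>2 \<le> (norm (x - y - t *\<^sub>R m))\<^sup>2"
      using min[OF cs(2)[OF yM cs(5)[OF that, of t]]] by (simp add: diff_diff_eq)
    also have "\<dots> = (norm (x - y))\<^sup>2 - 2 * t * inner (x - y) m + t\<^sup>2 * (norm m)\<^sup>2"
      using dot_norm_neg[of "x - y" "t *\<^sub>R m"] by (simp add: power_mult_distrib field_simps)
    also have "\<dots> = (norm (x - y))\<^sup>2 - (inner (x - y) m)\<^sup>2 / (norm m)\<^sup>2"
      using False by (simp add: t_def field_simps power2_eq_square)
    finally show ?thesis using False by (simp add: field_simps)
  qed simp
  have "cinner (x - y) m = 0" if "m \<in> M" for m
    using inner0[OF that] inner0[OF cs(3)[OF that, of \<i>]]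
    by (simp add: inner_Re_cinner cinner_scaleC_right complex_eq_iff)
  then show ?thesis using that yM by (simp add: orth_compl_def)
qed

lemma identity_on_eqI:
  assumes "closed_csubspace M" "y \<in> M" "x - y \<in> orth_compl M"
  shows "identity_on M x = y"
  unfolding identity_on_def
proof (rule the_equality)
  fix z assume z: "z \<in> M \<and> x - z \<in> orth_compl M"
  have "y - z \<in> M" "(x - z) - (x - y) \<in> orth_compl M"
    using assms z closed_csubspaceD(4) closed_csubspace_orth_compl by blast+
  then have "y - z = 0" using orth_compl_disjoint[of "y - z" M] by simp
  then show "z = y" by simp
qed (use assms in simp)

lemma identity_on_mem:
  assumes "closed_csubspace M"
  shows "identity_on M x \<in> M" "x - identity_on M x \<in> orth_compl M"
proof -
  obtain y where "y \<in> M" "x - y \<in> orth_compl M" using projection_exists[OF assms] .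
  with identity_on_eqI[OF assms this] show "identity_on M x \<in> M" "x - identity_on M x \<in> orth_compl M"
    by auto
qed

lemma identity_on_of_mem: "closed_csubspace M \<Longrightarrow> x \<in> M \<Longrightarrow> identity_on M x = x"
  by (rule identity_on_eqI) (use closed_csubspaceD(1)[OF closed_csubspace_orth_compl] in auto)

lemma identity_on_of_orth: "closed_csubspace M \<Longrightarrow> x \<in> orth_compl M \<Longrightarrow> identity_on M x = 0"
  by (rule identity_on_eqI) (use closed_csubspaceD(1) in auto)

lemma closed_csubspace_UNIV: "closed_csubspace UNIV"
  by (simp add: closed_csubspace_def complex_vector.subspace_UNIV)

lemma identity_on_UNIV: "identity_on UNIV = id"
  using identity_on_of_mem[OF closed_csubspace_UNIV] by (auto simp: fun_eq_iff)

lemma orth_compl_orth_compl: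
  assumes "closed_csubspace M"
  shows "orth_compl (orth_compl M) = M"
proof
  show "M \<subseteq> orth_compl (orth_compl M)"
    using orth_complD(2) by (auto simp: orth_compl_def[of "orth_compl M"])
  show "orth_compl (orth_compl M) \<subseteq> M"
  proof
    fix x assume x: "x \<in> orth_compl (orth_compl M)"
    have "x - identity_on M x \<in> orth_compl (orth_compl M)"
      using x identity_on_mem(1)[OF assms] \<open>M \<subseteq> _\<close> closed_csubspaceD(4)[OF closed_csubspace_orth_compl]
      by blast
    then have "x - identity_on M x = 0"
      using identity_on_mem(2)[OF assms] orth_compl_disjoint by blast
    then show "x \<in> M" using identity_on_mem(1)[OF assms, of x] by simp
  qed
qed

subsection \<open>Bounded operators and adjoints\<close>

lemma bounded_clinearD:
  assumes "bounded_clinear T"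
  shows "bounded_linear T" "T (x + y) = T x + T y" "T (c *\<^sub>C x) = c *\<^sub>C T x" "T 0 = 0"
    "T (x - y) = T x - T y" "T (- x) = - T x"
  using assms by (auto simp: bounded_clinear_def linear_simps)

lemma bounded_clinearI:
  assumes "\<And>x y. T (x + y) = T x + T y" "\<And>c x. T (c *\<^sub>C x) = c *\<^sub>C T x" "\<And>x. norm (T x) \<le> norm x * K"
  shows "bounded_clinear T"
  unfolding bounded_clinear_def
  using assms by (auto simp: scaleR_scaleC intro!: bounded_linear_intro[of _ K])

lemma bounded_clinear_compose: "bounded_clinear S \<Longrightarrow> bounded_clinear T \<Longrightarrow> bounded_clinear (\<lambda>x. S (T x))"
  by (auto simp: bounded_clinear_def bounded_linear_compose)

lemma bounded_clinear_add: "bounded_clinear S \<Longrightarrow> bounded_clinear T \<Longrightarrow> bounded_clinear (\<lambda>x. S x + T x)"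
  by (auto simp: bounded_clinear_def bounded_linear_add scaleC_add_right)

lemma bounded_clinear_diff: "bounded_clinear S \<Longrightarrow> bounded_clinear T \<Longrightarrow> bounded_clinear (\<lambda>x. S x - T x)"
  by (auto simp: bounded_clinear_def bounded_linear_sub scaleC_diff_right)

lemma bounded_clinear_ident: "bounded_clinear (\<lambda>x. x)"
  by (simp add: bounded_clinear_def bounded_linear_ident)

lemma bounded_clinear_identity_on:
  assumes M: "closed_csubspace M"
  shows "bounded_clinear (identity_on M)"
proof (rule bounded_clinearI[of _ 1])
  note mem = identity_on_mem[OF M] and cs = closed_csubspaceD[OF M]
    and cso = closed_csubspaceD[OF closed_csubspace_orth_compl[of M]]
  show "identity_on M (x + y) = identity_on M x + identity_on M y" for x y
  proof (rule identity_on_eqI[OF M])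
    have "(x - identity_on M x) + (y - identity_on M y) \<in> orth_compl M"
      by (intro cso(2) mem(2))
    then show "x + y - (identity_on M x + identity_on M y) \<in> orth_compl M" by (simp add: algebra_simps)
  qed (use mem cs in auto)
  show "identity_on M (c *\<^sub>C x) = c *\<^sub>C identity_on M x" for c x
  proof (rule identity_on_eqI[OF M])
    have "c *\<^sub>C (x - identity_on M x) \<in> orth_compl M" by (intro cso(3) mem(2))
    then show "c *\<^sub>C x - c *\<^sub>C identity_on M x \<in> orth_compl M" by (simp add: scaleC_diff_right)
  qed (use mem cs in auto)
  show "norm (identity_on M x) \<le> norm x * 1" for x
  proof -
    have "cinner (x - identity_on M x) (identity_on M x) = 0"
      using mem[of x] orth_complD by blast
    then have "inner (x - identity_on M x) (identity_on M x) = 0" by (simp add: inner_Re_cinner)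
    then have "(norm ((x - identity_on M x) + identity_on M x))\<^sup>2
        = (norm (x - identity_on M x))\<^sup>2 + (norm (identity_on M x))\<^sup>2"
      by (intro norm_add_Pythagorean) (simp add: orthogonal_def)
    then have "(norm (identity_on M x))\<^sup>2 \<le> (norm x)\<^sup>2" by simp
    then show ?thesis using power2_le_imp_le by fastforce
  qed
qed

text \<open>A vector \<open>w \<noteq> 0\<close> orthogonal to the kernel spans its orthogonal complement, so \<open>\<phi>\<close> is a multiple of
  the inner product with \<open>w\<close>.\<close>

lemma riesz_representation:
  fixes \<phi> :: "'h::complex_hilbert_space \<Rightarrow> complex"
  assumes bl: "bounded_linear \<phi>" and hom: "\<And>c x. \<phi> (c *\<^sub>C x) = c * \<phi> x"
  obtains z where "\<And>x. \<phi> x = cinner x z"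
proof (cases "\<forall>x. \<phi> x = 0")
  case True
  then show ?thesis using that[of 0] by simp
next
  case False
  then obtain x0 where x0: "\<phi> x0 \<noteq> 0" by blast
  define K where "K = {x. \<phi> x = 0}"
  have "closed K"
    unfolding K_def by (intro closed_Collect_eq continuous_on_const linear_continuous_on bl)
  then have K: "closed_csubspace K"
    using bl by (auto simp: closed_csubspace_def complex_vector.subspace_def K_def hom linear_simps)
  define w where "w = x0 - identity_on K x0"
  have wK: "w \<in> orth_compl K" unfolding w_def by (rule identity_on_mem(2)[OF K])
  have "\<phi> w = \<phi> x0"
    using identity_on_mem(1)[OF K, of x0] bl by (simp add: w_def linear_simps K_def)
  then have w0: "\<phi> w \<noteq> 0" "w \<noteq> 0" using x0 bl by (auto simp: linear_simps)
  show ?thesis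
  proof (rule that[of "(cnj (\<phi> w) / (norm w)\<^sup>2) *\<^sub>C w"])
    fix x
    have "x - (\<phi> x / \<phi> w) *\<^sub>C w \<in> K" using w0 bl by (simp add: K_def linear_simps hom)
    then have "cinner (x - (\<phi> x / \<phi> w) *\<^sub>C w) w = 0" using wK orth_complD by blast
    then have "cinner x w = (\<phi> x / \<phi> w) * (norm w)\<^sup>2" by (simp add: cinner_simps cinner_self)
    then show "\<phi> x = cinner x ((cnj (\<phi> w) / (norm w)\<^sup>2) *\<^sub>C w)"
      using w0 by (simp add: cinner_scaleC_right)
  qed
qed

lemma cadjoint_eqI:
  assumes "\<And>x y. cinner (T x) y = cinner x (S y)"
  shows "cadjoint T = S"
  unfolding cadjoint_def
proof (rule the_equality)
  fix S' assume "\<forall>x y. cinner (T x) y = cinner x (S' y)"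
  then have "cinner x (S' y) = cinner x (S y)" for x y using assms by metis
  then show "S' = S" by (intro ext eq_if_cinner_eq_right)
qed (use assms in blast)

lemma cinner_cadjoint:
  assumes T: "bounded_clinear T"
  shows "cinner (T x) y = cinner x (cadjoint T y)"
proof -
  have "\<exists>z. \<forall>x. cinner (T x) y = cinner x z" for y
  proof -
    have "bounded_linear (\<lambda>x. cinner (T x) y)"
      using bounded_linear_compose[OF bounded_bilinear.bounded_linear_left[OF bounded_bilinear_cinner]
          bounded_clinearD(1)[OF T]] .
    moreover have "cinner (T (c *\<^sub>C x)) y = c * cinner (T x) y" for c x
      by (simp add: bounded_clinearD(3)[OF T] cinner_scaleC_left)
    ultimately obtain z where "\<And>x. cinner (T x) y = cinner x z"
      using riesz_representation[of "\<lambda>x. cinner (T x) y"] by blast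
    then show ?thesis by blast
  qed
  then obtain S where "\<And>x y. cinner (T x) y = cinner x (S y)" by metis
  then show ?thesis using cadjoint_eqI[of T S] by simp
qed

lemma cinner_cadjoint_right:
  "bounded_clinear T \<Longrightarrow> cinner x (T y) = cinner (cadjoint T x) y"
  using cinner_cadjoint[of T y x] by (metis cinner_commute)

lemma bounded_clinear_cadjoint:
  assumes T: "bounded_clinear T"
  shows "bounded_clinear (cadjoint T)"
proof (rule bounded_clinearI[of _ "onorm T"])
  note adj = cinner_cadjoint[OF T, symmetric]
  show "cadjoint T (x + y) = cadjoint T x + cadjoint T y" for x y
    by (rule eq_if_cinner_eq_right) (simp add: adj cinner_simps)
  show "cadjoint T (c *\<^sub>C x) = c *\<^sub>C cadjoint T x" for c x
    by (rule eq_if_cinner_eq_right) (simp add: adj cinner_simps)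
  show "norm (cadjoint T x) \<le> norm x * onorm T" for x
  proof (cases "cadjoint T x = 0")
    case False
    have "(norm (cadjoint T x))\<^sup>2 = cmod (cinner (T (cadjoint T x)) x)"
      by (simp add: cinner_cadjoint[OF T] cinner_self norm_power)
    also have "\<dots> \<le> norm (T (cadjoint T x)) * norm x" by (rule cmod_cinner_le)
    also have "\<dots> \<le> (onorm T * norm (cadjoint T x)) * norm x"
      by (intro mult_right_mono onorm[OF bounded_clinearD(1)[OF T]]) simp
    finally show ?thesis using False by (simp add: power2_eq_square mult_ac)
  qed (simp add: onorm_pos_le[OF bounded_clinearD(1)[OF T]])
qed

lemma cadjoint_compose:
  assumes "bounded_clinear S" "bounded_clinear T"
  shows "cadjoint (\<lambda>x. S (T x)) = (\<lambda>x. cadjoint T (cadjoint S x))"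
  by (rule cadjoint_eqI) (simp add: cinner_cadjoint assms)

lemma cadjoint_identity_on:
  assumes M: "closed_csubspace M"
  shows "cadjoint (identity_on M) = identity_on M"
proof (rule cadjoint_eqI)
  fix x y
  have "cinner (identity_on M x) (y - identity_on M y) = 0"
    "cinner (x - identity_on M x) (identity_on M y) = 0"
    using identity_on_mem[OF M] orth_complD by blast+
  then show "cinner (identity_on M x) y = cinner x (identity_on M y)"
    by (simp add: cinner_simps)
qed

section \<open>Embedding separable semi-inner product spaces into the sequence space\<close>

definition clinear :: "('v::complex_vector \<Rightarrow> 'w::complex_vector) \<Rightarrow> bool" where
  "clinear T \<longleftrightarrow> (\<forall>x y. T (x + y) = T x + T y) \<and> (\<forall>c x. T (c *\<^sub>C x) = c *\<^sub>C T x)"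

lemma clinearD:
  assumes "clinear T"
  shows "T (x + y) = T x + T y" "T (c *\<^sub>C x) = c *\<^sub>C T x" "T 0 = 0" "T (x - y) = T x - T y"
proof -
  show add: "T (x + y) = T x + T y" and "T (c *\<^sub>C x) = c *\<^sub>C T x" for x y c
    using assms by (auto simp: clinear_def)
  show "T 0 = 0" using add[of 0 0] by simp
  show "T (x - y) = T x - T y" using add[of "x - y" y] by simp
qed

text \<open>Semi-inner products are used instead of inner products so that no quotient has to be formed:
  the form \<open>f(b\<^sup>*a)\<close> on the algebra and the form \<open>\<langle>\<triangle>\<^sub>R x, x'\<rangle>\<close> need not be definite.\<close>

locale semi_inner_product =
  fixes s :: "'v::complex_vector \<Rightarrow> 'v \<Rightarrow> complex"
  assumes add_left: "s (x + y) z = s x z + s y z"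
    and scaleC_left: "s (c *\<^sub>C x) y = c * s x y"
    and commute: "s x y = cnj (s y x)"
    and nonneg: "0 \<le> Re (s x x)"
begin

lemma add_right: "s x (y + z) = s x y + s x z"
  by (subst (1 2 3) commute) (simp add: add_left)

lemma scaleC_right: "s x (c *\<^sub>C y) = cnj c * s x y"
  by (subst (1 2) commute) (simp add: scaleC_left)

lemma zero_left [simp]: "s 0 x = 0"
  using scaleC_left[of 0 0 x] by simp

lemma zero_right [simp]: "s x 0 = 0"
  using scaleC_right[of x 0 0] by simp

lemma diff_left: "s (x - y) z = s x z - s y z"
  using add_left[of "x - y" y z] by simp

lemma diff_right: "s x (y - z) = s x y - s x z"
  using add_right[of x "y - z" z] by simp

lemma sum_left: "s (\<Sum>i\<in>I. f i) y = (\<Sum>i\<in>I. s (f i) y)"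
  by (induction I rule: infinite_finite_induct) (simp_all add: add_left)

lemma scaleR_left: "s (r *\<^sub>R x) y = r * s x y"
  by (simp add: scaleR_scaleC scaleC_left)

lemma scaleR_right: "s x (r *\<^sub>R y) = r * s x y"
  by (simp add: scaleR_scaleC scaleC_right)

lemmas sesquilinear = add_left add_right diff_left diff_right scaleC_left scaleC_right
  scaleR_left scaleR_right

lemma Im_self: "Im (s x x) = 0"
  using commute[of x x] by (simp add: complex_eq_iff)

lemma self_of_real: "s x x = of_real (Re (s x x))"
  by (simp add: complex_eq_iff Im_self)

lemma Re_commute: "Re (s x y) = Re (s y x)"
  by (subst commute) simp

lemma Re_add_le: "Re (s (x + y) (x + y)) \<le> 2 * Re (s x x) + 2 * Re (s y y)"
  using nonneg[of "x - y"] by (simp add: sesquilinear)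

end

text \<open>Since the form may be degenerate, a residual of length zero is replaced by the zero vector. The
  resulting sequence is orthonormal up to zero vectors, and these do no harm in the sums below.\<close>

fun gram_schmidt :: "('v::complex_vector \<Rightarrow> 'v \<Rightarrow> complex) \<Rightarrow> (nat \<Rightarrow> 'v) \<Rightarrow> nat \<Rightarrow> 'v" where
  "gram_schmidt s d n =
     (let u = d n - (\<Sum>i<n. s (d n) (gram_schmidt s d i) *\<^sub>C gram_schmidt s d i)
      in if Re (s u u) = 0 then 0 else (1 / sqrt (Re (s u u))) *\<^sub>R u)"

declare gram_schmidt.simps [simp del]

context semi_inner_product
begin

context
  fixes d :: "nat \<Rightarrow> 'v"
begin

abbreviation "e \<equiv> gram_schmidt s d"
abbreviation "proj N v \<equiv> \<Sum>i<N. s v (e i) *\<^sub>C e i"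
abbreviation "resid n \<equiv> d n - proj n (d n)"

lemma e_eq: "e n = (if Re (s (resid n) (resid n)) = 0 then 0
    else (1 / sqrt (Re (s (resid n) (resid n)))) *\<^sub>R resid n)"
  by (subst gram_schmidt.simps) (simp add: Let_def)

lemma e_self: "e n = 0 \<or> s (e n) (e n) = 1"
proof -
  define u where "u = resid n"
  have en: "e n = (if Re (s u u) = 0 then 0 else (1 / sqrt (Re (s u u))) *\<^sub>R u)"
    unfolding u_def by (rule e_eq)
  have "s ((1 / sqrt (Re (s u u))) *\<^sub>R u) ((1 / sqrt (Re (s u u))) *\<^sub>R u) = 1" if "Re (s u u) \<noteq> 0"
  proof -
    have "sqrt (Re (s u u)) * sqrt (Re (s u u)) = Re (s u u)" using nonneg[of u] by simp
    then have "complex_of_real (sqrt (Re (s u u))) * complex_of_real (sqrt (Re (s u u))) = s u u"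
      using self_of_real[of u] by (metis of_real_mult)
    moreover have "s u u \<noteq> 0" using that by auto
    ultimately show ?thesis by (simp add: sesquilinear)
  qed
  then show ?thesis unfolding en by simp
qed

lemma e_orthogonal: "j < n \<Longrightarrow> s (e n) (e j) = 0"
proof (induction n arbitrary: j rule: less_induct)
  case (less n)
  have orth: "s (e i) (e j) = 0" if "i < n" "i \<noteq> j" for i
    using less.IH[of i j] less.IH[of j i] less.prems that commute[of "e i" "e j"]
    by (cases "i < j") auto
  have "s (proj n (d n)) (e j) = (\<Sum>i<n. s (d n) (e i) * s (e i) (e j))"
    by (simp add: sum_left scaleC_left)
  also have "\<dots> = (\<Sum>i\<in>{j}. s (d n) (e i) * s (e i) (e j))"
    using less.prems orth by (intro sum.mono_neutral_right) auto
  also have "\<dots> = s (d n) (e j)" using e_self[of j] by auto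
  finally have "s (resid n) (e j) = 0" by (simp add: diff_left)
  then show ?case by (subst e_eq) (simp add: scaleR_left)
qed

lemma proj_e: "n \<ge> N \<Longrightarrow> s (proj N v) (e n) = 0"
proof -
  assume "n \<ge> N"
  then have "s (e i) (e n) = 0" if "i < N" for i
    using e_orthogonal[of i n] that commute[of "e i" "e n"] by simp
  then show ?thesis by (simp add: sum_left scaleC_left)
qed

lemma bessel: "Re (s (v - proj N v) (v - proj N v)) = Re (s v v) - (\<Sum>i<N. (cmod (s v (e i)))\<^sup>2)"
proof (induction N)
  case (Suc N)
  define w where "w = v - proj N v"
  define c where "c = s v (e N)"
  have we: "s w (e N) = c" by (simp add: w_def c_def diff_left proj_e)
  then have ew: "s (e N) w = cnj c" using commute[of "e N" w] by simp
  have cc: "c * cnj c = (cmod c)\<^sup>2" by (simp only: complex_norm_square)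
  have "Re (s (w - c *\<^sub>C e N) (w - c *\<^sub>C e N)) = Re (s w w) - (cmod c)\<^sup>2"
    using e_self[of N]
  proof
    assume "e N = 0"
    then show ?thesis by (simp add: c_def)
  next
    assume "s (e N) (e N) = 1"
    then have "s (w - c *\<^sub>C e N) (w - c *\<^sub>C e N) = s w w - c * cnj c"
      by (simp add: sesquilinear we ew algebra_simps)
    then show ?thesis by (simp add: cc)
  qed
  moreover have eq: "v - proj (Suc N) v = w - c *\<^sub>C e N" by (simp add: w_def c_def algebra_simps)
  ultimately show ?case unfolding eq using Suc by (simp add: w_def c_def)
qed simp

text \<open>The residual \<open>resid n\<close> is a multiple of \<open>e n\<close>, unless it has length zero.\<close>

lemma proj_d: "Re (s (d n - proj (Suc n) (d n)) (d n - proj (Suc n) (d n))) = 0"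
proof -
  define u where "u = resid n"
  have en: "e n = (if Re (s u u) = 0 then 0 else (1 / sqrt (Re (s u u))) *\<^sub>R u)"
    unfolding u_def by (rule e_eq)
  have eq: "d n - proj (Suc n) (d n) = u - s (d n) (e n) *\<^sub>C e n"
    by (simp add: u_def algebra_simps)
  have sdn: "s (d n) (e n) = s u (e n)" by (simp add: u_def diff_left proj_e)
  show ?thesis
  proof (cases "Re (s u u) = 0")
    case True
    then show ?thesis unfolding eq by (simp add: en)
  next
    case False
    define \<alpha> where "\<alpha> = sqrt (Re (s u u))"
    have \<alpha>: "\<alpha> \<noteq> 0" using False by (simp add: \<alpha>_def)
    have "u = \<alpha> *\<^sub>R e n" using False \<alpha> by (simp add: en \<alpha>_def[symmetric])
    moreover have "e n \<noteq> 0" using False calculation by auto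
    ultimately have "s u (e n) *\<^sub>C e n = u"
      using e_self[of n] by (metis mult.right_neutral scaleR_left scaleR_scaleC)
    then show ?thesis unfolding eq sdn by simp
  qed
qed

text \<open>\<open>v \<mapsto> v - proj N v\<close> does not increase lengths and annihilates \<open>d\<^sub>n\<close> for \<open>N = n + 1\<close>, so
  \<open>v - proj N v\<close> is small when \<open>v\<close> is close to \<open>d\<^sub>n\<close>.\<close>

lemma parseval:
  assumes dense: "\<And>\<epsilon>. 0 < \<epsilon> \<Longrightarrow> \<exists>n. Re (s (v - d n) (v - d n)) < \<epsilon>"
  shows "(\<lambda>n. (cmod (s v (e n)))\<^sup>2) sums Re (s v v)"
proof -
  have le: "(\<Sum>i<N. (cmod (s w (e i)))\<^sup>2) \<le> Re (s w w)" for N w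
    using bessel[of w N] nonneg[of "w - proj N w"] by linarith
  have summ: "summable (\<lambda>n. (cmod (s v (e n)))\<^sup>2)"
    by (rule summableI_nonneg_bounded[OF _ le]) simp
  have "Re (s v v) \<le> (\<Sum>n. (cmod (s v (e n)))\<^sup>2)"
  proof (rule field_le_epsilon)
    fix \<epsilon> :: real assume "0 < \<epsilon>"
    then obtain n where n: "Re (s (v - d n) (v - d n)) < \<epsilon> / 2"
      using dense[of "\<epsilon> / 2"] by auto
    define w where "w = v - d n"
    have "v - proj (Suc n) v = (d n - proj (Suc n) (d n)) + (w - proj (Suc n) w)"
      by (simp only: w_def diff_left scaleC_diff_left sum_subtractf) simp
    then have "Re (s (v - proj (Suc n) v) (v - proj (Suc n) v))
        \<le> 2 * 0 + 2 * Re (s (w - proj (Suc n) w) (w - proj (Suc n) w))"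
      using Re_add_le[of "d n - proj (Suc n) (d n)" "w - proj (Suc n) w"] proj_d by simp
    also have "\<dots> \<le> 2 * Re (s w w)"
      using bessel[of w "Suc n"] sum_nonneg[of "{..<Suc n}" "\<lambda>i. (cmod (s w (e i)))\<^sup>2"] by simp
    finally have "Re (s v v) - (\<Sum>i<Suc n. (cmod (s v (e i)))\<^sup>2) \<le> \<epsilon>"
      using bessel[of v "Suc n"] n by (simp add: w_def)
    moreover have "(\<Sum>i<Suc n. (cmod (s v (e i)))\<^sup>2) \<le> (\<Sum>n. (cmod (s v (e n)))\<^sup>2)"
      by (rule sum_le_suminf[OF summ]) auto
    ultimately show "Re (s v v) \<le> (\<Sum>n. (cmod (s v (e n)))\<^sup>2) + \<epsilon>" by linarith
  qed
  moreover have "(\<Sum>n. (cmod (s v (e n)))\<^sup>2) \<le> Re (s v v)"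
    by (rule suminf_le_const[OF summ le])
  ultimately show ?thesis using summ by (simp add: sums_iff)
qed

end

text \<open>The coefficients with respect to the Gram--Schmidt sequence of a dense sequence. Parseval's
  identity makes this isometric, and polarisation turns lengths into inner products.\<close>

theorem ell2_embedding:
  assumes "countable D" and dense: "\<And>v \<epsilon>. 0 < \<epsilon> \<Longrightarrow> \<exists>d\<in>D. Re (s (v - d) (v - d)) < \<epsilon>"
  obtains E :: "'v \<Rightarrow> ell2" where "clinear E" "\<And>v w. cinner (E v) (E w) = s v w"
proof -
  have "D \<noteq> {}" using dense[of 1] by auto
  define d where "d = from_nat_into D"
  have d: "range d = D" using \<open>D \<noteq> {}\<close> assms(1) by (simp add: d_def)
  have ps: "(\<lambda>n. (cmod (s v (gram_schmidt s d n)))\<^sup>2) sums Re (s v v)" for v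
    by (rule parseval) (use dense d in \<open>metis imageE\<close>)
  define E where "E v = Abs_ell2 (\<lambda>n. s v (gram_schmidt s d n))" for v
  have nth: "ell2_nth (E v) = (\<lambda>n. s v (gram_schmidt s d n))" for v
    using ps[of v] by (simp add: E_def Abs_ell2_inverse sums_iff)
  have E: "clinear E"
    unfolding clinear_def
    by (intro conjI allI ell2_eqI) (simp_all add: nth plus_ell2.rep_eq scaleC_ell2.rep_eq add_left scaleC_left)
  have norm: "Re (cinner (E v) (E v)) = Re (s v v)" for v
    using ps[of v] by (simp add: cinner_self norm_ell2_power2 nth sums_iff)
  have Re: "Re (cinner (E v) (E w)) = Re (s v w)" for v w
  proof -
    have "Re (cinner (E v) (E w)) = Re (cinner (E w) (E v))" by (subst cinner_commute) simp
    then show ?thesis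
      using norm[of "v + w"] norm[of v] norm[of w] Re_commute[of v w]
      by (simp add: clinearD(1)[OF E] cinner_simps sesquilinear)
  qed
  have "cinner (E v) (E w) = s v w" for v w
    using Re[of v w] Re[of v "\<i> *\<^sub>C w"]
    by (simp add: complex_eq_iff clinearD(2)[OF E] cinner_simps sesquilinear)
  then show ?thesis using that E by blast
qed

end

section \<open>Operators on a completion\<close>

lemma closed_csubspace_closure:
  fixes S :: "'h::complex_hilbert_space set"
  assumes "csubspace S"
  shows "closed_csubspace (closure S)"
  unfolding closed_csubspace_def complex_vector.subspace_def
proof (intro conjI ballI allI)
  note S = assms[unfolded complex_vector.subspace_def]
  show "0 \<in> closure S" using S closure_subset by auto
  fix x assume "x \<in> closure S"
  then obtain X where X: "\<And>n. X n \<in> S" "X \<longlonglongrightarrow> x" by (auto simp: closure_sequential)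
  show "c *\<^sub>C x \<in> closure S" for c
  proof (rule limit_in_closure)
    show "c *\<^sub>C X n \<in> S" for n using S X(1) by blast
    show "(\<lambda>n. c *\<^sub>C X n) \<longlonglongrightarrow> c *\<^sub>C x" by (rule tendsto_scaleC_right[OF X(2)])
  qed
  fix y assume "y \<in> closure S"
  then obtain Y where Y: "\<And>n. Y n \<in> S" "Y \<longlonglongrightarrow> y" by (auto simp: closure_sequential)
  show "x + y \<in> closure S"
  proof (rule limit_in_closure)
    show "X n + Y n \<in> S" for n using S X(1) Y(1) by blast
    show "(\<lambda>n. X n + Y n) \<longlonglongrightarrow> x + y" by (intro tendsto_add X Y)
  qed
qed simp

text \<open>Extend by uniform continuity to the closure of \<open>S\<close>, then compose with the orthogonal projection
  onto it, since operators between closed subspaces are represented by their extensions by zero.\<close>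

lemma bounded_clinear_extension:
  fixes f :: "'h::complex_hilbert_space \<Rightarrow> 'k::complex_hilbert_space"
  assumes S: "csubspace S" and K: "0 \<le> K"
    and add: "\<And>x y. x \<in> S \<Longrightarrow> y \<in> S \<Longrightarrow> f (x + y) = f x + f y"
    and scale: "\<And>c x. x \<in> S \<Longrightarrow> f (c *\<^sub>C x) = c *\<^sub>C f x"
    and bound: "\<And>x. x \<in> S \<Longrightarrow> norm (f x) \<le> K * norm x"
  obtains T where "T \<in> operators (closure S) (closure (f ` S))" "\<And>x. x \<in> S \<Longrightarrow> T x = f x"
proof -
  note sub = S[unfolded complex_vector.subspace_def]
  have diff: "f (x - y) = f x - f y" if "x \<in> S" "y \<in> S" for x y
  proof -
    have "x - y \<in> S" using S that by (rule complex_vector.subspace_diff)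
    then show ?thesis using add[of "x - y" y] that by simp
  qed
  have "uniformly_continuous_on S f"
    unfolding uniformly_continuous_on_def
  proof (intro allI impI)
    fix \<epsilon> :: real assume \<epsilon>: "0 < \<epsilon>"
    have "dist (f y) (f x) < \<epsilon>" if "x \<in> S" "y \<in> S" "dist y x < \<epsilon> / (K + 1)" for x y
    proof -
      have "dist (f y) (f x) \<le> K * norm (y - x)"
        using bound[of "y - x"] diff[of y x] that S complex_vector.subspace_diff[of S y x]
        by (simp add: dist_norm)
      also have "\<dots> \<le> (K + 1) * norm (y - x)" by (intro mult_right_mono) auto
      also have "\<dots> < \<epsilon>" using that(3) K by (simp add: dist_norm field_simps)
      finally show ?thesis .
    qed
    then show "\<exists>\<delta>>0. \<forall>x\<in>S. \<forall>x'\<in>S. dist x' x < \<delta> \<longrightarrow> dist (f x') (f x) < \<epsilon>"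
      using \<epsilon> K by (intro exI[of _ "\<epsilon> / (K + 1)"]) auto
  qed
  then obtain g where g: "uniformly_continuous_on (closure S) g" "\<And>x. x \<in> S \<Longrightarrow> f x = g x"
    by (rule uniformly_continuous_on_extension_on_closure) (rule that)
  have lim: "(\<lambda>n. f (X n)) \<longlonglongrightarrow> g x" if "\<And>n. X n \<in> S" "X \<longlonglongrightarrow> x" for X x
  proof -
    have "(\<lambda>n. g (X n)) \<longlonglongrightarrow> g x"
    proof (rule continuous_on_tendsto_compose[OF uniformly_continuous_imp_continuous[OF g(1)] that(2)])
      show "x \<in> closure S" by (rule limit_in_closure[OF that])
      show "\<forall>\<^sub>F n in sequentially. X n \<in> closure S"
        using that(1) closure_subset by (auto intro!: always_eventually)
    qed
    then show ?thesis using g(2) that(1) by simp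
  qed
  define H where "H = closure S"
  have H: "closed_csubspace H" unfolding H_def by (rule closed_csubspace_closure[OF S])
  have seq: "\<exists>X. (\<forall>n. X n \<in> S) \<and> X \<longlonglongrightarrow> x" if "x \<in> H" for x
    using that by (auto simp: H_def closure_sequential)
  have gadd: "g (x + y) = g x + g y" if xy: "x \<in> H" "y \<in> H" for x y
  proof -
    obtain X Y where X: "\<And>n. X n \<in> S" "X \<longlonglongrightarrow> x" and Y: "\<And>n. Y n \<in> S" "Y \<longlonglongrightarrow> y"
      using seq xy by metis
    have "(\<lambda>n. f (X n + Y n)) \<longlonglongrightarrow> g (x + y)"
      using sub X Y by (intro lim tendsto_add) auto
    moreover have "(\<lambda>n. f (X n) + f (Y n)) \<longlonglongrightarrow> g x + g y"
      by (intro tendsto_add lim X Y)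
    ultimately show ?thesis using add[OF X(1) Y(1)] LIMSEQ_unique by simp
  qed
  have gscale: "g (c *\<^sub>C x) = c *\<^sub>C g x" if x: "x \<in> H" for c x
  proof -
    obtain X where X: "\<And>n. X n \<in> S" "X \<longlonglongrightarrow> x" using seq x by metis
    have "(\<lambda>n. f (c *\<^sub>C X n)) \<longlonglongrightarrow> g (c *\<^sub>C x)"
      using sub X by (intro lim tendsto_scaleC_right) auto
    moreover have "(\<lambda>n. c *\<^sub>C f (X n)) \<longlonglongrightarrow> c *\<^sub>C g x"
      by (intro tendsto_scaleC_right lim X)
    ultimately show ?thesis using scale[OF X(1)] LIMSEQ_unique by simp
  qed
  have gbound: "norm (g x) \<le> K * norm x" if x: "x \<in> H" for x
  proof -
    obtain X where X: "\<And>n. X n \<in> S" "X \<longlonglongrightarrow> x" using seq x by metis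
    show ?thesis
    proof (rule LIMSEQ_le)
      show "(\<lambda>n. norm (f (X n))) \<longlonglongrightarrow> norm (g x)" by (intro tendsto_norm lim X)
      show "(\<lambda>n. K * norm (X n)) \<longlonglongrightarrow> K * norm x" by (intro tendsto_intros X)
    qed (use bound[OF X(1)] in auto)
  qed
  define T where "T x = g (identity_on H x)" for x
  note P = bounded_clinear_identity_on[OF H] and Pm = identity_on_mem(1)[OF H]
  obtain K' where K': "\<And>x. norm (identity_on H x) \<le> norm x * K'"
    using bounded_linear.bounded[OF bounded_clinearD(1)[OF P]] by blast
  have "bounded_clinear T"
  proof (rule bounded_clinearI)
    show "norm (T x) \<le> norm x * (K * K')" for x
      using gbound[OF Pm, of x] mult_left_mono[OF K'[of x] K] by (simp add: T_def mult_ac)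
  qed (simp_all add: T_def bounded_clinearD[OF P] gadd gscale Pm)
  moreover have "T x \<in> closure (f ` S)" for x
  proof -
    obtain X where X: "\<And>n. X n \<in> S" "X \<longlonglongrightarrow> identity_on H x" using seq Pm by metis
    show ?thesis unfolding T_def by (rule limit_in_closure[OF _ lim[OF X]]) (use X in auto)
  qed
  moreover have "T x = 0" if "x \<in> orth_compl H" for x
  proof -
    have "g 0 = 0" using gadd[of 0 0] closed_csubspaceD(1)[OF H] by simp
    then show ?thesis using identity_on_of_orth[OF H that] by (simp add: T_def)
  qed
  ultimately have "T \<in> operators (closure S) (closure (f ` S))"
    by (auto simp: operators_def H_def)
  moreover have "T x = f x" if "x \<in> S" for x
  proof -
    have "identity_on H x = x"
      using that closure_subset by (intro identity_on_of_mem H) (auto simp: H_def)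
    then show ?thesis using g(2)[OF that] by (simp add: T_def)
  qed
  ultimately show ?thesis using that by blast
qed

lemma csubspace_range:
  assumes "clinear E"
  shows "csubspace (range E)"
  unfolding complex_vector.subspace_def
  by (auto simp flip: clinearD(1,2)[OF assms]) (metis clinearD(3)[OF assms] rangeI)

text \<open>An operator on the semi-inner product space that is bounded for its seminorm induces an operator
  on the completion, realised as the closure of the range of \<open>E\<close>.\<close>

lemma operator_lift:
  fixes E :: "'v::complex_vector \<Rightarrow> 'h::complex_hilbert_space"
  assumes E: "clinear E" and T: "clinear T" and "0 \<le> K"
    and bound: "\<And>v. norm (E (T v)) \<le> K * norm (E v)"
  obtains X where "X \<in> operators (closure (range E)) (closure (range E))" "\<And>v. X (E v) = E (T v)"
proof -
  \<comment> \<open>any choice of preimages will do: by boundedness, \<open>T\<close> preserves the kernel of \<open>E\<close>\<close>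
  define f where "f y = E (T (SOME v. E v = y))" for y
  have f: "f (E v) = E (T v)" for v
  proof -
    have some: "E (SOME w. E w = E v) = E v" by (rule someI) (rule refl)
    have "norm (E (T ((SOME w. E w = E v) - v))) \<le> K * norm (E ((SOME w. E w = E v) - v))"
      by (rule bound)
    then show ?thesis by (simp add: f_def clinearD(4)[OF E] clinearD(4)[OF T] some)
  qed
  have fadd: "f (x + y) = f x + f y" if "x \<in> range E" "y \<in> range E" for x y
  proof -
    obtain v w where "x = E v" "y = E w" using \<open>x \<in> range E\<close> \<open>y \<in> range E\<close> by blast
    then show ?thesis
      using f[of "v + w"] by (simp add: clinearD[OF E] clinearD[OF T] f)
  qed
  have fscale: "f (c *\<^sub>C x) = c *\<^sub>C f x" if "x \<in> range E" for c x
  proof -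
    obtain v where "x = E v" using \<open>x \<in> range E\<close> by blast
    then show ?thesis
      using f[of "c *\<^sub>C v"] by (simp add: clinearD[OF E] clinearD[OF T] f)
  qed
  have fbound: "norm (f x) \<le> K * norm x" if "x \<in> range E" for x
    using that bound by (auto simp: f)
  obtain X where X: "X \<in> operators (closure (range E)) (closure (f ` range E))"
    "\<And>x. x \<in> range E \<Longrightarrow> X x = f x"
    using bounded_clinear_extension[where f = f, OF csubspace_range[OF E] \<open>0 \<le> K\<close> fadd fscale fbound]
    by metis
  have "closure (f ` range E) \<subseteq> closure (range E)"
    by (intro closure_mono) (auto simp: f)
  then have "X \<in> operators (closure (range E)) (closure (range E))"
    using X(1) by (auto simp: operators_def)
  moreover have "X (E v) = E (T v)" for v using X(2)[of "E v"] by (simp add: f)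
  ultimately show ?thesis using that by blast
qed

lemma operators_eqI:
  assumes S: "csubspace S" and X: "X \<in> operators (closure S) K" "Y \<in> operators (closure S) K'"
    and eq: "\<And>x. x \<in> S \<Longrightarrow> X x = Y x"
  shows "X = Y"
proof
  fix x
  define H where "H = closure S"
  have H: "closed_csubspace H" unfolding H_def by (rule closed_csubspace_closure[OF S])
  have bl: "bounded_clinear X" "bounded_clinear Y" using X by (auto simp: operators_def)
  have "H \<subseteq> {x. X x = Y x}"
    unfolding H_def
    using eq bl by (intro closure_minimal closed_Collect_eq linear_continuous_on) (auto simp: bounded_clinear_def)
  moreover have "X (x - identity_on H x) = 0" "Y (x - identity_on H x) = 0"
    using identity_on_mem(2)[OF H, of x] X by (auto simp: operators_def H_def)
  ultimately show "X x = Y x"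
    using identity_on_mem(1)[OF H, of x]
    by (simp add: bounded_clinearD[OF bl(1)] bounded_clinearD[OF bl(2)]) blast
qed

lemma operators_project:
  assumes H: "closed_csubspace H" and X: "X \<in> operators H K"
  shows "X (identity_on H x) = X x"
proof -
  have "X (x - identity_on H x) = 0"
    using identity_on_mem(2)[OF H, of x] X by (auto simp: operators_def)
  then show ?thesis using X by (auto simp: operators_def bounded_clinearD)
qed

lemma cadjoint_operators_eqI:
  fixes X Y :: "'h::complex_hilbert_space \<Rightarrow> 'h"
  assumes S: "csubspace S" and X: "X \<in> operators (closure S) (closure S)"
    and Y: "Y \<in> operators (closure S) (closure S)"
    and adj: "\<And>x y. x \<in> S \<Longrightarrow> y \<in> S \<Longrightarrow> cinner (X x) y = cinner x (Y y)"
  shows "cadjoint X = Y"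
proof (rule cadjoint_eqI)
  fix x y
  define H where "H = closure S"
  have H: "closed_csubspace H" unfolding H_def by (rule closed_csubspace_closure[OF S])
  have bl: "bounded_linear X" "bounded_linear Y" using X Y by (auto simp: operators_def bounded_clinear_def)
  have on_H: "cinner (X x) y = cinner x (Y y)" if xy: "x \<in> H" "y \<in> H" for x y
  proof -
    obtain U V where U: "\<And>n. U n \<in> S" "U \<longlonglongrightarrow> x" and V: "\<And>n. V n \<in> S" "V \<longlonglongrightarrow> y"
      using xy by (auto simp: H_def closure_sequential)
    have "(\<lambda>n. cinner (X (U n)) (V n)) \<longlonglongrightarrow> cinner (X x) y"
      by (intro tendsto_cinner bounded_linear.tendsto[OF bl(1)] U V)
    moreover have "(\<lambda>n. cinner (U n) (Y (V n))) \<longlonglongrightarrow> cinner x (Y y)"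
      by (intro tendsto_cinner bounded_linear.tendsto[OF bl(2)] U V)
    ultimately show ?thesis using adj[OF U(1) V(1)] LIMSEQ_unique by simp
  qed
  have XH: "X x \<in> H" and YH: "Y y \<in> H" using X Y by (auto simp: operators_def H_def)
  define x' where "x' = identity_on H x"
  define y' where "y' = identity_on H y"
  note x' = identity_on_mem[OF H, of x, folded x'_def] and y' = identity_on_mem[OF H, of y, folded y'_def]
  have "cinner (X x) y = cinner (X x) y'"
    using orth_complD(2)[OF y'(2) XH] by (simp add: cinner_diff_right)
  also have "\<dots> = cinner (X x') y'"
    using operators_project[OF H X[folded H_def], of x] by (simp add: x'_def)
  also have "\<dots> = cinner x' (Y y')" by (rule on_H[OF x'(1) y'(1)])
  also have "\<dots> = cinner x' (Y y)"
    using operators_project[OF H Y[folded H_def], of y] by (simp add: y'_def)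
  also have "\<dots> = cinner x (Y y)"
    using orth_complD(1)[OF x'(2) YH] by (simp add: cinner_diff_left)
  finally show "cinner (X x) y = cinner x (Y y)" .
qed

section \<open>Compressions of representations under hyperrigidity\<close>

lemma operators_comp:
  assumes "X \<in> operators H H" "Y \<in> operators H H"
  shows "(\<lambda>x. X (Y x)) \<in> operators H H"
proof -
  have bl: "bounded_clinear X" "bounded_clinear Y" using assms by (auto simp: operators_def)
  show ?thesis
    using assms bounded_clinear_compose[OF bl] bounded_clinearD(4)[OF bl(1)]
    by (auto simp: operators_def)
qed

lemma operators_add:
  assumes "closed_csubspace H" "X \<in> operators H H" "Y \<in> operators H H"
  shows "(\<lambda>x. X x + Y x) \<in> operators H H"
  using assms closed_csubspaceD(2)[OF assms(1)]
  by (auto simp: operators_def image_subset_iff intro!: bounded_clinear_add)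

lemma bounded_clinear_scaleC:
  assumes "bounded_clinear X"
  shows "bounded_clinear (\<lambda>x. c *\<^sub>C X x)"
proof -
  obtain K where "\<And>x. norm (X x) \<le> norm x * K"
    using bounded_linear.bounded[OF bounded_clinearD(1)[OF assms]] by blast
  then have bound: "cmod c * norm (X x) \<le> cmod c * (norm x * K)" for x
    by (rule mult_left_mono) simp
  show ?thesis
  proof (rule bounded_clinearI)
    show "norm (c *\<^sub>C X x) \<le> norm x * (cmod c * K)" for x
      using bound[of x] by (simp add: norm_scaleC_hilbert mult_ac)
  qed (simp_all add: bounded_clinearD[OF assms] scaleC_add_right mult.commute)
qed

lemma operators_scaleC:
  assumes "closed_csubspace H" "X \<in> operators H H"
  shows "(\<lambda>x. c *\<^sub>C X x) \<in> operators H H"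
  using assms closed_csubspaceD(3)[OF assms(1)]
  by (auto simp: operators_def image_subset_iff intro!: bounded_clinear_scaleC)

lemma operators_identity_on:
  "closed_csubspace H \<Longrightarrow> identity_on H \<in> operators H H"
  by (auto simp: operators_def bounded_clinear_identity_on identity_on_mem identity_on_of_orth)

text \<open>Here \<open>K'\<close> and \<open>L'\<close> stand for the adjoints of \<open>K\<close> and \<open>L\<close>. The quadratic form of the image of an
  operator matrix at \<open>(x\<^sub>i)\<close> is the sum of those of the matrix itself at \<open>(Kx\<^sub>i)\<close> and \<open>(Lx\<^sub>i)\<close>.\<close>

lemma ucp_map_kraus:
  fixes H :: "'h::complex_hilbert_space set"
  assumes H: "closed_csubspace H"
    and K: "K \<in> operators H H" "K' \<in> operators H H" "\<And>x y. cinner (K' x) y = cinner x (K y)"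
    and L: "L \<in> operators H H" "L' \<in> operators H H" "\<And>x y. cinner (L' x) y = cinner x (L y)"
    and unital: "\<And>x. x \<in> H \<Longrightarrow> K' (K x) + L' (L x) = x"
  shows "ucp_map H (\<lambda>X x. K' (X (K x)) + L' (X (L x)))"
  unfolding ucp_map_def
proof (intro conjI ballI allI impI)
  have K'lin: "K' (x + y) = K' x + K' y" "K' (c *\<^sub>C x) = c *\<^sub>C K' x"
    and L'lin: "L' (x + y) = L' x + L' y" "L' (c *\<^sub>C x) = c *\<^sub>C L' x" for x y c
    using K(2) L(2) by (auto simp: operators_def bounded_clinearD)
  show "(\<lambda>x. K' (T (K x)) + L' (T (L x))) \<in> operators H H" if "T \<in> operators H H" for T
    by (intro operators_add H operators_comp[OF K(2) operators_comp[OF that K(1)]]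
        operators_comp[OF L(2) operators_comp[OF that L(1)]])
  show "(\<lambda>x. K' (S (K x) + T (K x)) + L' (S (L x) + T (L x)))
      = (\<lambda>x. (K' (S (K x)) + L' (S (L x))) + (K' (T (K x)) + L' (T (L x))))" for S T
    by (simp add: K'lin L'lin algebra_simps)
  show "(\<lambda>x. K' (c *\<^sub>C T (K x)) + L' (c *\<^sub>C T (L x)))
      = (\<lambda>x. c *\<^sub>C (K' (T (K x)) + L' (T (L x))))" for c T
    by (simp add: K'lin L'lin scaleC_add_right)
  show "(\<lambda>x. K' (identity_on H (K x)) + L' (identity_on H (L x))) = identity_on H"
  proof
    fix x
    have KL: "K x \<in> H" "L x \<in> H" using K(1) L(1) by (auto simp: operators_def)
    then have "K' (identity_on H (K x)) + L' (identity_on H (L x)) = K' (K x) + L' (L x)"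
      by (simp add: identity_on_of_mem[OF H])
    also have "\<dots> = K' (K (identity_on H x)) + L' (L (identity_on H x))"
      by (simp add: operators_project[OF H K(1)] operators_project[OF H L(1)])
    also have "\<dots> = identity_on H x" by (rule unital[OF identity_on_mem(1)[OF H]])
    finally show "K' (identity_on H (K x)) + L' (identity_on H (L x)) = identity_on H x" .
  qed
  fix n T
  assume "positive_op_matrix H n T"
  then have pos: "(\<Sum>i<n. \<Sum>j<n. cinner (T i j (x j)) (x i)) \<in> \<real>\<^sub>\<ge>\<^sub>0" if "\<And>i. x i \<in> H" for x
    using that by (auto simp: positive_op_matrix_def)
  show "positive_op_matrix H n (\<lambda>i j x. K' (T i j (K x)) + L' (T i j (L x)))"
    unfolding positive_op_matrix_def
  proof (intro allI impI)
    fix x :: "nat \<Rightarrow> 'h"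
    have "(\<Sum>i<n. \<Sum>j<n. cinner (T i j (K (x j))) (K (x i))) \<in> \<real>\<^sub>\<ge>\<^sub>0"
      "(\<Sum>i<n. \<Sum>j<n. cinner (T i j (L (x j))) (L (x i))) \<in> \<real>\<^sub>\<ge>\<^sub>0"
      using K(1) L(1) by (auto simp: operators_def intro!: pos)
    then have "(\<Sum>i<n. \<Sum>j<n. cinner (T i j (K (x j))) (K (x i)))
        + (\<Sum>i<n. \<Sum>j<n. cinner (T i j (L (x j))) (L (x i))) \<in> \<real>\<^sub>\<ge>\<^sub>0"
      by (rule nonneg_Reals_add_I)
    then show "(\<Sum>i<n. \<Sum>j<n. cinner (K' (T i j (K (x j))) + L' (T i j (L (x j)))) (x i)) \<in> \<real>\<^sub>\<ge>\<^sub>0"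
      by (simp add: cinner_add_left K(3) L(3) sum.distrib)
  qed
qed

text \<open>A representation of the algebra before completion: it acts on a semi-inner product space by
  linear maps that have formal adjoints. Such an action is automatically bounded (\<open>action_bounded\<close>).\<close>

locale star_action = semi_inner_product s
  for s :: "'v::complex_vector \<Rightarrow> 'v \<Rightarrow> complex" +
  fixes \<sigma> :: "'a::unital_cstar_algebra \<Rightarrow> 'v \<Rightarrow> 'v"
  assumes action_clinear: "clinear (\<sigma> b)"
    and action_add: "\<sigma> (a + b) v = \<sigma> a v + \<sigma> b v"
    and action_scaleC: "\<sigma> (c *\<^sub>C a) v = c *\<^sub>C \<sigma> a v"
    and action_mult: "\<sigma> (a * b) v = \<sigma> a (\<sigma> b v)"
    and action_one: "\<sigma> 1 v = v"
    and action_star: "s (\<sigma> b v) w = s v (\<sigma> (star b) w)"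
begin

lemma action_diff: "\<sigma> (a - b) v = \<sigma> a v - \<sigma> b v"
  using action_add[of "a - b" b v] by simp

lemma action_bounded: "Re (s (\<sigma> b v) (\<sigma> b v)) \<le> (norm b)\<^sup>2 * Re (s v v)"
proof -
  obtain c where c: "star c * c = (norm b)\<^sup>2 *\<^sub>R 1 - star b * b"
    using norm_square_minus_star_mult .
  have self: "s (\<sigma> a v) (\<sigma> a v) = s v (\<sigma> (star a * a) v)" for a
    by (simp add: action_star action_mult)
  have "0 \<le> Re (s v (\<sigma> (star c * c) v))" using nonneg[of "\<sigma> c v"] by (simp add: self)
  also have "\<sigma> (star c * c) v = (norm b)\<^sup>2 *\<^sub>R v - \<sigma> (star b * b) v"
    by (simp add: c action_diff scaleR_scaleC action_scaleC action_one)
  also have "Re (s v \<dots>) = (norm b)\<^sup>2 * Re (s v v) - Re (s (\<sigma> b v) (\<sigma> b v))"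
    by (simp add: diff_right scaleR_right self)
  finally show ?thesis by simp
qed

text \<open>The form in which hyperrigidity is applied. After completion inside the sequence space, the
  action becomes a faithful representation \<open>\<tau>\<close>, and the UCP map \<open>\<Phi>(X) = K\<^sup>*XK + L\<^sup>*XL\<close> fixes \<open>\<tau>(g)\<close> for \<open>g \<in> G\<close>.
  Applied to the constant sequence \<open>\<Phi>\<close>, hyperrigidity shows that \<open>\<Phi>\<close> fixes every \<open>\<tau>(a)\<close>.\<close>

theorem hyperrigid_kraus:
  fixes G :: "'a set"
  assumes G: "hyperrigid G"
    and D: "countable D" "\<And>v \<epsilon>. 0 < \<epsilon> \<Longrightarrow> \<exists>d\<in>D. Re (s (v - d) (v - d)) < \<epsilon>"
    and faithful: "\<And>b. (\<And>v. s (\<sigma> b v) (\<sigma> b v) = 0) \<Longrightarrow> b = 0"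
    and K: "clinear K" "clinear K'" "\<And>v w. s (K v) w = s v (K' w)"
    and L: "clinear L" "clinear L'" "\<And>v w. s (L v) w = s v (L' w)"
    and unital: "\<And>v. K' (K v) + L' (L v) = v"
    and fixG: "\<And>g v. g \<in> G \<Longrightarrow> K' (\<sigma> g (K v)) + L' (\<sigma> g (L v)) = \<sigma> g v"
  defines "err a v \<equiv> K' (\<sigma> a (K v)) + L' (\<sigma> a (L v)) - \<sigma> a v"
  shows "s (err a v) (err a v) = 0"
proof -
  obtain E :: "'v \<Rightarrow> ell2" where E: "clinear E" "\<And>v w. cinner (E v) (E w) = s v w"
    using ell2_embedding[OF D] by blast
  define S where "S = range E"
  define H where "H = closure S"
  have S: "csubspace S" unfolding S_def by (rule csubspace_range[OF E(1)])
  have H: "closed_csubspace H" unfolding H_def by (rule closed_csubspace_closure[OF S])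
  have EH: "E v \<in> H" for v
    using closure_subset[of "range E"] by (auto simp: H_def S_def)
  have normE: "(norm (E v))\<^sup>2 = Re (s v v)" for v
    using E(2)[of v v] by (simp add: cinner_self complex_eq_iff)
  note Elin = clinearD[OF E(1)]
  have lift: "\<exists>X. X \<in> operators H H \<and> (\<forall>v. X (E v) = E (T v))"
    if T: "clinear T" and C: "0 \<le> C" "\<And>v. norm (E (T v)) \<le> C * norm (E v)" for T C
    using operator_lift[OF E(1) T C] unfolding H_def S_def by metis
  have eqI: "X = Y" if "X \<in> operators H H" "Y \<in> operators H H" "\<And>v. X (E v) = E (T v)"
    "\<And>v. Y (E v) = E (T v)" for X Y T
    using that(3,4) by (intro operators_eqI[OF S that(1,2)[unfolded H_def]]) (auto simp: S_def)
  have adjI: "cadjoint X = Y" if "X \<in> operators H H" "Y \<in> operators H H" "\<And>v. X (E v) = E (T v)"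
    "\<And>v. Y (E v) = E (T' v)" "\<And>v w. s (T v) w = s v (T' w)" for X Y T T'
    using that(3-5) by (intro cadjoint_operators_eqI[OF S that(1,2)[unfolded H_def]])
      (auto simp: S_def E(2))
  \<comment> \<open>the induced representation on \<open>H\<close>\<close>
  have "norm (E (\<sigma> b v)) \<le> norm b * norm (E v)" for b v
  proof (rule power2_le_imp_le)
    show "(norm (E (\<sigma> b v)))\<^sup>2 \<le> (norm b * norm (E v))\<^sup>2"
      using action_bounded[of b v] by (simp add: power_mult_distrib normE)
  qed simp
  then have "\<forall>b. \<exists>X. X \<in> operators H H \<and> (\<forall>v. X (E v) = E (\<sigma> b v))"
    by (intro allI lift[OF action_clinear norm_ge_zero])
  then obtain \<tau> where \<tau>: "\<And>b. \<tau> b \<in> operators H H" "\<And>b v. \<tau> b (E v) = E (\<sigma> b v)" by metis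
  have rep: "cstar_representation H \<tau>"
    unfolding cstar_representation_def
  proof (intro conjI allI)
    show "\<tau> (a + b) = (\<lambda>x. \<tau> a x + \<tau> b x)" for a b
      by (rule eqI[OF \<tau>(1) operators_add[OF H \<tau>(1) \<tau>(1)] \<tau>(2)]) (simp add: \<tau>(2) action_add Elin)
    show "\<tau> (c *\<^sub>C a) = (\<lambda>x. c *\<^sub>C \<tau> a x)" for c a
      by (rule eqI[OF \<tau>(1) operators_scaleC[OF H \<tau>(1)] \<tau>(2)]) (simp add: \<tau>(2) action_scaleC Elin)
    show "\<tau> (a * b) = \<tau> a \<circ> \<tau> b" for a b
      unfolding comp_def
      by (rule eqI[OF \<tau>(1) operators_comp[OF \<tau>(1) \<tau>(1)] \<tau>(2)]) (simp add: \<tau>(2) action_mult)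
    show "\<tau> (star a) = cadjoint (\<tau> a)" for a
      by (rule adjI[OF \<tau>(1) \<tau>(1) \<tau>(2) \<tau>(2) action_star, symmetric])
    show "\<tau> 1 = identity_on H"
    proof (rule eqI[OF \<tau>(1) operators_identity_on[OF H] \<tau>(2)])
      show "identity_on H (E v) = E (\<sigma> 1 v)" for v
        by (simp add: action_one identity_on_of_mem[OF H EH])
    qed
  qed (rule \<tau>(1))
  have "inj \<tau>"
  proof (rule injI)
    fix a b assume "\<tau> a = \<tau> b"
    then have "E (\<sigma> a v) = E (\<sigma> b v)" for v using \<tau>(2) by metis
    then have "E (\<sigma> (a - b) v) = 0" for v by (simp add: action_diff Elin)
    then have "s (\<sigma> (a - b) v) (\<sigma> (a - b) v) = 0" for v by (simp flip: E(2))
    then show "a = b" using faithful[of "a - b"] by simp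
  qed
  \<comment> \<open>the Kraus operators on \<open>H\<close>; they are contractions because they come from the isometry \<open>(K, L)\<close>\<close>
  have "s v v = s (K v) (K v) + s (L v) (L v)" for v
    using arg_cong[OF unital[of v], of "s v"] by (simp add: K(3) L(3) add_right)
  then have sum: "Re (s v v) = Re (s (K v) (K v)) + Re (s (L v) (L v))" for v
    unfolding plus_complex.sel(1)[symmetric] by (rule arg_cong)
  have "(norm (E (K v)))\<^sup>2 \<le> (norm (E v))\<^sup>2" "(norm (E (L v)))\<^sup>2 \<le> (norm (E v))\<^sup>2" for v
    unfolding normE using sum[of v] nonneg[of "K v"] nonneg[of "L v"] by linarith+
  then have KL: "norm (E (K v)) \<le> norm (E v)" "norm (E (L v)) \<le> norm (E v)" for v
    using power2_le_imp_le norm_ge_zero by blast+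
  \<comment> \<open>the adjoint of a contraction is a contraction, by the Cauchy--Schwarz inequality\<close>
  have adj_bound: "norm (E (T' v)) \<le> norm (E v)"
    if T: "\<And>v. norm (E (T v)) \<le> norm (E v)" "\<And>v w. s (T v) w = s v (T' w)" for T T' v
  proof (cases "E (T' v) = 0")
    case False
    have "(norm (E (T' v)))\<^sup>2 = cmod (cinner (E (T (T' v))) (E v))"
      using arg_cong[OF cinner_self[of "E (T' v)"], of cmod] by (simp add: E(2) T(2) norm_power)
    also have "\<dots> \<le> norm (E (T (T' v))) * norm (E v)" by (rule cmod_cinner_le)
    also have "\<dots> \<le> norm (E (T' v)) * norm (E v)" by (intro mult_right_mono T(1)) simp
    finally show ?thesis using False by (simp add: power2_eq_square)
  qed simp
  have lift1: "\<exists>X. X \<in> operators H H \<and> (\<forall>v. X (E v) = E (T v))"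
    if "clinear T" "\<And>v. norm (E (T v)) \<le> norm (E v)" for T
    using lift[of T 1] that by simp
  obtain k where k: "k \<in> operators H H" "\<And>v. k (E v) = E (K v)"
    using lift1[OF K(1) KL(1)] by blast
  obtain k' where k': "k' \<in> operators H H" "\<And>v. k' (E v) = E (K' v)"
    using lift1[OF K(2) adj_bound[OF KL(1) K(3)]] by blast
  obtain l where l: "l \<in> operators H H" "\<And>v. l (E v) = E (L v)"
    using lift1[OF L(1) KL(2)] by blast
  obtain l' where l': "l' \<in> operators H H" "\<And>v. l' (E v) = E (L' v)"
    using lift1[OF L(2) adj_bound[OF KL(2) L(3)]] by blast
  have adj: "cinner (k' x) y = cinner x (k y)" "cinner (l' x) y = cinner x (l y)" for x y
    using cinner_cadjoint_right[of k x y] cinner_cadjoint_right[of l x y] k l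
      adjI[OF k(1) k'(1) k(2) k'(2) K(3)] adjI[OF l(1) l'(1) l(2) l'(2) L(3)]
    by (simp_all add: operators_def)
  define \<Phi> where "\<Phi> X x = k' (X (k x)) + l' (X (l x))" for X x
  have \<Phi>op: "\<Phi> X \<in> operators H H" if "X \<in> operators H H" for X
    unfolding \<Phi>_def
    by (intro operators_add H operators_comp[OF k'(1) operators_comp[OF that k(1)]]
        operators_comp[OF l'(1) operators_comp[OF that l(1)]])
  have "(\<lambda>x. k' (k x) + l' (l x)) = identity_on H"
  proof (rule eqI[where T = "\<lambda>v. v", OF _ operators_identity_on[OF H]])
    show "(\<lambda>x. k' (k x) + l' (l x)) \<in> operators H H"
      by (intro operators_add H operators_comp[OF k'(1) k(1)] operators_comp[OF l'(1) l(1)])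
    show "k' (k (E v)) + l' (l (E v)) = E v" for v
      by (simp add: k k' l l' unital flip: Elin(1))
    show "identity_on H (E v) = E v" for v by (rule identity_on_of_mem[OF H EH])
  qed
  then have "k' (k x) + l' (l x) = x" if "x \<in> H" for x
    using identity_on_of_mem[OF H that] by metis
  then have ucp: "ucp_map H \<Phi>"
    unfolding \<Phi>_def
    by (intro ucp_map_kraus[OF H k(1) k'(1) adj(1) l(1) l'(1) adj(2)])
  have \<Phi>E: "\<Phi> (\<tau> a) (E v) = E (K' (\<sigma> a (K v)) + L' (\<sigma> a (L v)))" for a v
    by (simp add: \<Phi>_def k k' l l' \<tau> Elin)
  have fix_g: "\<Phi> (\<tau> g) = \<tau> g" if "g \<in> G" for g
    by (rule eqI[OF \<Phi>op[OF \<tau>(1)] \<tau>(1) _ \<tau>(2)]) (simp add: \<Phi>E fixG[OF that])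
  have "\<forall>g\<in>G. (\<lambda>_::nat. onorm (\<lambda>x. \<Phi> (\<tau> g) x - \<tau> g x)) \<longlonglongrightarrow> 0"
    using fix_g by (simp add: onorm_zero)
  then have "(\<lambda>_::nat. onorm (\<lambda>x. \<Phi> (\<tau> a) x - \<tau> a x)) \<longlonglongrightarrow> 0"
  proof -
    have "\<forall>(H :: ell2 set) \<pi> \<Phi>. closed_csubspace H \<longrightarrow> cstar_representation H \<pi> \<longrightarrow> inj \<pi> \<longrightarrow>
        (\<forall>k::nat. ucp_map H (\<Phi> k)) \<longrightarrow>
        (\<forall>g\<in>G. (\<lambda>k. onorm (\<lambda>x. \<Phi> k (\<pi> g) x - \<pi> g x)) \<longlonglongrightarrow> 0) \<longrightarrow>
        (\<forall>a. (\<lambda>k. onorm (\<lambda>x. \<Phi> k (\<pi> a) x - \<pi> a x)) \<longlonglongrightarrow> 0)"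
      using G by (simp add: hyperrigid_def)
    from this[rule_format, of H \<tau> "\<lambda>_. \<Phi>" a] show ?thesis
      using H rep \<open>inj \<tau>\<close> ucp \<open>\<forall>g\<in>G. _ g\<close> by blast
  qed
  then have "onorm (\<lambda>x. \<Phi> (\<tau> a) x - \<tau> a x) = 0"
    using LIMSEQ_const_iff by blast
  moreover have "bounded_linear (\<lambda>x. \<Phi> (\<tau> a) x - \<tau> a x)"
    using \<Phi>op[OF \<tau>(1)] \<tau>(1) by (intro bounded_linear_sub) (auto simp: operators_def bounded_clinear_def)
  ultimately have "\<Phi> (\<tau> a) (E v) - \<tau> a (E v) = 0" by (simp add: onorm_eq_0)
  then have "E (err a v) = 0" by (simp add: \<Phi>E \<tau> err_def Elin)
  then show ?thesis by (simp flip: E(2))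
qed

end

instantiation prod :: (complex_vector, complex_vector) complex_vector
begin

definition scaleC_prod :: "complex \<Rightarrow> 'a \<times> 'b \<Rightarrow> 'a \<times> 'b" where
  "scaleC_prod c v = (c *\<^sub>C fst v, c *\<^sub>C snd v)"

instance
  by standard (simp_all add: scaleC_prod_def scaleC_add_right scaleC_add_left scaleR_prod_def scaleR_scaleC prod_eq_iff)

end

lemma scaleC_Pair [simp]: "c *\<^sub>C (a, b) = (c *\<^sub>C a, c *\<^sub>C b)"
  by (simp add: scaleC_prod_def)

lemma separable_space_dense:
  assumes "separable_space (euclidean :: 'x::topological_space topology)"
  obtains D :: "'x::topological_space set" where "countable D" "closure D = UNIV"
  using assms by (auto simp: separable_space_def)

lemma dense_approx:
  fixes x :: "'x::metric_space"
  assumes "closure D = UNIV" "0 < \<delta>"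
  shows "\<exists>d\<in>D. dist d x < \<delta>"
  using assms closure_approachable[of x D] by auto

lemma contraction_norm_le:
  assumes "contraction R"
  shows "norm (R x) \<le> norm x"
proof -
  have "norm (R x) \<le> onorm R * norm x"
    using assms by (intro onorm) (simp add: contraction_def bounded_clinearD)
  also have "\<dots> \<le> 1 * norm x"
    using assms by (intro mult_right_mono) (auto simp: contraction_def)
  finally show ?thesis by simp
qed

lemma bounded_clinear_defect: "bounded_clinear R \<Longrightarrow> bounded_clinear (defect R)"
  unfolding defect_def
  by (intro bounded_clinear_diff bounded_clinear_ident
      bounded_clinear_compose[of "cadjoint R" R] bounded_clinear_cadjoint)

lemma cinner_defect:
  assumes "bounded_clinear R"
  shows "cinner (defect R x) y = cinner x y - cinner (R x) (R y)"
    "cinner x (defect R y) = cinner x y - cinner (R x) (R y)"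
  by (simp_all add: defect_def cinner_simps cinner_cadjoint[OF assms] cinner_cadjoint_right[OF assms, symmetric])

text \<open>The space is \<open>A \<times> H \<times> K \<times> H\<close> with the form
  \<open>f(a'\<^sup>*a) + \<langle>x, x'\<rangle> + \<langle>y, y'\<rangle> + \<langle>\<triangle>\<^sub>R z, z'\<rangle>\<close>, where \<open>f\<close> is a faithful positive functional, and the algebra acts
  by left multiplication, \<open>\<pi>\<close>, \<open>\<rho>\<close> and \<open>\<chi>\<close>; the first factor makes the action faithful. The map
  \<open>x \<mapsto> (Rx, x)\<close> from \<open>H\<close> to the last two factors is isometric, because
  \<open>\<parallel>Rx\<parallel>\<^sup>2 + \<langle>\<triangle>\<^sub>R x, x\<rangle> = \<parallel>x\<parallel>\<^sup>2\<close>, and it compresses \<open>\<rho> \<oplus> \<chi>\<close> to \<open>R\<^sup>*\<rho>R + \<chi>\<triangle>\<^sub>R\<close>. The operator \<open>K\<close> below is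
  the projection onto the other three factors, and \<open>L\<close> is this isometry on the factor \<open>H\<close>.\<close>

theorem hyperrigid_compression:
  fixes G :: "'a::unital_cstar_algebra set"
    and \<pi> :: "'a \<Rightarrow> 'h::complex_hilbert_space \<Rightarrow> 'h"
    and \<rho> :: "'a \<Rightarrow> 'k::complex_hilbert_space \<Rightarrow> 'k"
  assumes G: "hyperrigid G"
    and chi: "character chi" "G \<subseteq> {a. chi a = 0}"
    and sep: "separable_space (euclidean :: 'h topology)" "separable_space (euclidean :: 'k topology)"
    and \<pi>: "cstar_representation UNIV \<pi>"
    and \<rho>: "cstar_representation UNIV \<rho>"
    and R: "contraction R"
    and comp: "\<forall>g\<in>G. \<pi> g = cadjoint R \<circ> \<rho> g \<circ> R"
  shows "\<pi> a x = cadjoint R (\<rho> a (R x)) + chi a *\<^sub>C defect R x"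
proof -
  have "countable G" "generates G" using G by (auto simp: hyperrigid_def)
  then obtain DA :: "'a set" where DA: "countable DA" "closure DA = UNIV"
    by (rule countable_generated_separable)
  obtain DH :: "'h set" where DH: "countable DH" "closure DH = UNIV"
    using separable_space_dense[OF sep(1)] .
  obtain DK :: "'k set" where DK: "countable DK" "closure DK = UNIV"
    using separable_space_dense[OF sep(2)] .
  obtain f :: "'a \<Rightarrow> complex" where f: "positive_functional f" "\<And>x. cmod (f x) \<le> 4 * norm x"
    "\<And>a. f (star a * a) = 0 \<Longrightarrow> a = 0"
    using faithful_positive_functional[OF DA] by blast
  have f_add: "f (x + y) = f x + f y" and f_scaleC: "f (c *\<^sub>C x) = c * f x"
    and f_star: "f (star x) = cnj (f x)" and f_pos: "0 \<le> Re (f (star x * x))" for x y c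
    using f(1) by (auto simp: positive_functional_def)
  have f0: "f 0 = 0" using f_add[of 0 0] by simp
  have bR: "bounded_clinear R" using R by (simp add: contraction_def)
  note bRa = bounded_clinear_cadjoint[OF bR] and bD = bounded_clinear_defect[OF bR]
  note Rlin = bounded_clinearD[OF bR] and Ralin = bounded_clinearD[OF bRa]
    and Dlin = bounded_clinearD[OF bD]
  have \<pi>': "bounded_clinear (\<pi> a)" "\<pi> (a + b) = (\<lambda>x. \<pi> a x + \<pi> b x)" "\<pi> (c *\<^sub>C a) = (\<lambda>x. c *\<^sub>C \<pi> a x)"
    "\<pi> (a * b) x = \<pi> a (\<pi> b x)" "\<pi> (star a) = cadjoint (\<pi> a)" "\<pi> 1 x = x" for a b c x
    using \<pi> by (auto simp: cstar_representation_def operators_def identity_on_UNIV)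
  have \<rho>': "bounded_clinear (\<rho> a)" "\<rho> (a + b) = (\<lambda>x. \<rho> a x + \<rho> b x)" "\<rho> (c *\<^sub>C a) = (\<lambda>x. c *\<^sub>C \<rho> a x)"
    "\<rho> (a * b) x = \<rho> a (\<rho> b x)" "\<rho> (star a) = cadjoint (\<rho> a)" "\<rho> 1 x = x" for a b c x
    using \<rho> by (auto simp: cstar_representation_def operators_def identity_on_UNIV)
  have chi': "chi (a + b) = chi a + chi b" "chi (c *\<^sub>C a) = c * chi a" "chi (a * b) = chi a * chi b"
    "chi (star a) = cnj (chi a)" "chi 1 = 1" for a b c
    using chi by (auto simp: character_def)
  have cadd: "cinner (defect R z) z = of_real ((norm z)\<^sup>2 - (norm (R z))\<^sup>2)" for z
    by (simp add: cinner_defect[OF bR] cinner_self)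
  have Re_D: "0 \<le> Re (cinner (defect R z) z)" "Re (cinner (defect R z) z) \<le> (norm z)\<^sup>2" for z
    using power_mono[OF contraction_norm_le[OF R, of z], of 2] by (auto simp: cadd)
  define s where "s = (\<lambda>(a, x::'h, y::'k, z::'h) (a', x', y', z').
    f (star a' * a) + cinner x x' + cinner y y' + cinner (defect R z) z')"
  define \<sigma> where "\<sigma> b = (\<lambda>(a, x, y, z::'h). (b * a, \<pi> b x, \<rho> b y, chi b *\<^sub>C z))" for b
  interpret star_action s \<sigma>
  proof
    show "s (u + v) w = s u w + s v w" for u v w
      by (cases u; cases v; cases w) (simp add: s_def distrib_left f_add cinner_simps Dlin)
    show "s (c *\<^sub>C u) v = c * s u v" for c u v
      by (cases u; cases v) (simp add: s_def mult_scaleC_right f_scaleC cinner_simps Dlin distrib_left)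
    show "s u v = cnj (s v u)" for u v
    proof (cases u; cases v)
      fix a x y z a' x' y' z' assume uv: "u = (a, x, y, z)" "v = (a', x', y', z')"
      have "f (star a' * a) = cnj (f (star a * a'))"
        using f_star[of "star a * a'"] by (simp add: star_mult)
      moreover have "cinner (defect R z) z' = cnj (cinner (defect R z') z)"
        by (simp add: cinner_defect[OF bR] flip: cinner_commute)
      ultimately show ?thesis
        by (simp add: uv s_def flip: cinner_commute)
    qed
    show "0 \<le> Re (s u u)" for u
      by (cases u) (simp add: s_def f_pos cinner_self Re_D add_nonneg_nonneg)
    show "clinear (\<sigma> b)" for b
      by (auto simp: clinear_def \<sigma>_def distrib_left mult_scaleC_right scaleC_add_right
          bounded_clinearD[OF \<pi>'(1)] bounded_clinearD[OF \<rho>'(1)] mult.commute)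
    show "\<sigma> (a + b) v = \<sigma> a v + \<sigma> b v" for a b v
      by (cases v) (simp add: \<sigma>_def distrib_right \<pi>' \<rho>' chi' scaleC_add_left)
    show "\<sigma> (c *\<^sub>C a) v = c *\<^sub>C \<sigma> a v" for c a v
      by (cases v) (simp add: \<sigma>_def mult_scaleC_left \<pi>' \<rho>' chi')
    show "\<sigma> (a * b) v = \<sigma> a (\<sigma> b v)" for a b v
      by (cases v) (simp add: \<sigma>_def mult.assoc \<pi>' \<rho>' chi')
    show "\<sigma> 1 v = v" for v
      by (cases v) (simp add: \<sigma>_def \<pi>' \<rho>' chi')
    show "s (\<sigma> b v) w = s v (\<sigma> (star b) w)" for b v w
      by (cases v; cases w) (simp add: \<sigma>_def s_def star_mult mult.assoc \<pi>' \<rho>' chi'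
          cinner_cadjoint[OF \<pi>'(1)] cinner_cadjoint[OF \<rho>'(1)] cinner_simps Dlin)
  qed
  define K where "K = (\<lambda>(a::'a, x::'h, y::'k, z::'h). (a, 0::'h, y, z))"
  define L where "L = (\<lambda>(a::'a, x::'h, y::'k, z::'h). (0::'a, 0::'h, R x, x))"
  define L' where "L' = (\<lambda>(a::'a, x::'h, y::'k, z::'h). (0::'a, cadjoint R y + defect R z, 0::'k, 0::'h))"
  define v where "v = (0::'a, x, 0::'k, 0::'h)"
  define err where "err = K (\<sigma> a (K v)) + L' (\<sigma> a (L v)) - \<sigma> a v"
  have "s err err = 0"
    unfolding err_def
  proof (rule hyperrigid_kraus[OF G])
    show "countable (DA \<times> DH \<times> DK \<times> DH)" using DA DH DK by blast
    show "\<exists>d\<in>DA \<times> DH \<times> DK \<times> DH. Re (s (v - d) (v - d)) < \<epsilon>" if \<epsilon>: "0 < \<epsilon>" for v \<epsilon>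
    proof -
      obtain a x y z where v: "v = (a, x, y, z)" by (cases v)
      \<comment> \<open>four approximations contribute at most \<open>(4 + 1 + 1 + 1)\<delta>\<^sup>2 < \<epsilon>\<close>\<close>
      define \<delta> where "\<delta> = sqrt \<epsilon> / 4"
      have \<delta>: "0 < \<delta>" "\<delta>\<^sup>2 = \<epsilon> / 16" using \<epsilon> by (auto simp: \<delta>_def power_divide)
      obtain a' x' y' z' where d: "a' \<in> DA" "dist a' a < \<delta>" "x' \<in> DH" "dist x' x < \<delta>"
        "y' \<in> DK" "dist y' y < \<delta>" "z' \<in> DH" "dist z' z < \<delta>"
        using dense_approx[OF DA(2) \<delta>(1)] dense_approx[OF DH(2) \<delta>(1)] dense_approx[OF DK(2) \<delta>(1)]
        by metis
      have sq: "(norm (u - u'))\<^sup>2 \<le> \<epsilon> / 16" if "dist u' u < \<delta>" for u u' :: "'x::real_normed_vector"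
        using power_mono[of "dist u' u" \<delta> 2] that unfolding \<delta>(2) by (simp add: dist_norm norm_minus_commute)
      have "Re (f (star (a - a') * (a - a'))) \<le> 4 * norm (star (a - a') * (a - a'))"
        using complex_Re_le_cmod f(2) order_trans by blast
      also have "\<dots> \<le> 4 * (\<epsilon> / 16)" using sq[OF d(2)] by (simp add: cstar_identity)
      finally have "Re (f (star (a - a') * (a - a'))) \<le> 4 * (\<epsilon> / 16)" .
      moreover have "Re (cinner (defect R (z - z')) (z - z')) \<le> \<epsilon> / 16"
        using Re_D(2)[of "z - z'"] sq[OF d(8)] by linarith
      ultimately have "Re (s (v - (a', x', y', z')) (v - (a', x', y', z'))) < \<epsilon>"
        using sq[OF d(4)] sq[OF d(6)] \<epsilon> by (simp add: s_def v cinner_self)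
      then show ?thesis using d by (intro bexI[of _ "(a', x', y', z')"]) auto
    qed
    show "b = 0" if "\<And>v. s (\<sigma> b v) (\<sigma> b v) = 0" for b
      using that[of "(1, 0, 0, 0)"] f(3)[of b]
      by (simp add: \<sigma>_def s_def bounded_clinearD[OF \<pi>'(1)] bounded_clinearD[OF \<rho>'(1)] Dlin)
    show "clinear K" "clinear K" by (auto simp: clinear_def K_def)
    show "s (K v) w = s v (K w)" for v w
      by (cases v; cases w) (simp add: K_def s_def)
    show "clinear L" by (auto simp: clinear_def L_def Rlin)
    show "clinear L'" by (auto simp: clinear_def L'_def Ralin Dlin scaleC_add_right algebra_simps)
    show "s (L v) w = s v (L' w)" for v w
      by (cases v; cases w)
        (simp add: L_def L'_def s_def f0 cinner_simps cinner_cadjoint[OF bR] cinner_defect[OF bR] Rlin Ralin Dlin)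
    show "K (K v) + L' (L v) = v" for v
      by (cases v) (simp add: K_def L_def L'_def defect_def)
    show "K (\<sigma> g (K v)) + L' (\<sigma> g (L v)) = \<sigma> g v" if "g \<in> G" for g v
    proof -
      have "chi g = 0" "\<And>x. \<pi> g x = cadjoint R (\<rho> g (R x))"
        using that chi(2) comp by auto
      then show ?thesis
        by (cases v) (simp add: K_def L_def L'_def \<sigma>_def Dlin bounded_clinearD[OF \<rho>'(1)])
    qed
  qed
  moreover have "err = (0, cadjoint R (\<rho> a (R x)) + chi a *\<^sub>C defect R x - \<pi> a x, 0, 0)"
    by (simp add: err_def v_def K_def L_def L'_def \<sigma>_def Dlin bounded_clinearD[OF \<rho>'(1)]
        zero_prod_def bounded_clinearD[OF \<pi>'(1)])
  ultimately show ?thesis by (simp add: s_def f0 Dlin cinner_self_eq_0)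
qed

section \<open>The decomposition\<close>

lemma cstar_representationD:
  assumes "cstar_representation UNIV \<pi>"
  shows "bounded_clinear (\<pi> a)" "\<pi> (a - b) x = \<pi> a x - \<pi> b x" "\<pi> (c *\<^sub>C a) x = c *\<^sub>C \<pi> a x"
    "\<pi> (a * b) x = \<pi> a (\<pi> b x)" "\<pi> 1 x = x" "cinner (\<pi> a x) y = cinner x (\<pi> (star a) y)"
proof -
  have add: "\<pi> (a + b) x = \<pi> a x + \<pi> b x" for a b x
    using assms by (simp add: cstar_representation_def)
  show bl: "bounded_clinear (\<pi> a)" using assms by (simp add: cstar_representation_def operators_def)
  show "\<pi> (a - b) x = \<pi> a x - \<pi> b x" using add[of "a - b" b x] by simp
  show "\<pi> (c *\<^sub>C a) x = c *\<^sub>C \<pi> a x" "\<pi> (a * b) x = \<pi> a (\<pi> b x)" "\<pi> 1 x = x"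
    using assms by (auto simp: cstar_representation_def identity_on_UNIV)
  have "\<pi> (star a) = cadjoint (\<pi> a)" using assms by (simp add: cstar_representation_def)
  then show "cinner (\<pi> a x) y = cinner x (\<pi> (star a) y)" by (simp add: cinner_cadjoint[OF bl])
qed

lemma characterD:
  assumes "character chi"
  shows "chi (a - b) = chi a - chi b" "chi (c *\<^sub>C a) = c * chi a" "chi (a * b) = chi a * chi b"
    "chi (star a) = cnj (chi a)" "chi 1 = 1"
proof -
  have "chi (a - b + b) = chi (a - b) + chi b" using assms by (simp only: character_def)
  then show "chi (a - b) = chi a - chi b" by simp
qed (use assms in \<open>auto simp: character_def\<close>)

context
  fixes chi :: "'a::unital_cstar_algebra \<Rightarrow> complex"
    and \<pi> :: "'a \<Rightarrow> 'h::complex_hilbert_space \<Rightarrow> 'h"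
    and \<rho> :: "'a \<Rightarrow> 'k::complex_hilbert_space \<Rightarrow> 'k"
    and R :: "'h \<Rightarrow> 'k"
  assumes chi: "character chi"
    and \<pi>: "cstar_representation UNIV \<pi>"
    and \<rho>: "cstar_representation UNIV \<rho>"
    and R: "contraction R"
    and compression: "\<And>a x. \<pi> a x = cadjoint R (\<rho> a (R x)) + chi a *\<^sub>C defect R x"
begin

text \<open>For \<open>a \<in> ker \<chi>\<close> put \<open>w = \<rho>(a)Rx\<close>, so that \<open>\<pi>(a)x = R\<^sup>*w\<close>. The identity for \<open>a\<^sup>*a\<close> gives
  \<open>\<parallel>R\<^sup>*w\<parallel> = \<parallel>w\<parallel>\<close>, and a contraction \<open>R\<close> with this property satisfies \<open>RR\<^sup>*w = w\<close>. A general \<open>a\<close> differs from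
  an element of \<open>ker \<chi>\<close> by a scalar.\<close>

lemma intertwines: "\<rho> a (R x) = R (\<pi> a x)"
proof -
  have bR: "bounded_clinear R" using R by (simp add: contraction_def)
  have kernel: "\<rho> a (R x) = R (\<pi> a x)" if "chi a = 0" for a x
  proof -
    define w where "w = \<rho> a (R x)"
    have \<pi>a: "\<pi> a x = cadjoint R w" using compression[of a x] that by (simp add: w_def)
    have "cinner (\<pi> a x) (\<pi> a x) = cinner x (\<pi> (star a * a) x)"
      by (simp add: cstar_representationD[OF \<pi>])
    also have "\<dots> = cinner x (cadjoint R (\<rho> (star a) w))"
      using compression[of "star a * a" x] that
      by (simp add: characterD[OF chi] cstar_representationD[OF \<rho>] w_def)
    also have "\<dots> = cinner w w"
      by (simp add: cinner_cadjoint[OF bR, symmetric] cstar_representationD(6)[OF \<rho>, symmetric] w_def)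
    finally have eq: "(norm (cadjoint R w))\<^sup>2 = (norm w)\<^sup>2"
      by (simp add: \<pi>a cinner_self flip: of_real_power)
    define r where "r = R (cadjoint R w)"
    have wr: "cinner w r = of_real ((norm (cadjoint R w))\<^sup>2)" "cinner r w = of_real ((norm (cadjoint R w))\<^sup>2)"
      unfolding r_def cinner_cadjoint[OF bR] cinner_cadjoint_right[OF bR] by (rule cinner_self)+
    have "cinner (w - r) (w - r) = cinner w w - cinner r w - (cinner w r - cinner r r)"
      by (simp only: cinner_diff_left cinner_diff_right)
    also have "\<dots> = of_real ((norm w)\<^sup>2 - 2 * (norm (cadjoint R w))\<^sup>2 + (norm r)\<^sup>2)"
      unfolding wr cinner_self by simp
    finally have "(norm (w - R (cadjoint R w)))\<^sup>2
        = (norm w)\<^sup>2 - 2 * (norm (cadjoint R w))\<^sup>2 + (norm (R (cadjoint R w)))\<^sup>2"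
      unfolding cinner_self of_real_eq_iff r_def .
    also have "\<dots> \<le> 0"
      using eq power_mono[OF contraction_norm_le[OF R, of "cadjoint R w"], of 2] by simp
    finally have "w = R (cadjoint R w)" by simp
    then show ?thesis by (simp add: w_def \<pi>a)
  qed
  have "chi (a - chi a *\<^sub>C 1) = 0" by (simp add: characterD[OF chi])
  from kernel[OF this, of x] show ?thesis
    by (simp add: cstar_representationD[OF \<rho>] cstar_representationD[OF \<pi>] bounded_clinearD[OF bR])
qed

text \<open>For \<open>a \<in> ker \<chi>\<close> the identity and the intertwining relation give \<open>\<pi>(a) = R\<^sup>*R\<pi>(a)\<close>, that is
  \<open>\<triangle>\<^sub>R\<pi>(a) = 0\<close>; take adjoints.\<close>

lemma defect_in_chi_space: "defect R x \<in> chi_space chi \<pi>"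
proof -
  have bR: "bounded_clinear R" using R by (simp add: contraction_def)
  have kernel: "\<pi> a (defect R x) = 0" if "chi a = 0" for a
  proof -
    have "chi (star a) = 0" using that by (simp add: characterD[OF chi])
    then have "\<pi> (star a) y = cadjoint R (R (\<pi> (star a) y))" for y
      using compression[of "star a" y] by (simp add: intertwines)
    then have "defect R (\<pi> (star a) y) = 0" for y by (simp add: defect_def)
    then have "cinner (\<pi> a (defect R x)) y = cinner 0 y" for y
      using cinner_defect[OF bR, of x "\<pi> (star a) y"] by (simp add: cstar_representationD(6)[OF \<pi>])
    then show ?thesis by (rule eq_if_cinner_eq)
  qed
  have "\<pi> a (defect R x) - chi a *\<^sub>C defect R x = 0" for a
  proof -
    have "chi (a - chi a *\<^sub>C 1) = 0" by (simp add: characterD[OF chi])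
    from kernel[OF this] show ?thesis by (simp add: cstar_representationD[OF \<pi>])
  qed
  then show ?thesis by (simp add: chi_space_def)
qed

end

lemma closed_csubspace_chi_space:
  assumes "cstar_representation UNIV \<pi>"
  shows "closed_csubspace (chi_space chi \<pi>)"
proof -
  note bl = cstar_representationD(1)[OF assms]
  have "bounded_clinear (\<lambda>x. \<pi> a x - chi a *\<^sub>C x)" for a
    by (intro bounded_clinear_diff bounded_clinear_scaleC bounded_clinear_ident bl)
  then have "closed {x. \<pi> a x - chi a *\<^sub>C x = 0}" for a
    by (intro closed_Collect_eq continuous_on_const linear_continuous_on) (simp add: bounded_clinear_def)
  then have "closed (chi_space chi \<pi>)" unfolding chi_space_def by (intro closed_INT) auto
  then show ?thesis
    by (auto simp: closed_csubspace_def complex_vector.subspace_def chi_space_def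
        bounded_clinearD[OF bl] scaleC_add_right mult.commute algebra_simps)
qed

lemma reduces_rep_if_invariant:
  assumes \<pi>: "cstar_representation UNIV \<pi>" and M: "closed_csubspace M"
    and inv: "\<And>a x. x \<in> M \<Longrightarrow> \<pi> a x \<in> M"
  shows "reduces_rep M \<pi>"
  unfolding reduces_rep_def reduces_def
proof (intro allI conjI M image_subsetI inv)
  fix a y assume "y \<in> orth_compl M"
  then have "cinner (\<pi> a y) m = 0" if "m \<in> M" for m
    using orth_complD(1)[OF _ inv[OF that]] by (simp add: cstar_representationD(6)[OF \<pi>])
  then show "\<pi> a y \<in> orth_compl M" by (simp add: orth_compl_def)
qed

lemma reduces_rep_orth_compl: "reduces_rep M \<pi> \<Longrightarrow> reduces_rep (orth_compl M) \<pi>"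
  by (auto simp: reduces_rep_def reduces_def closed_csubspace_orth_compl orth_compl_orth_compl)

lemma orthogonal_sum_orth_compl:
  assumes "closed_csubspace M"
  shows "orthogonal_sum (orth_compl M) M"
  unfolding orthogonal_sum_def
proof (intro conjI allI closed_csubspace_orth_compl assms)
  show "orthogonal_sets (orth_compl M) M"
    using orth_complD(1) by (auto simp: orthogonal_sets_def)
  fix x
  show "\<exists>x0\<in>orth_compl M. \<exists>x1\<in>M. x = x0 + x1"
    using identity_on_mem[OF assms, of x]
    by (intro bexI[of _ "x - identity_on M x"] bexI[of _ "identity_on M x"]) auto
qed

lemma identity_on_orth_compl:
  assumes "closed_csubspace M"
  shows "identity_on (orth_compl M) x = x - identity_on M x"
  using identity_on_mem[OF assms, of x]
  by (intro identity_on_eqI closed_csubspace_orth_compl) (simp_all add: orth_compl_orth_compl[OF assms])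

text \<open>The intertwining relation makes \<open>R(N)\<close> itself invariant under \<open>\<rho>\<close>, so that the closed span
  involves only \<open>a = 1\<close>.\<close>

lemma cyclic_span_of_reducing:
  assumes \<rho>: "cstar_representation UNIV \<rho>" and bR: "bounded_clinear R"
    and \<pi>: "cstar_representation UNIV \<pi>" and N: "reduces_rep N \<pi>"
    and intertw: "\<And>a x. \<rho> a (R x) = R (\<pi> a x)"
  shows "cyclic_span \<rho> R N = closure (R ` N)" "closed_csubspace (closure (R ` N))"
    "reduces_rep (closure (R ` N)) \<rho>"
proof -
  have Ninv: "\<pi> a x \<in> N" if "x \<in> N" for a x
    using N that by (auto simp: reduces_rep_def reduces_def)
  have Ncs: "closed_csubspace N" using N by (simp add: reduces_rep_def reduces_def)
  note Nd = closed_csubspaceD[OF Ncs]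
  have RN: "csubspace (R ` N)"
    unfolding complex_vector.subspace_def
  proof (intro conjI ballI allI)
    show "0 \<in> R ` N" using bounded_clinearD(4)[OF bR] Nd(1) by (metis imageI)
    fix x assume "x \<in> R ` N"
    then obtain u where u: "u \<in> N" "x = R u" by blast
    have "R (c *\<^sub>C u) \<in> R ` N" for c using Nd(3)[OF u(1)] by (rule imageI)
    then show "c *\<^sub>C x \<in> R ` N" for c by (simp add: u bounded_clinearD[OF bR])
    fix y assume "y \<in> R ` N"
    then obtain v where v: "v \<in> N" "y = R v" by blast
    have "R (u + v) \<in> R ` N" using Nd(2)[OF u(1) v(1)] by (rule imageI)
    then show "x + y \<in> R ` N" by (simp add: u v bounded_clinearD[OF bR])
  qed
  have "(\<Union>a. \<rho> a ` R ` N) = R ` N"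
  proof
    show "(\<Union>a. \<rho> a ` R ` N) \<subseteq> R ` N" using Ninv by (auto simp: intertw)
    show "R ` N \<subseteq> (\<Union>a. \<rho> a ` R ` N)"
    proof
      fix y assume "y \<in> R ` N"
      then have "\<rho> 1 y \<in> \<rho> 1 ` R ` N" by (rule imageI)
      then show "y \<in> (\<Union>a. \<rho> a ` R ` N)" using cstar_representationD(5)[OF \<rho>, of y] by auto
    qed
  qed
  then show "cyclic_span \<rho> R N = closure (R ` N)"
    unfolding cyclic_span_def closed_cspan_def
    using complex_vector.span_eq_iff[THEN iffD2, OF RN] by (simp only:)
  show cs: "closed_csubspace (closure (R ` N))" by (rule closed_csubspace_closure[OF RN])
  have "\<rho> a ` closure (R ` N) \<subseteq> closure (R ` N)" for a
  proof (rule image_closure_subset)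
    show "continuous_on (closure (R ` N)) (\<rho> a)"
      using cstar_representationD(1)[OF \<rho>] by (intro linear_continuous_on) (simp add: bounded_clinear_def)
    show "\<rho> a ` R ` N \<subseteq> closure (R ` N)"
      using Ninv closure_subset[of "R ` N"] by (auto simp: intertw)
  qed simp
  then show "reduces_rep (closure (R ` N)) \<rho>"
    by (intro reduces_rep_if_invariant \<rho> cs) blast
qed

text \<open>The summands of \<open>R\<close> are determined by \<open>R\<close>, so assertions about every splitting reduce to one.\<close>

lemma splits_as_unique:
  assumes M: "closed_csubspace M"
    and split: "splits_as R (orth_compl M) M K0 K1 R0 R1"
  shows "R0 = (\<lambda>x. R (identity_on (orth_compl M) x))"
proof
  fix x
  define x0 where "x0 = identity_on (orth_compl M) x"
  have x0: "x0 \<in> orth_compl M"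
    unfolding x0_def by (rule identity_on_mem(1)[OF closed_csubspace_orth_compl])
  have "R0 x = R0 x0"
  proof -
    have op: "bounded_clinear R0" "\<And>y. y \<in> orth_compl (orth_compl M) \<Longrightarrow> R0 y = 0"
      using split by (auto simp: splits_as_def operators_def)
    have "R0 (x - x0) = 0"
      unfolding x0_def by (rule op(2)[OF identity_on_mem(2)[OF closed_csubspace_orth_compl]])
    then show ?thesis by (simp add: bounded_clinearD[OF op(1)])
  qed
  also have "\<dots> = R x0" using split x0 by (auto simp: splits_as_def operators_def)
  finally show "R0 x = R (identity_on (orth_compl M) x)" by (simp add: x0_def)
qed

theorem theorem2p8:
  fixes G :: "'a::unital_cstar_algebra set"
    and chi :: "'a \<Rightarrow> complex"
    and \<pi> :: "'a \<Rightarrow> 'h::complex_hilbert_space \<Rightarrow> 'h"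
    and \<rho> :: "'a \<Rightarrow> 'k::complex_hilbert_space \<Rightarrow> 'k"
    and R :: "'h \<Rightarrow> 'k"
    and M :: "'h set"
    and L L' :: "'k set"
  assumes "hyperrigid G"
    and "character chi"
    and "G \<subseteq> {a. chi a = 0}"
    and "separable_space (euclidean :: 'h topology)"
    and "separable_space (euclidean :: 'k topology)"
    and "cstar_representation UNIV \<pi>"
    and "cstar_representation UNIV \<rho>"
    and "contraction R"
    and "\<forall>g\<in>G. \<pi> g = cadjoint R \<circ> \<rho> g \<circ> R"
    and "M = chi_space chi \<pi>"
    and "L = cyclic_span \<rho> R M"
    and "L' = cyclic_span \<rho> R (orth_compl M)"
  shows
    \<comment> \<open>(i)\<close>
    "(reduces_rep M \<pi> \<and> reduces M (cadjoint R \<circ> R) \<and> reduces M (defect R)) \<and>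
    \<comment> \<open>(ii)\<close>
     (reduces_rep L \<rho> \<and> reduces_rep L' \<rho>) \<and>
    \<comment> \<open>(iii)\<close>
     (L = closure (R ` M) \<and> L' = closure (R ` orth_compl M) \<and> orthogonal_sets L L') \<and>
    \<comment> \<open>(iv)\<close>
     (R ` M \<subseteq> chi_space chi \<rho> \<and> range (defect R) \<subseteq> M) \<and>
    \<comment> \<open>(v)\<close>
     isometric_chi_decomposition chi \<pi> \<rho> R (orth_compl M) M (orth_compl L) L \<and>
    \<comment> \<open>(vi)\<close>
     (\<forall>R0 R1. splits_as R (orth_compl M) M (orth_compl L) L R0 R1 \<longrightarrow>
        (\<forall>a. \<forall>x\<in>orth_compl M. R0 (\<pi> a x) = \<rho> a (R0 x))) \<and>
    \<comment> \<open>moreover\<close>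
     (cyclic_span \<rho> R UNIV = UNIV \<longrightarrow>
        L' = orth_compl L \<and>
        (\<forall>R0 R1. splits_as R (orth_compl M) M (orth_compl L) L R0 R1 \<longrightarrow>
           unitary_op (orth_compl M) (orth_compl L) R0) \<and>
        unitary_chi_decomposition chi \<pi> \<rho> R (orth_compl M) M (orth_compl L) L)"
proof -
  note M_def = assms(10) and L_def = assms(11) and L'_def = assms(12)
  note chi = assms(2) and \<pi> = assms(6) and \<rho> = assms(7) and R = assms(8)
  have bR: "bounded_clinear R" using R by (simp add: contraction_def)
  note compression = hyperrigid_compression[OF assms(1-9)]
  have intertw: "\<rho> a (R x) = R (\<pi> a x)" for a x
    by (rule intertwines[OF chi \<pi> \<rho> R compression])
  note Rlin = bounded_clinearD[OF bR] and Dlin = bounded_clinearD[OF bounded_clinear_defect[OF bR]]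
  have M: "closed_csubspace M" unfolding M_def by (rule closed_csubspace_chi_space[OF \<pi>])
  note Mperp = closed_csubspace_orth_compl[of M]
  have \<pi>M: "\<pi> a x = chi a *\<^sub>C x" if "x \<in> M" for a x
    using that by (auto simp: M_def chi_space_def)
  have defM: "defect R x \<in> M" for x
    unfolding M_def by (rule defect_in_chi_space[OF chi \<pi> \<rho> R compression])
  have def0: "defect R x = 0" if "x \<in> orth_compl M" for x
  proof (rule eq_if_cinner_eq)
    fix z
    show "cinner (defect R x) z = cinner 0 z"
      using orth_complD(1)[OF that defM, of z] cinner_defect[OF bR, of x z] by simp
  qed
  have RR: "cadjoint R (R x) = x - defect R x" for x by (simp add: defect_def)
  have \<pi>_red: "reduces_rep M \<pi>"
    using \<pi>M closed_csubspaceD(3)[OF M] by (intro reduces_rep_if_invariant \<pi> M) simp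
  note \<pi>_redp = reduces_rep_orth_compl[OF \<pi>_red]
  have red_def: "reduces M (defect R)"
    unfolding reduces_def
  proof (intro conjI M image_subsetI)
    show "defect R x \<in> orth_compl M" if "x \<in> orth_compl M" for x
      by (simp add: def0[OF that] closed_csubspaceD(1)[OF Mperp])
  qed (rule defM)
  have red_RR: "reduces M (cadjoint R \<circ> R)"
    unfolding reduces_def
  proof (intro conjI M image_subsetI)
    show "(cadjoint R \<circ> R) x \<in> M" if "x \<in> M" for x
      using closed_csubspaceD(4)[OF M that defM] by (simp add: RR)
    show "(cadjoint R \<circ> R) x \<in> orth_compl M" if "x \<in> orth_compl M" for x
      using that by (simp add: RR def0)
  qed
  have cyc: "cyclic_span \<rho> R N = closure (R ` N)" "closed_csubspace (closure (R ` N))"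
    "reduces_rep (closure (R ` N)) \<rho>" if "reduces_rep N \<pi>" for N
    by (rule cyclic_span_of_reducing[OF \<rho> bR \<pi> that], rule intertw)+
  note cycM = cyc[OF \<pi>_red] and cycMp = cyc[OF \<pi>_redp]
  have L: "L = closure (R ` M)" using cycM(1) by (simp add: L_def)
  have L': "L' = closure (R ` orth_compl M)" using cycMp(1) by (simp add: L'_def)
  have Lcs: "closed_csubspace L" "reduces_rep L \<rho>" using cycM(2,3) by (simp_all add: L)
  have L'cs: "closed_csubspace L'" "reduces_rep L' \<rho>" using cycMp(2,3) by (simp_all add: L')
  note Lperp = closed_csubspace_orth_compl[of L]
  have Rperp: "R x \<in> orth_compl L" if "x \<in> orth_compl M" for x
  proof -
    have "cinner (R x) (R m) = 0" if "m \<in> M" for m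
      using cinner_cadjoint[OF bR, of m "R x"] orth_complD[OF \<open>x \<in> orth_compl M\<close> that]
      by (simp add: RR def0[OF \<open>x \<in> orth_compl M\<close>] cinner_eq_0_commute[of "R x"])
    then have "R x \<in> orth_compl (R ` M)" by (auto simp: orth_compl_def)
    then show ?thesis by (simp add: L orth_compl_closure)
  qed
  have L'L: "L' \<subseteq> orth_compl L"
    unfolding L' using Rperp closed_csubspaceD(6)[OF Lperp] by (intro closure_minimal) auto
  then have orthLL': "orthogonal_sets L L'"
    using orth_complD(2) by (auto simp: orthogonal_sets_def)
  have RM: "R ` M \<subseteq> chi_space chi \<rho>"
    by (auto simp: chi_space_def intertw \<pi>M Rlin)
  then have "L \<subseteq> chi_space chi \<rho>"
    unfolding L by (rule closure_minimal[OF _ closed_csubspaceD(6)[OF closed_csubspace_chi_space[OF \<rho>]]])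
  then have \<rho>L: "\<rho> a y = chi a *\<^sub>C y" if "y \<in> L" for a y
    using that by (auto simp: chi_space_def)
  define R0 where "R0 = (\<lambda>x. R (identity_on (orth_compl M) x))"
  define R1 where "R1 = (\<lambda>x. R (identity_on M x))"
  have R0x: "R0 x = R x" if "x \<in> orth_compl M" for x
    by (simp add: R0_def identity_on_of_mem[OF Mperp that])
  have bR0: "bounded_clinear R0"
    unfolding R0_def by (rule bounded_clinear_compose[OF bR bounded_clinear_identity_on[OF Mperp]])
  have R0op: "R0 \<in> operators (orth_compl M) (orth_compl L)"
    using bR0 Rperp[OF identity_on_mem(1)[OF Mperp]]
    by (auto simp: operators_def R0_def identity_on_of_orth[OF Mperp] Rlin)
  have R1op: "R1 \<in> operators M L"
  proof -
    have "bounded_clinear R1"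
      unfolding R1_def by (rule bounded_clinear_compose[OF bR bounded_clinear_identity_on[OF M]])
    moreover have "R1 x \<in> L" for x
      using closure_subset[of "R ` M"] identity_on_mem(1)[OF M, of x] by (auto simp: R1_def L)
    ultimately show ?thesis
      by (auto simp: operators_def R1_def identity_on_of_orth[OF M] Rlin)
  qed
  have "R x = R0 x + R1 x" for x
    by (simp add: R0_def R1_def identity_on_orth_compl[OF M] Rlin)
  then have split: "splits_as R (orth_compl M) M (orth_compl L) L R0 R1"
    using R0op R1op by (auto simp: splits_as_def)
  have unique: "R0' = R0" if "splits_as R (orth_compl M) M (orth_compl L) L R0' R1'" for R0' R1'
    unfolding R0_def by (rule splits_as_unique[OF M that])
  have cR0: "cadjoint R0 = (\<lambda>y. identity_on (orth_compl M) (cadjoint R y))"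
    unfolding R0_def
    by (simp add: cadjoint_compose[OF bR bounded_clinear_identity_on[OF Mperp]] cadjoint_identity_on[OF Mperp])
  have R0R0: "cadjoint R0 (R0 x) = identity_on (orth_compl M) x" for x
    using identity_on_mem(1)[OF Mperp, of x]
    by (simp add: cR0) (simp add: R0_def RR def0 identity_on_of_mem[OF Mperp])
  have iso: "isometric_op (orth_compl M) (orth_compl L) R0"
    using R0op R0R0 by (auto simp: isometric_op_def)
  have \<pi>inv: "\<pi> a x \<in> orth_compl M" if "x \<in> orth_compl M" for a x
    using \<pi>_redp that by (auto simp: reduces_rep_def reduces_def)
  have R0\<pi>: "R0 (\<pi> a x) = \<rho> a (R0 x)" if "x \<in> orth_compl M" for a x
    using that \<pi>inv[OF that, of a] by (simp add: R0x intertw)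
  have decomp: "chi_decomposition P chi \<pi> \<rho> R (orth_compl M) M (orth_compl L) L"
    if "P (orth_compl M) (orth_compl L) R0" for P
    unfolding chi_decomposition_def
  proof (intro conjI)
    show "\<exists>R0 R1. splits_as R (orth_compl M) M (orth_compl L) L R0 R1 \<and> P (orth_compl M) (orth_compl L) R0 \<and>
        (\<forall>a. \<forall>x\<in>orth_compl M. \<pi> a x = cadjoint R0 (\<rho> a (R0 x)))"
    proof (intro exI conjI allI ballI)
      fix a x assume x: "x \<in> orth_compl M"
      show "\<pi> a x = cadjoint R0 (\<rho> a (R0 x))"
        unfolding R0\<pi>[OF x, symmetric] R0R0 by (rule identity_on_of_mem[OF Mperp \<pi>inv[OF x], symmetric])
    qed (rule split that)+
  qed (use \<pi>M \<rho>L in \<open>auto intro: orthogonal_sum_orth_compl M Lcs \<pi>_red \<pi>_redp reduces_rep_orth_compl\<close>)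
  have moreover_part: "L' = orth_compl L \<and> unitary_op (orth_compl M) (orth_compl L) R0"
    if full: "cyclic_span \<rho> R UNIV = UNIV"
  proof
    have "reduces_rep UNIV \<pi>"
      by (intro reduces_rep_if_invariant \<pi> closed_csubspace_UNIV) simp
    from cyc(1)[OF this] have dense: "closure (range R) = UNIV"
      using full by simp
    \<comment> \<open>a vector orthogonal to \<open>L\<close> and to \<open>L\'\<close> is orthogonal to the dense range of \<open>R\<close>\<close>
    have "orth_compl L \<subseteq> L'"
    proof
      fix y assume y: "y \<in> orth_compl L"
      define z where "z = y - identity_on L' y"
      have zL': "z \<in> orth_compl L'" unfolding z_def by (rule identity_on_mem(2)[OF L'cs(1)])
      have zL: "z \<in> orth_compl L"
        unfolding z_def using y L'L identity_on_mem(1)[OF L'cs(1), of y]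
        by (intro closed_csubspaceD(4)[OF Lperp]) auto
      have "cinner z (R x) = 0" for x
      proof -
        have "R0 x \<in> L'"
          using closure_subset[of "R ` orth_compl M"] identity_on_mem(1)[OF Mperp, of x]
          by (auto simp: R0_def L')
        moreover have "R1 x \<in> L" using R1op by (auto simp: operators_def)
        moreover have "R x = R0 x + R1 x" using split by (simp add: splits_as_def)
        ultimately show ?thesis
          using orth_complD(1)[OF zL'] orth_complD(1)[OF zL] by (simp add: cinner_add_right)
      qed
      then have "z \<in> orth_compl (range R)" by (auto simp: orth_compl_def)
      then have "z \<in> orth_compl (closure (range R))" by (simp only: orth_compl_closure)
      then have "z = 0" using orth_compl_disjoint[of z UNIV] dense by simp
      then show "y \<in> L'" using identity_on_mem(1)[OF L'cs(1), of y] by (simp add: z_def)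
    qed
    then show L'eq: "L' = orth_compl L" using L'L by blast
    have "R0 (cadjoint R0 y) = identity_on (orth_compl L) y" for y
    proof -
      define y0 where "y0 = identity_on (orth_compl L) y"
      have y0: "y0 \<in> closure (R ` orth_compl M)" "y - y0 \<in> orth_compl (orth_compl L)"
        using identity_on_mem[OF Lperp, of y] L'eq by (simp_all add: y0_def L')
      note bcR0 = bounded_clinear_cadjoint[OF bR0]
      have "cinner x (cadjoint R0 (y - y0)) = cinner x 0" for x
        using R0op orth_complD(2)[OF y0(2), of "R0 x"]
        by (auto simp: operators_def cinner_cadjoint[OF bR0, symmetric])
      then have "cadjoint R0 (y - y0) = 0" by (rule eq_if_cinner_eq_right)
      then have "cadjoint R0 y = cadjoint R0 y0" by (simp add: bounded_clinearD[OF bcR0])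
      moreover have "closure (R ` orth_compl M) \<subseteq> {z. R0 (cadjoint R0 z) = z}"
      proof (rule closure_minimal)
        show "closed {z. R0 (cadjoint R0 z) = z}"
          using bounded_clinear_compose[OF bR0 bcR0]
          by (intro closed_Collect_eq linear_continuous_on bounded_linear_ident) (simp add: bounded_clinear_def)
        show "R ` orth_compl M \<subseteq> {z. R0 (cadjoint R0 z) = z}"
        proof (intro subsetI CollectI)
          fix z assume "z \<in> R ` orth_compl M"
          then obtain x where x: "x \<in> orth_compl M" "z = R0 x" using R0x by auto
          then show "R0 (cadjoint R0 z) = z" by (simp add: R0R0 identity_on_of_mem[OF Mperp])
        qed
      qed
      ultimately show ?thesis using y0(1) by (auto simp: y0_def[symmetric])
    qed
    then show "unitary_op (orth_compl M) (orth_compl L) R0"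
      using iso by (auto simp: unitary_op_def isometric_op_def fun_eq_iff)
  qed
  show ?thesis
  proof (intro conjI allI impI ballI)
    fix R0' R1' a x
    assume "splits_as R (orth_compl M) M (orth_compl L) L R0' R1'" "x \<in> orth_compl M"
    then show "R0' (\<pi> a x) = \<rho> a (R0' x)" using unique R0\<pi> by blast
  next
    fix R0' R1'
    assume "cyclic_span \<rho> R UNIV = UNIV" "splits_as R (orth_compl M) M (orth_compl L) L R0' R1'"
    then show "unitary_op (orth_compl M) (orth_compl L) R0'" using unique moreover_part by blast
  next
    assume "cyclic_span \<rho> R UNIV = UNIV"
    then show "unitary_chi_decomposition chi \<pi> \<rho> R (orth_compl M) M (orth_compl L) L"
      using moreover_part by (intro decomp) blast
  next
    show "isometric_chi_decomposition chi \<pi> \<rho> R (orth_compl M) M (orth_compl L) L"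
      by (rule decomp[of isometric_op, OF iso])
  qed (use \<pi>_red red_def red_RR Lcs L'cs L L' orthLL' RM defM moreover_part in auto)
qed

end
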